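(* Let $X$ be a real nonzero Banach space and $S,T:X\rightrightarrows X^*$ maximal monotone operators of Gossez type (D) with strong representative functions $h_S,h_T$ such that $\operatorname{pr}_{X^*}(\operatorname{dom}h_S)\cap\operatorname{pr}_{X^*}(\operatorname{dom}h_T)\neq\emptyset$. Assume one of: (a) $0\in{}^{ic}\big(\operatorname{pr}_{X^*}(\operatorname{dom}h_S)-\operatorname{pr}_{X^*}(\operatorname{dom}h_T)\big)$; (b) the set $\{(u^*,v^*,u^{**}+v^{**},r): r\in\mathbb R,\ h_S^*(u^*,u^{**})+h_T^*(v^*,v^{**})\le r\}$ is closed regarding $\Delta_{X^*}\times X^{**}\times\mathbb R$ in $(X^*,w^* )\times(X^*,w^* )\times(X^{**},w^* )\times\mathbb R$. Then: (i) $h:=\operatorname{cl}_{\|\cdot\|\times\|\cdot\|_*}(h_S\square_1h_T)$ is a strong representative function of $\overline S\|\overline T$, and $\overline S\|\overline T$ is maximal monotone of Gossez type (D); (ii) if $D(\overline S)\subseteq X$ (or $D(\overline T)\subseteq X$), then $h$ is a strong representative function of $S\|T$ and $S\|T$ is maximal monotone of Gossez type (D).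
   Context: $X$ identified with its image in $X^{**}$. $G,D$ denote graph and domain; $M^{-1}$ inverse operator. Coupling $c(x,x^* )=\langle x^*,x\rangle$. Conjugate of $h$ on $X\times X^*$: $h^*(x^*,x^{**})=\sup_{(x,y^* )}\{\langle x^*,x\rangle+\langle x^{**},y^*\rangle-h(x,y^* )\}$. Representative function of monotone $S$: convex norm-lsc $h_S$ with $h_S\ge c$ and $G(S)\subseteq\{h_S=c\}$; strong if $h_S^*(x^*,x^{**})\ge\langle x^{**},x^*\rangle$ for all. Gossez's closure $\overline S:X^{**}\rightrightarrows X^*$ has graph $\{(x^{**},x^* ):\langle x^{**}-y,x^*-y^*\rangle\ge0\ \forall(y,y^* )\in G(S)\}$; maximal monotone $S$ is of Gossez type (D) if each point of $G(\overline S)$ is the $w^*\times\|\cdot\|_*$-limit of a bounded net in $G(S)$. $(h_S\square_1h_T)(x,x^* )=\inf\{h_S(u,x^* )+h_T(w,x^* ):u,w\in X,\ u+w=x\}$. Parallel sums: $S\|T(x)=(S^{-1}+T^{-1})^{-1}(x)$ and $\overline S\|\overline T(x)=(\overline S^{-1}+\overline T^{-1})^{-1}(x)$ for $x\in X$. $\Delta_{X^*}=\{(x^*,x^* )\}$. Closed regarding $W$: $\operatorname{cl}D\cap W=D\cap W$. ${}^{ic}D=\operatorname{icr}D$ if $\operatorname{aff}D$ closed, else $\emptyset$, with $\operatorname{icr}D=\{u:\forall x\in\operatorname{aff}(D-D)\ \exists\delta>0\ \forall\lambda\in[0,\delta]:u+\lambda x\in D\}$. *)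

theory Defs
  imports "HOL-Analysis.Analysis"
begin

(* X is a real Banach space ('a::banach); X^* = 'a \<Rightarrow>\<^sub>L real; X^** = ('a \<Rightarrow>\<^sub>L real) \<Rightarrow>\<^sub>L real.
   Operators X \<rightrightarrows> X^* are represented by their graphs ('a \<times> ('a \<Rightarrow>\<^sub>L real)) set.
   Functions on X \<times> X^* take values in ereal. *)

definition canon :: "'a::real_normed_vector \<Rightarrow> ('a \<Rightarrow>\<^sub>L real) \<Rightarrow>\<^sub>L real" where
  "canon x = Blinfun (\<lambda>f. blinfun_apply f x)"

definition wstar :: "('b::real_normed_vector \<Rightarrow>\<^sub>L real) topology" where
  "wstar = pullback_topology UNIV (\<lambda>f x. blinfun_apply f x) (product_topology (\<lambda>_. euclideanreal) UNIV)"

definition monotone_op :: "('a::real_normed_vector \<times> ('a \<Rightarrow>\<^sub>L real)) set \<Rightarrow> bool" where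
  "monotone_op G \<longleftrightarrow> (\<forall>(x,xs)\<in>G. \<forall>(y,ys)\<in>G. blinfun_apply (xs - ys) (x - y) \<ge> 0)"

definition max_monotone :: "('a::real_normed_vector \<times> ('a \<Rightarrow>\<^sub>L real)) set \<Rightarrow> bool" where
  "max_monotone G \<longleftrightarrow> monotone_op G \<and> (\<forall>G'. monotone_op G' \<and> G \<subseteq> G' \<longrightarrow> G' = G)"

definition gossez :: "('a::real_normed_vector \<times> ('a \<Rightarrow>\<^sub>L real)) set
    \<Rightarrow> ((('a \<Rightarrow>\<^sub>L real) \<Rightarrow>\<^sub>L real) \<times> ('a \<Rightarrow>\<^sub>L real)) set" where
  "gossez G = {(xss, xs). \<forall>(y,ys)\<in>G. blinfun_apply (xss - canon y) (xs - ys) \<ge> 0}"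

(* Gossez type (D): every point of the Gossez closure is the (w* x norm)-limit of a bounded
  net in G(S); equivalently it lies in the (w* x norm)-closure of (the image of) a bounded subset of G(S). *)
definition type_D :: "('a::real_normed_vector \<times> ('a \<Rightarrow>\<^sub>L real)) set \<Rightarrow> bool" where
  "type_D G \<longleftrightarrow> (\<forall>p\<in>gossez G. \<exists>B. B \<subseteq> G \<and> bounded B \<and>
      p \<in> (prod_topology wstar euclidean) closure_of ((\<lambda>(x,xs). (canon x, xs)) ` B))"

definition max_monotone_D :: "('a::real_normed_vector \<times> ('a \<Rightarrow>\<^sub>L real)) set \<Rightarrow> bool" where
  "max_monotone_D G \<longleftrightarrow> max_monotone G \<and> type_D G"

definition epi :: "('z \<Rightarrow> ereal) \<Rightarrow> ('z \<times> real) set" where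
  "epi h = {(z, r). h z \<le> ereal r}"

definition representative ::
  "('a::real_normed_vector \<times> ('a \<Rightarrow>\<^sub>L real)) set \<Rightarrow> ('a \<times> ('a \<Rightarrow>\<^sub>L real) \<Rightarrow> ereal) \<Rightarrow> bool" where
  "representative G h \<longleftrightarrow> convex (epi h) \<and> closed (epi h) \<and>
     (\<forall>x xs. ereal (blinfun_apply xs x) \<le> h (x, xs)) \<and>
     (\<forall>(x,xs)\<in>G. h (x, xs) = ereal (blinfun_apply xs x))"

definition conj ::
  "('a::real_normed_vector \<times> ('a \<Rightarrow>\<^sub>L real) \<Rightarrow> ereal) \<Rightarrow> ('a \<Rightarrow>\<^sub>L real) \<times> (('a \<Rightarrow>\<^sub>L real) \<Rightarrow>\<^sub>L real) \<Rightarrow> ereal" where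
  "conj h = (\<lambda>(xs, xss). SUP (x, ys)\<in>UNIV. ereal (blinfun_apply xs x + blinfun_apply xss ys) - h (x, ys))"

definition strong_representative ::
  "('a::real_normed_vector \<times> ('a \<Rightarrow>\<^sub>L real)) set \<Rightarrow> ('a \<times> ('a \<Rightarrow>\<^sub>L real) \<Rightarrow> ereal) \<Rightarrow> bool" where
  "strong_representative G h \<longleftrightarrow> representative G h \<and>
     (\<forall>xs xss. ereal (blinfun_apply xss xs) \<le> conj h (xs, xss))"

definition infconv1 ::
  "('a::real_normed_vector \<times> ('a \<Rightarrow>\<^sub>L real) \<Rightarrow> ereal) \<Rightarrow> ('a \<times> ('a \<Rightarrow>\<^sub>L real) \<Rightarrow> ereal)
     \<Rightarrow> 'a \<times> ('a \<Rightarrow>\<^sub>L real) \<Rightarrow> ereal" where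
  "infconv1 hS hT = (\<lambda>(x, xs). INF (u, w)\<in>{(u, w). u + w = x}. hS (u, xs) + hT (w, xs))"

definition lsc_hull :: "('z::topological_space \<Rightarrow> ereal) \<Rightarrow> 'z \<Rightarrow> ereal" where
  "lsc_hull h z = (INF r\<in>{r. (z, r) \<in> closure (epi h)}. ereal r)"

definition par_sum ::
  "('a::real_normed_vector \<times> ('a \<Rightarrow>\<^sub>L real)) set \<Rightarrow> ('a \<times> ('a \<Rightarrow>\<^sub>L real)) set \<Rightarrow> ('a \<times> ('a \<Rightarrow>\<^sub>L real)) set" where
  "par_sum S T = {(x, xs). \<exists>u w. u + w = x \<and> (u, xs) \<in> S \<and> (w, xs) \<in> T}"

definition par_sum_bar ::
  "('a::real_normed_vector \<times> ('a \<Rightarrow>\<^sub>L real)) set \<Rightarrow> ('a \<times> ('a \<Rightarrow>\<^sub>L real)) set \<Rightarrow> ('a \<times> ('a \<Rightarrow>\<^sub>L real)) set" where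
  "par_sum_bar S T = {(x, xs). \<exists>uss vss. uss + vss = canon x \<and> (uss, xs) \<in> gossez S \<and> (vss, xs) \<in> gossez T}"

definition pr_dual_dom :: "('a \<times> 'b \<Rightarrow> ereal) \<Rightarrow> 'b set" where
  "pr_dual_dom h = {xs. \<exists>x. h (x, xs) < \<infinity>}"

definition icr :: "'b::real_vector set \<Rightarrow> 'b set" where
  "icr D = {u. \<forall>x\<in>affine hull {a - b | a b. a \<in> D \<and> b \<in> D}.
              \<exists>\<delta>>0. \<forall>t\<in>{0..\<delta>}. u + t *\<^sub>R x \<in> D}"

definition ic :: "'b::real_normed_vector set \<Rightarrow> 'b set" where
  "ic D = (if closed (affine hull D) then icr D else {})"

definition closed_regarding :: "'z topology \<Rightarrow> 'z set \<Rightarrow> 'z set \<Rightarrow> bool" where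
  "closed_regarding Tp D W \<longleftrightarrow> (Tp closure_of D) \<inter> W = D \<inter> W"

end

theory Submission
  imports Defs
begin

text \<open>Write \<open>c\<close> for the coupling. If \<open>h \<ge> c\<close> is convex and lower semicontinuous and its conjugate also
  dominates the coupling, then \<open>{h = c}\<close> is maximal monotone of type (D): Fenchel duality makes the
  infimum of \<open>h\<close>, recentred at any point, plus half the squared norms vanish; iterating this yields a
  Brondsted--Rockafellar property without Ekeland's principle, and rescaling the two norms
  against each other yields \<open>inf \<langle>zss - y, zs - ys\<rangle> \<le> 0\<close> over \<open>{h = c}\<close> for all bidual points. The largest
  representative function of \<open>{h = c}\<close> is therefore strong as well, its conjugate touches the coupling
  exactly on the Gossez closure, and a Fenchel duality argument with a penalty that Goldstine's
  theorem keeps harmless produces the bounded nets.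

  It remains to see that \<open>h = cl (hS \<box> hT)\<close> is of this kind and that \<open>{h = c}\<close> is the extended parallel
  sum. Both follow once the conjugate of \<open>hS \<box> hT\<close> is the exact infimal convolution of the conjugates
  in the second variable, since type (D) identifies the Gossez closures of \<open>S\<close> and \<open>T\<close> with the sets where
  the conjugates of \<open>hS\<close> and \<open>hT\<close> touch the coupling. Under (a) exactness is a subgradient of the value
  function, continuous at \<open>0\<close> by Baire category; under (b) it is a weak-star separation argument.\<close>

subsection \<open>Hahn--Banach\<close>

text \<open>Condition (a) works with the norm topology, condition (b) with the weak-star one.
  Hahn--Banach is therefore stated for an arbitrary sublinear majorant: a multiple of the norm
  yields bounded functionals, a finite sum of absolute evaluations yields evaluations at points of
  the predual.

  Conjugates are handled through real upper bounds, that is, as inclusions of the epigraph in a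
  halfspace. This mostly avoids extended-real arithmetic, and such bounds pass to closures and
  convex hulls.

  Without reflexivity infima are not attained, and a bidual point cannot be the centre of a norm
  penalty on \<open>X\<close>. Approximate minimisers have to be pushed into the contact set at a
  cost governed by their gap, so bounds on their norms must be fixed before the gap is chosen; this
  dictates the order of the constants.

  Type (D) is proved through the largest representative function and not through \<open>h\<close>,
  because a point of the Gossez closure bounds the conjugate of the former directly.\<close>

definition sublinear :: "('e::real_vector \<Rightarrow> real) \<Rightarrow> bool" where
  "sublinear p \<longleftrightarrow> (\<forall>x y. p (x + y) \<le> p x + p y) \<and> (\<forall>t>0. \<forall>x. p (t *\<^sub>R x) \<le> t * p x)"

lemma sublinear_add: "sublinear p \<Longrightarrow> p (x + y) \<le> p x + p y"
  by (simp add: sublinear_def)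

lemma sublinear_scale:
  assumes "sublinear p" "t > 0"
  shows "p (t *\<^sub>R x) = t * p x"
proof (rule antisym)
  show "p (t *\<^sub>R x) \<le> t * p x"
    using assms by (simp add: sublinear_def)
  have "p ((1 / t) *\<^sub>R (t *\<^sub>R x)) \<le> (1 / t) * p (t *\<^sub>R x)"
    using assms unfolding sublinear_def by (metis zero_less_divide_1_iff)
  then show "t * p x \<le> p (t *\<^sub>R x)"
    using assms by (simp add: field_simps)
qed

lemma sublinear_0: "sublinear p \<Longrightarrow> p 0 = 0"
  using sublinear_scale[of p 2 0] by simp

lemma sublinear_minus: "sublinear p \<Longrightarrow> - p (- x) \<le> p x"
  using sublinear_add[of p x "- x"] sublinear_0[of p] by simp

text \<open>The largest sublinear functional \<open>q \<le> p\<close> with \<open>q (- a) \<le> s\<close> for all \<open>(a, s)\<close>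
  in the convex cone \<open>K\<close>.\<close>

definition cone_lower :: "('e::real_vector \<Rightarrow> real) \<Rightarrow> ('e \<times> real) set \<Rightarrow> 'e \<Rightarrow> real" where
  "cone_lower p K x = (INF (a, s)\<in>K. p (x + a) + s)"

context
  fixes p :: "'e::real_vector \<Rightarrow> real" and K
  assumes p: "sublinear p" and K: "convex_cone K"
    and nonneg: "\<And>a s. (a, s) \<in> K \<Longrightarrow> 0 \<le> p a + s"
begin

lemma cone_lower_le:
  assumes "(a, s) \<in> K"
  shows "cone_lower p K x \<le> p (x + a) + s"
proof -
  have "- p (- x) \<le> p (x + a) + s" if "(a, s) \<in> K" for a s
    using nonneg[OF that] sublinear_add[OF p, of "- x" "x + a"] by simp
  then have "bdd_below ((\<lambda>(a, s). p (x + a) + s) ` K)"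
    by (auto intro!: bdd_belowI[of _ "- p (- x)"])
  from cINF_lower[OF this assms] show ?thesis
    by (simp add: cone_lower_def)
qed

lemma cone_lower_greatest:
  assumes "\<And>a s. (a, s) \<in> K \<Longrightarrow> b \<le> p (x + a) + s"
  shows "b \<le> cone_lower p K x"
  unfolding cone_lower_def using assms convex_cone_nonempty[OF K]
  by (intro cINF_greatest) auto

lemma cone_lower_le_self: "cone_lower p K x \<le> p x"
  using cone_lower_le[of 0 0 x] convex_cone_contains_0[OF K] by (simp add: zero_prod_def)

lemma cone_lower_minus: "(a, s) \<in> K \<Longrightarrow> cone_lower p K (- a) \<le> s"
  using cone_lower_le[of a s "- a"] sublinear_0[OF p] by simp

text \<open>The two operations of the cone match the two properties: adding two members gives
  subadditivity, scaling one gives homogeneity.\<close>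

lemma sublinear_cone_lower: "sublinear (cone_lower p K)"
  unfolding sublinear_def
proof (intro conjI allI impI)
  fix x y
  have "cone_lower p K (x + y) - (p (y + b) + t) \<le> cone_lower p K x" if "(b, t) \<in> K" for b t
  proof (rule cone_lower_greatest)
    fix a s assume "(a, s) \<in> K"
    then have "(a + b, s + t) \<in> K"
      using convex_cone_add[OF K _ that] by fastforce
    from cone_lower_le[OF this, of "x + y"]
    show "cone_lower p K (x + y) - (p (y + b) + t) \<le> p (x + a) + s"
      using sublinear_add[OF p, of "x + a" "y + b"] by (simp add: algebra_simps)
  qed
  then have "cone_lower p K (x + y) - cone_lower p K x \<le> cone_lower p K y"
    by (intro cone_lower_greatest) (smt (verit))
  then show "cone_lower p K (x + y) \<le> cone_lower p K x + cone_lower p K y"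
    by simp
next
  fix t :: real and x assume t: "t > 0"
  have "cone_lower p K (t *\<^sub>R x) / t \<le> cone_lower p K x"
  proof (rule cone_lower_greatest)
    fix a s assume "(a, s) \<in> K"
    then have "(t *\<^sub>R a, t * s) \<in> K"
      using convex_cone_scaleR[OF K, of t "(a, s)"] t by simp
    from cone_lower_le[OF this, of "t *\<^sub>R x"]
    have "cone_lower p K (t *\<^sub>R x) \<le> t * (p (x + a) + s)"
      using sublinear_scale[OF p t, of "x + a"] by (simp add: algebra_simps)
    then show "cone_lower p K (t *\<^sub>R x) / t \<le> p (x + a) + s"
      using t by (simp add: field_simps)
  qed
  then show "cone_lower p K (t *\<^sub>R x) \<le> t * cone_lower p K x"
    using t by (simp add: field_simps)
qed

end

lemma minimal_sublinear_linear:
  assumes p: "sublinear p"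
    and minimal: "\<And>q. sublinear q \<Longrightarrow> q \<le> p \<Longrightarrow> q = p"
  shows "linear p"
proof -
  have add: "p (x + y) = p x + p y" for x y
  proof (rule antisym)
    \<comment> \<open>The cone is chosen so that lowering \<open>p\<close> along it forces
      \<open>p x + p y \<le> p (x + y)\<close>; by minimality the lowered functional is
      \<open>p\<close> itself.\<close>
    define K where "K = conic hull {(y, - p y)}"
    have K: "convex_cone K"
      unfolding K_def by (simp add: convex_cone_def convex_conic_hull conic_conic_hull conic_hull_eq_empty)
    have nonneg: "0 \<le> p a + s" if "(a, s) \<in> K" for a s
      using that sublinear_scale[OF p, of _ y] sublinear_0[OF p]
      by (fastforce simp: K_def conic_hull_explicit le_less)
    have "cone_lower p K = p"
      by (intro minimal sublinear_cone_lower le_funI cone_lower_le_self p K nonneg)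
    moreover have "(y, - p y) \<in> K"
      unfolding K_def by (intro hull_inc) auto
    ultimately show "p x + p y \<le> p (x + y)"
      using cone_lower_le[OF p K nonneg, of y "- p y" x] by simp
  qed (rule sublinear_add[OF p])
  have minus: "p (- x) = - p x" for x
    using add[of x "- x"] sublinear_0[OF p] by simp
  show ?thesis
  proof (rule linearI)
    fix c :: real and x
    consider "c > 0" | "c = 0" | "c < 0" by linarith
    then show "p (c *\<^sub>R x) = c *\<^sub>R p x"
    proof cases
      case 3
      then have "p (- (c *\<^sub>R x)) = - c * p x"
        using sublinear_scale[OF p, of "- c" x] by simp
      then show ?thesis by (simp add: minus)
    qed (auto simp: sublinear_scale[OF p] sublinear_0[OF p])
  qed (rule add)
qed

text \<open>Zorn's lemma for the reversed pointwise order; a minimal sublinear functional is linear.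
  The pointwise infimum of a chain is finite because every sublinear \<open>q \<le> p\<close>
  satisfies \<open>- p (- x) \<le> q x\<close>.\<close>

theorem hahn_banach_sublinear:
  assumes p: "sublinear p"
  shows "\<exists>L. linear L \<and> L \<le> p"
proof -
  define A where "A = {q. sublinear q \<and> q \<le> p}"
  have "\<exists>m\<in>A. \<forall>a\<in>A. m \<ge> a \<longrightarrow> a = m"
  proof (rule predicate_Zorn)
    show "partial_order_on A (relation_of (\<ge>) A)"
      by (auto simp: partial_order_on_def preorder_on_def refl_on_def trans_def antisym_def
          relation_of_def)
  next
    fix C assume C: "C \<in> Chains (relation_of (\<ge>) A)"
    then have CA: "C \<subseteq> A" and total: "\<And>f g. f \<in> C \<Longrightarrow> g \<in> C \<Longrightarrow> f \<le> g \<or> g \<le> f"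
      by (auto simp: Chains_def relation_of_def)
    show "\<exists>u\<in>A. \<forall>a\<in>C. a \<ge> u"
    proof (cases "C = {}")
      case True
      then show ?thesis using p by (auto simp: A_def)
    next
      case False
      define u where "u x = (INF q\<in>C. q x)" for x
      have lb: "- p (- x) \<le> q x" if "q \<in> C" for q x
      proof -
        have "sublinear q" "q (- x) \<le> p (- x)"
          using CA that by (auto simp: A_def le_fun_def)
        then show ?thesis using sublinear_minus[of q x] by linarith
      qed
      have bdd: "bdd_below ((\<lambda>q. q x) ` C)" for x
        using lb by (auto intro!: bdd_belowI[of _ "- p (- x)"])
      have le: "u x \<le> q x" if "q \<in> C" for q x
        unfolding u_def by (rule cINF_lower[OF bdd that])
      have greatest: "b \<le> u x" if "\<And>q. q \<in> C \<Longrightarrow> b \<le> q x" for b x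
        unfolding u_def using False that by (rule cINF_greatest)
      have "sublinear u"
        unfolding sublinear_def
      proof (intro conjI allI impI)
        fix x y
        have "u (x + y) - q y \<le> u x" if q: "q \<in> C" for q
        proof (rule greatest)
          fix r assume r: "r \<in> C"
          \<comment> \<open>Subadditivity of the infimum must bound \<open>r x + q y\<close> for two
            members of the chain; the smaller one bounds both terms at once.\<close>
          define m where "m = (if q \<le> r then q else r)"
          have m: "m \<in> C" "m \<le> q" "m \<le> r"
            using total[OF q r] q r by (auto simp: m_def)
          then have "u (x + y) \<le> m x + m y"
            using le[OF m(1), of "x + y"] CA sublinear_add[of m x y] by (fastforce simp: A_def)
          then show "u (x + y) - q y \<le> r x"
            using m(2,3) by (simp add: le_fun_def) (smt (verit))
        qed
        then have "u (x + y) - u x \<le> u y"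
          by (intro greatest) (smt (verit))
        then show "u (x + y) \<le> u x + u y" by simp
      next
        fix t :: real and x assume t: "t > 0"
        have "u (t *\<^sub>R x) / t \<le> u x"
        proof (rule greatest)
          fix q assume q: "q \<in> C"
          then have "u (t *\<^sub>R x) \<le> t * q x"
            using le[OF q, of "t *\<^sub>R x"] CA sublinear_scale[of q t x] t by (auto simp: A_def)
          then show "u (t *\<^sub>R x) / t \<le> q x"
            using t by (simp add: field_simps)
        qed
        then show "u (t *\<^sub>R x) \<le> t * u x"
          using t by (simp add: field_simps)
      qed
      moreover have "u \<le> p"
      proof (rule le_funI)
        fix x
        obtain q where q: "q \<in> C" using False by blast
        then have "q x \<le> p x" using CA by (auto simp: A_def le_fun_def)
        then show "u x \<le> p x" using le[OF q, of x] by linarith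
      qed
      ultimately show ?thesis
        using le by (intro bexI[of _ u]) (auto simp: A_def le_fun_def)
    qed
  qed
  then obtain m where m: "m \<in> A" "\<And>a. a \<in> A \<Longrightarrow> a \<le> m \<Longrightarrow> a = m" by blast
  have "linear m"
    using m by (intro minimal_sublinear_linear) (auto simp: A_def)
  then show ?thesis using m(1) by (auto simp: A_def)
qed

text \<open>A Mazur--Orlicz type statement. Subtracting \<beta> from the second coordinate makes the
  bound homogeneous, so it extends to the cone generated by the set, where \<open>cone_lower\<close>
  applies.\<close>

theorem hahn_banach_lagrange:
  fixes C :: "('e::real_vector \<times> real) set"
  assumes p: "sublinear p" and C: "convex C"
    and bound: "\<And>w r. (w, r) \<in> C \<Longrightarrow> \<beta> \<le> p w + r"
  shows "\<exists>L. linear L \<and> L \<le> p \<and> (\<forall>(w, r)\<in>C. \<beta> \<le> L w + r)"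
proof (cases "C = {}")
  case True
  then show ?thesis using hahn_banach_sublinear[OF p] by auto
next
  case False
  define D where "D = (\<lambda>x. x + (0, - \<beta>)) ` C"
  define K where "K = conic hull D"
  have "convex D"
    unfolding D_def using convex_translation[OF C, of "(0, - \<beta>)"] by (simp add: add.commute image_def)
  have K: "convex_cone K"
    using False \<open>convex D\<close>
    by (simp add: K_def D_def convex_cone_def convex_conic_hull conic_conic_hull conic_hull_eq_empty)
  have nonneg: "0 \<le> p a + s" if as: "(a, s) \<in> K" for a s
  proof -
    obtain c w r where cwr: "0 \<le> c" "(w, r) \<in> C" "(a, s) = c *\<^sub>R (w, r - \<beta>)"
      using as by (auto simp: K_def conic_hull_explicit D_def)
    show ?thesis
    proof (cases "c = 0")
      case True
      then show ?thesis using cwr sublinear_0[OF p] by simp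
    next
      case False
      then have "p a + s = c * (p w + r - \<beta>)"
        using cwr sublinear_scale[OF p, of c w] by (simp add: algebra_simps)
      then show ?thesis using bound[OF cwr(2)] cwr(1) by simp
    qed
  qed
  obtain L where L: "linear L" "L \<le> cone_lower p K"
    using hahn_banach_sublinear[OF sublinear_cone_lower[OF p K nonneg]] by blast
  have "\<beta> \<le> L w + r" if "(w, r) \<in> C" for w r
  proof -
    have "(w, r - \<beta>) \<in> K"
      using that unfolding K_def D_def by (intro hull_inc) force
    then have "L (- w) \<le> r - \<beta>"
      using cone_lower_minus[OF p K nonneg] L(2) by (meson le_funE order_trans)
    then show ?thesis using linear_neg[OF L(1), of w] by simp
  qed
  moreover have "L \<le> p"
    using L(2) cone_lower_le_self[OF p K nonneg] by (auto simp: le_fun_def intro: order_trans)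
  ultimately show ?thesis using L(1) by blast
qed

section \<open>Bounded functionals, separation and subgradients\<close>

lemma linear_le_norm_blinfun:
  fixes L :: "'e::real_normed_vector \<Rightarrow> real"
  assumes L: "linear L" and le: "\<And>x. L x \<le> M * norm x"
  obtains f :: "'e \<Rightarrow>\<^sub>L real" where "blinfun_apply f = L"
proof -
  have "norm (L x) \<le> norm x * M" for x
    using le[of x] le[of "- x"] linear_neg[OF L, of x] by (simp add: algebra_simps)
  then have "bounded_linear L"
    using L by (intro bounded_linear_intro[of _ M]) (auto simp: linear_add linear_scale)
  from bounded_linear_Blinfun_apply[OF this] that show ?thesis by blast
qed

lemma blinfun_prodE:
  fixes f :: "('a::real_normed_vector \<times> 'b::real_normed_vector) \<Rightarrow>\<^sub>L real"
  obtains a :: "'a \<Rightarrow>\<^sub>L real" and b :: "'b \<Rightarrow>\<^sub>L real" where "\<And>x y. f (x, y) = a x + b y"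
proof -
  have "bounded_linear (\<lambda>x. f (x, 0))" "bounded_linear (\<lambda>y. f (0, y))"
    by (intro bounded_linear_compose[OF blinfun.bounded_linear_right] bounded_linear_Pair
        bounded_linear_ident bounded_linear_zero)+
  note * = this[THEN bounded_linear_Blinfun_apply]
  show ?thesis
  proof (rule that)
    show "f (x, y) = Blinfun (\<lambda>x. f (x, 0)) x + Blinfun (\<lambda>y. f (0, y)) y" for x y
      unfolding * using blinfun.add_right[of f "(x, 0)" "(0, y)"] by simp
  qed
qed

lemma sublinear_norm: "0 \<le> M \<Longrightarrow> sublinear (\<lambda>x. M * norm x)"
  unfolding sublinear_def
  by (auto simp: mult_left_mono[OF norm_triangle_ineq] simp flip: distrib_left)

lemma sublinear_sum_abs:
  assumes "\<And>i. i \<in> I \<Longrightarrow> linear (f i)"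
  shows "sublinear (\<lambda>x. \<Sum>i\<in>I. \<bar>f i x :: real\<bar>)"
  unfolding sublinear_def
proof (intro conjI allI impI)
  fix x y
  have "(\<Sum>i\<in>I. \<bar>f i (x + y)\<bar>) \<le> (\<Sum>i\<in>I. \<bar>f i x\<bar> + \<bar>f i y\<bar>)"
    using assms by (intro sum_mono) (simp add: linear_add)
  then show "(\<Sum>i\<in>I. \<bar>f i (x + y)\<bar>) \<le> (\<Sum>i\<in>I. \<bar>f i x\<bar>) + (\<Sum>i\<in>I. \<bar>f i y\<bar>)"
    by (simp add: sum.distrib)
next
  fix t :: real and x assume "t > 0"
  then show "(\<Sum>i\<in>I. \<bar>f i (t *\<^sub>R x)\<bar>) \<le> t * (\<Sum>i\<in>I. \<bar>f i x\<bar>)"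
    using assms by (simp add: linear_scale abs_mult sum_distrib_left)
qed

text \<open>Since \<open>p\<close> is arbitrary, this separates in the norm topology and in the
  weak-star topology alike; \<beta> is the distance kept between \<open>z\<close> and
  \<open>C\<close> in the sense of \<open>p\<close>.\<close>

lemma convex_separation:
  fixes C :: "'e::real_vector set"
  assumes p: "sublinear p" and C: "convex C" and bound: "\<And>x. x \<in> C \<Longrightarrow> \<beta> \<le> p (x - z)"
  obtains L where "linear L" "L \<le> p" "\<And>x. x \<in> C \<Longrightarrow> L z + \<beta> \<le> L x"
proof -
  have "convex ((\<lambda>x. x - z) ` C \<times> {0::real})"
    using C by (intro convex_Times convex_translation_subtract) auto
  then obtain L where L: "linear L" "L \<le> p"
    "\<forall>(w, r)\<in>(\<lambda>x. x - z) ` C \<times> {0}. \<beta> \<le> L w + r"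
    using hahn_banach_lagrange[OF p, of "(\<lambda>x. x - z) ` C \<times> {0}" \<beta>] bound by auto
  show ?thesis
    using L(3) by (intro that[OF L(1,2)]) (auto simp: linear_diff[OF L(1)])
qed

text \<open>\<open>Q\<close> stands for the epigraph of a convex value function that is at most
  \<open>K\<close> near the origin of \<open>Y\<close> and at least \<beta> at the origin. If
  \<beta> is the value at the origin, \<open>L\<close> is a subgradient there.\<close>

lemma marginal_subgradient:
  fixes Q :: "('e::real_normed_vector \<times> real) set"
  assumes Q: "convex Q" and Y: "subspace Y" and QY: "\<And>w r. (w, r) \<in> Q \<Longrightarrow> w \<in> Y"
    and d: "d > 0" and K: "\<And>w. w \<in> Y \<Longrightarrow> norm w < d \<Longrightarrow> \<exists>r\<le>K. (w, r) \<in> Q"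
    and \<beta>: "\<And>r. (0, r) \<in> Q \<Longrightarrow> \<beta> \<le> r"
  obtains L :: "'e \<Rightarrow>\<^sub>L real" where "\<And>w r. (w, r) \<in> Q \<Longrightarrow> \<beta> + L w \<le> r"
proof -
  have "\<beta> \<le> K"
    using K[of 0] \<beta> d subspace_0[OF Y] by force
  define M where "M = 2 * (K - \<beta>) / d"
  have M: "0 \<le> M" using \<open>\<beta> \<le> K\<close> d by (simp add: M_def)
  have "\<beta> \<le> M * norm w + r" if wr: "(w, r) \<in> Q" for w r
  proof (cases "w = 0")
    case True
    then show ?thesis using \<beta> wr by simp
  next
    case False
    define n where "n = norm w"
    have n: "n > 0" using False by (simp add: n_def)
    \<comment> \<open>The point opposite to \<open>w\<close>, of norm \<open>d / 2\<close>. The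
      segment from \<open>w\<close> to \<open>w'\<close> passes through 0, and comparison with
      \<beta> there gives the slope \<open>2 * (K - \<beta>) / d\<close>.\<close>
    define w' where "w' = (- (d / (2 * n))) *\<^sub>R w"
    have "w' \<in> Y"
      unfolding w'_def using QY[OF wr] Y by (intro subspace_scale)
    moreover have "norm w' < d"
      using n d by (simp add: w'_def flip: n_def)
    ultimately obtain r' where r': "r' \<le> K" "(w', r') \<in> Q"
      using K by blast
    define u where "u = n / (n + d / 2)"
    define t where "t = (d / 2) / (n + d / 2)"
    have tu: "0 \<le> t" "0 \<le> u" "t + u = 1"
      using n d by (auto simp: t_def u_def divide_simps)
    have "t *\<^sub>R (w, r) + u *\<^sub>R (w', r') \<in> Q"
      using wr r'(2) tu by (intro convexD[OF Q])
    moreover have "t *\<^sub>R w + u *\<^sub>R w' = (t - u * (d / (2 * n))) *\<^sub>R w"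
      by (simp add: w'_def scaleR_diff_left)
    moreover have "t - u * (d / (2 * n)) = 0"
      using n by (simp add: t_def u_def divide_simps)
    ultimately have "\<beta> \<le> t * r + u * r'"
      by (intro \<beta>) simp
    also have "\<dots> \<le> t * r + u * K"
      using r'(1) tu by (simp add: mult_left_mono)
    finally have "\<beta> * (n + d / 2) \<le> (t * r + u * K) * (n + d / 2)"
      using n d by (intro mult_right_mono) auto
    also have "\<dots> = d / 2 * r + n * K"
    proof -
      have "n + d / 2 \<noteq> 0" using n d by simp
      then have "t * (n + d / 2) = d / 2" "u * (n + d / 2) = n"
        unfolding t_def u_def by (metis nonzero_divide_eq_eq)+
      then have "t * r * (n + d / 2) = d / 2 * r" "u * K * (n + d / 2) = n * K"
        by (metis mult.assoc mult.commute)+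
      then show ?thesis by (simp only: distrib_right)
    qed
    finally have "\<beta> * d \<le> 2 * (K - \<beta>) * n + r * d"
      by (simp add: algebra_simps)
    then show ?thesis
      using d by (simp add: M_def n_def field_simps)
  qed
  then obtain L where L: "linear L" "L \<le> (\<lambda>x. M * norm x)" "\<forall>(w, r)\<in>Q. \<beta> \<le> L w + r"
    using hahn_banach_lagrange[OF sublinear_norm[OF M] Q, of \<beta>] by blast
  obtain f :: "'e \<Rightarrow>\<^sub>L real" where f: "blinfun_apply f = L"
    using L(1,2) by (metis le_fun_def linear_le_norm_blinfun)
  show ?thesis
    using L(3) by (intro that[of "- f"]) (auto simp: blinfun.minus_left f)
qed

text \<open>Serves to recognise a functional dominated by finitely many evaluations as an
  evaluation. In the induction either some \<open>e\<close> is killed by the family but not by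
  \<open>f j\<close>, and subtracting a multiple of \<open>f j\<close> reduces to the smaller
  family, or \<open>f j\<close> vanishes wherever the others do and gets the coefficient 0.\<close>

lemma linear_combination_of_kernels:
  fixes f :: "'i \<Rightarrow> 'e::real_vector \<Rightarrow> real"
  assumes "finite I" "\<And>i. i \<in> I \<Longrightarrow> linear (f i)" "linear L"
    "\<And>x. (\<And>i. i \<in> I \<Longrightarrow> f i x = 0) \<Longrightarrow> L x = 0"
  shows "\<exists>c. \<forall>x. L x = (\<Sum>i\<in>I. c i * f i x)"
  using assms
proof (induction I arbitrary: L rule: finite_induct)
  case empty
  then show ?case by simp
next
  case (insert j I)
  have fj: "linear (f j)" using insert.prems by simp
  show ?case
  proof (cases "\<exists>e. (\<forall>i\<in>I. f i e = 0) \<and> f j e \<noteq> 0")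
    case True
    then obtain e where e: "\<forall>i\<in>I. f i e = 0" "f j e \<noteq> 0" by blast
    define a where "a = L e / f j e"
    define L' where "L' x = L x - a * f j x" for x
    have "linear L'"
      unfolding L'_def using insert.prems(2) fj
      by (intro linearI) (simp_all add: linear_add linear_scale algebra_simps)
    have "L' x = 0" if x: "\<And>i. i \<in> I \<Longrightarrow> f i x = 0" for x
    proof -
      have "L (x - (f j x / f j e) *\<^sub>R e) = 0"
        using e x insert.prems(1)
        by (intro insert.prems(3)) (auto simp: linear_diff linear_scale)
      then show ?thesis
        using e insert.prems(2) by (simp add: L'_def a_def linear_diff linear_scale)
    qed
    with insert.IH[OF _ \<open>linear L'\<close>] insert.prems(1)
    obtain c where c: "\<forall>x. L' x = (\<Sum>i\<in>I. c i * f i x)" by auto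
    have "L x = (\<Sum>i\<in>insert j I. (c(j := a)) i * f i x)" for x
    proof -
      have "(\<Sum>i\<in>I. (c(j := a)) i * f i x) = (\<Sum>i\<in>I. c i * f i x)"
        using insert.hyps by (intro sum.cong) auto
      then show ?thesis
        using c insert.hyps by (simp add: L'_def algebra_simps)
    qed
    then show ?thesis by blast
  next
    case False
    with insert.prems insert.IH[of L] obtain c where c: "\<forall>x. L x = (\<Sum>i\<in>I. c i * f i x)"
      by (metis insert_iff)
    have "L x = (\<Sum>i\<in>insert j I. (c(j := 0)) i * f i x)" for x
    proof -
      have "(\<Sum>i\<in>I. (c(j := 0)) i * f i x) = (\<Sum>i\<in>I. c i * f i x)"
        using insert.hyps by (intro sum.cong) auto
      then show ?thesis
        using c insert.hyps by simp
    qed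
    then show ?thesis by blast
  qed
qed

subsection \<open>Weak-star neighbourhoods\<close>

lemma canon_apply [simp]: "canon x f = f x"
  unfolding canon_def
  by (simp add: bounded_linear_Blinfun_apply blinfun.bounded_linear_left)

lemma canon_add: "canon (x + y) = canon x + canon y"
  by (rule blinfun_eqI) (simp add: blinfun.add_left blinfun.add_right)

lemma canon_diff: "canon (x - y) = canon x - canon y"
  by (rule blinfun_eqI) (simp add: blinfun.diff_left blinfun.diff_right)

lemma norm_blinfun_real: "\<bar>blinfun_apply f x :: real\<bar> \<le> norm f * norm x"
  using norm_blinfun[of f x] by simp

lemma openin_wstar_D:
  assumes "openin wstar U" "f \<in> U"
  obtains F e where "finite F" "0 < e" "\<And>g. (\<And>x. x \<in> F \<Longrightarrow> \<bar>blinfun_apply g x - blinfun_apply f x\<bar> < e) \<Longrightarrow> g \<in> U"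
proof -
  obtain V where V: "openin (product_topology (\<lambda>_. euclideanreal) UNIV) V"
    "U = blinfun_apply -` V"
    using assms(1) by (auto simp: wstar_def openin_pullback_topology)
  have "blinfun_apply f \<in> V" using V(2) assms(2) by simp
  then have "\<exists>W. finite {x \<in> UNIV. W x \<noteq> topspace euclideanreal} \<and>
      (\<forall>x\<in>UNIV. openin euclideanreal (W x)) \<and>
      blinfun_apply f \<in> Pi\<^sub>E UNIV W \<and> Pi\<^sub>E UNIV W \<subseteq> V"
    using V(1) unfolding openin_product_topology_alt by (rule bspec[rotated])
  then obtain W where W: "finite {x. W x \<noteq> UNIV}" "\<And>x. open (W x)"
    "blinfun_apply f \<in> Pi\<^sub>E UNIV W" "Pi\<^sub>E UNIV W \<subseteq> V"
    by auto
  define F where "F = {x. W x \<noteq> UNIV}"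
  have "\<exists>e>0. \<forall>t. \<bar>t - blinfun_apply f x\<bar> < e \<longrightarrow> t \<in> W x" for x
    using W(2,3) by (force simp: open_dist dist_real_def PiE_def)
  then obtain \<epsilon> where \<epsilon>: "\<And>x. \<epsilon> x > 0" "\<And>x t. \<bar>t - blinfun_apply f x\<bar> < \<epsilon> x \<Longrightarrow> t \<in> W x" by metis
  show ?thesis
  proof (rule that)
    show "finite F" using W(1) by (simp add: F_def)
    \<comment> \<open>Inserting 1 keeps the minimum defined and positive when no coordinate is
      restricted.\<close>
    then show "0 < Min (insert 1 (\<epsilon> ` F))" using \<epsilon>(1) by auto
    fix g assume g: "\<And>x. x \<in> F \<Longrightarrow> \<bar>blinfun_apply g x - blinfun_apply f x\<bar> < Min (insert 1 (\<epsilon> ` F))"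
    have "g x \<in> W x" for x
    proof (cases "x \<in> F")
      case True
      then have "\<bar>g x - blinfun_apply f x\<bar> < \<epsilon> x" using g[OF True] \<open>finite F\<close> by auto
      then show ?thesis by (rule \<epsilon>(2))
    qed (simp add: F_def)
    then show "g \<in> U" using V(2) W(4) by auto
  qed
qed

lemma continuous_map_wstar_apply: "continuous_map wstar euclideanreal (\<lambda>f. blinfun_apply f x)"
  unfolding wstar_def
  using continuous_map_pullback[OF continuous_map_product_projection[of x UNIV "\<lambda>_. euclideanreal"]]
  by (simp add: o_def)

lemma topspace_wstar [simp]: "topspace wstar = UNIV"
  by (simp add: wstar_def topspace_pullback_topology)

lemma openin_wstar_ball:
  assumes "finite F"
  shows "openin wstar {g. \<forall>x\<in>F. \<bar>blinfun_apply g x - blinfun_apply f x\<bar> < e}"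
proof -
  have "openin wstar {g. \<bar>blinfun_apply g x - blinfun_apply f x\<bar> < e}" for x
    using openin_continuous_map_preimage[OF continuous_map_wstar_apply[of x], of "{t. \<bar>t - blinfun_apply f x\<bar> < e}"]
    by (simp add: open_Collect_less continuous_intros)
  then have "openin wstar ((\<Inter>x\<in>F. {g. \<bar>blinfun_apply g x - blinfun_apply f x\<bar> < e}) \<inter> topspace wstar)"
    using assms by (intro openin_INT) auto
  moreover have "(\<Inter>x\<in>F. {g. \<bar>blinfun_apply g x - blinfun_apply f x\<bar> < e}) \<inter> topspace wstar
    = {g. \<forall>x\<in>F. \<bar>blinfun_apply g x - blinfun_apply f x\<bar> < e}"
    by auto
  ultimately show ?thesis by simp
qed

lemma openin_prod_topologyE:
  assumes "openin (prod_topology X Y) T" "(x, y) \<in> T"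
  obtains U V where "openin X U" "openin Y V" "x \<in> U" "y \<in> V" "U \<times> V \<subseteq> T"
  using assms unfolding openin_prod_topology_alt by meson

text \<open>Nets become finite sets of test vectors. Type (D) is both constructed and exploited in
  this form.\<close>

lemma closure_of_wstar_norm_iff:
  fixes v :: "'a::real_normed_vector \<Rightarrow>\<^sub>L real" and g :: "'b::metric_space"
  shows "(v, g) \<in> prod_topology wstar euclidean closure_of A \<longleftrightarrow>
    (\<forall>(F::'a set) e. finite F \<longrightarrow> 0 < e \<longrightarrow>
      (\<exists>(v', g')\<in>A. (\<forall>x\<in>F. \<bar>blinfun_apply v' x - blinfun_apply v x\<bar> < e) \<and> dist g' g < e))" (is "?l \<longleftrightarrow> ?r")
proof
  assume l: ?l
  show ?r
  proof (intro allI impI)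
    fix F :: "'a set" and e :: real assume F: "finite F" and e: "0 < e"
    define U where "U = {v'. \<forall>x\<in>F. \<bar>blinfun_apply v' x - blinfun_apply v x\<bar> < e} \<times> ball g e"
    have "openin (prod_topology wstar euclidean) U"
      unfolding U_def using openin_wstar_ball[OF F] by (simp add: openin_prod_Times_iff)
    moreover have "(v, g) \<in> U" using e by (simp add: U_def)
    ultimately obtain y where "y \<in> A" "y \<in> U"
      using l by (auto simp: in_closure_of)
    then show "\<exists>(v', g')\<in>A. (\<forall>x\<in>F. \<bar>blinfun_apply v' x - blinfun_apply v x\<bar> < e) \<and> dist g' g < e"
      by (force simp: U_def dist_commute)
  qed
next
  assume r: ?r
  show ?l
    unfolding in_closure_of
  proof (intro conjI allI impI)
    fix T assume "(v, g) \<in> T \<and> openin (prod_topology wstar euclidean) T"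
    then obtain U V where UV: "openin wstar U" "open V" "v \<in> U" "g \<in> V" "U \<times> V \<subseteq> T"
      by (metis openin_prod_topologyE open_openin)
    obtain F e where F: "finite F" "0 < e"
      "\<And>v'. (\<And>x. x \<in> F \<Longrightarrow> \<bar>blinfun_apply v' x - blinfun_apply v x\<bar> < e) \<Longrightarrow> v' \<in> U"
      using openin_wstar_D[OF UV(1,3)] by metis
    obtain e' where e': "0 < e'" "ball g e' \<subseteq> V"
      using UV(2,4) by (auto simp: open_contains_ball)
    obtain v' g' where vg: "(v', g') \<in> A" "\<forall>x\<in>F. \<bar>blinfun_apply v' x - blinfun_apply v x\<bar> < min e e'"
      "dist g' g < min e e'"
      using r[rule_format, OF F(1), of "min e e'"] F(2) e'(1) by auto
    have "v' \<in> U" using vg(2) by (intro F(3)) auto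
    moreover have "g' \<in> V" using vg(3) e'(2) by (auto simp: dist_commute)
    ultimately show "\<exists>y. y \<in> A \<and> y \<in> T" using UV(5) vg(1) by blast
  qed simp
qed

text \<open>Basic neighbourhoods in the fourfold product of condition (b): a finite test set for
  each weak-star factor and one common radius.\<close>

lemma closure_of_wstar4_I:
  fixes a :: "'a::real_normed_vector \<Rightarrow>\<^sub>L real" and b :: "'b::real_normed_vector \<Rightarrow>\<^sub>L real"
    and c :: "'c::real_normed_vector \<Rightarrow>\<^sub>L real"
  assumes close: "\<And>F G H e. finite F \<Longrightarrow> finite G \<Longrightarrow> finite H \<Longrightarrow> 0 < e \<Longrightarrow>
    \<exists>(a', b', c', r')\<in>A. (\<forall>x\<in>F. \<bar>blinfun_apply a' x - blinfun_apply a x\<bar> < e) \<and>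
      (\<forall>x\<in>G. \<bar>blinfun_apply b' x - blinfun_apply b x\<bar> < e) \<and> (\<forall>x\<in>H. \<bar>blinfun_apply c' x - blinfun_apply c x\<bar> < e) \<and> \<bar>r' - r\<bar> < e"
  shows "(a, b, c, r) \<in>
    prod_topology wstar (prod_topology wstar (prod_topology wstar euclideanreal)) closure_of A"
  unfolding in_closure_of
proof (intro conjI allI impI)
  fix T
  assume "(a, b, c, r) \<in> T \<and>
    openin (prod_topology wstar (prod_topology wstar (prod_topology wstar euclideanreal))) T"
  then have T: "openin (prod_topology wstar (prod_topology wstar (prod_topology wstar euclideanreal))) T"
    "(a, b, c, r) \<in> T" by auto
  obtain U1 V1 where 1: "openin wstar U1"
    "openin (prod_topology wstar (prod_topology wstar euclideanreal)) V1"
    "a \<in> U1" "(b, c, r) \<in> V1" "U1 \<times> V1 \<subseteq> T"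
    using openin_prod_topologyE[OF T] .
  obtain U2 V2 where 2: "openin wstar U2" "openin (prod_topology wstar euclideanreal) V2"
    "b \<in> U2" "(c, r) \<in> V2" "U2 \<times> V2 \<subseteq> V1"
    using openin_prod_topologyE[OF 1(2,4)] .
  obtain U3 V3 where 3: "openin wstar U3" "openin euclideanreal V3"
    "c \<in> U3" "r \<in> V3" "U3 \<times> V3 \<subseteq> V2"
    using openin_prod_topologyE[OF 2(2,4)] .
  obtain F e1 where F: "finite F" "0 < e1"
    "\<And>v'. (\<And>x. x \<in> F \<Longrightarrow> \<bar>blinfun_apply v' x - blinfun_apply a x\<bar> < e1) \<Longrightarrow> v' \<in> U1"
    using openin_wstar_D[OF 1(1,3)] by metis
  obtain G e2 where G: "finite G" "0 < e2"
    "\<And>v'. (\<And>x. x \<in> G \<Longrightarrow> \<bar>blinfun_apply v' x - blinfun_apply b x\<bar> < e2) \<Longrightarrow> v' \<in> U2"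
    using openin_wstar_D[OF 2(1,3)] by metis
  obtain H e3 where H: "finite H" "0 < e3"
    "\<And>v'. (\<And>x. x \<in> H \<Longrightarrow> \<bar>blinfun_apply v' x - blinfun_apply c x\<bar> < e3) \<Longrightarrow> v' \<in> U3"
    using openin_wstar_D[OF 3(1,3)] by metis
  obtain e4 where e4: "0 < e4" "\<And>t. \<bar>t - r\<bar> < e4 \<Longrightarrow> t \<in> V3"
    using 3(2,4) by (auto simp: open_dist dist_real_def)
  define e where "e = min (min e1 e2) (min e3 e4)"
  have e: "e > 0" "e \<le> e1" "e \<le> e2" "e \<le> e3" "e \<le> e4"
    using F(2) G(2) H(2) e4(1) by (auto simp: e_def)
  obtain a' b' c' r' where p: "(a', b', c', r') \<in> A"
    "\<forall>x\<in>F. \<bar>blinfun_apply a' x - blinfun_apply a x\<bar> < e" "\<forall>x\<in>G. \<bar>blinfun_apply b' x - blinfun_apply b x\<bar> < e"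
    "\<forall>x\<in>H. \<bar>blinfun_apply c' x - blinfun_apply c x\<bar> < e" "\<bar>r' - r\<bar> < e"
    using close[OF F(1) G(1) H(1) e(1)] by auto
  have "a' \<in> U1" using p(2) e(2) by (intro F(3)) force
  moreover have "b' \<in> U2" using p(3) e(3) by (intro G(3)) force
  moreover have "c' \<in> U3" using p(4) e(4) by (intro H(3)) force
  moreover have "r' \<in> V3" using p(5) e(5) by (intro e4(2)) linarith
  ultimately have "(a', b', c', r') \<in> T"
    using 1(5) 2(5) 3(5) by blast
  then show "\<exists>y. y \<in> A \<and> y \<in> T" using p(1) by blast
qed simp

subsection \<open>Conjugates\<close>

lemma le_ereal_trans: "a \<le> ereal c \<Longrightarrow> c \<le> d \<Longrightarrow> a \<le> ereal d"
  by (meson ereal_less_eq(3) order_trans)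

lemma epi_iff [simp]: "(z, r) \<in> epi h \<longleftrightarrow> h z \<le> ereal r"
  by (simp add: epi_def)

text \<open>Letting \<open>t\<close> run through the reals above \<open>h (x, ys)\<close> removes
  the extended-real subtraction. A point of value infinity imposes no condition; a point of value
  minus infinity makes both sides false.\<close>

lemma conj_le_iff:
  "conj h (xs, xss) \<le> ereal r \<longleftrightarrow>
    (\<forall>x ys t. h (x, ys) \<le> ereal t \<longrightarrow> blinfun_apply xs x + blinfun_apply xss ys - t \<le> r)"
proof -
  have *: "ereal a - e \<le> ereal r \<longleftrightarrow> (\<forall>t. e \<le> ereal t \<longrightarrow> a - t \<le> r)" for a e
  proof (cases e)
    case MInf
    then show ?thesis by (auto intro!: exI[of _ "a - r - 1"])
  qed (auto intro: order_trans[of _ "a - _"])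
  show ?thesis
    by (simp add: conj_def SUP_le_iff *)
qed

lemma conj_convex:
  assumes "conj h (xs, xss) \<le> ereal r" "conj h (ys, yss) \<le> ereal s" "0 \<le> a" "0 \<le> b" "a + b = 1"
  shows "conj h (a *\<^sub>R xs + b *\<^sub>R ys, a *\<^sub>R xss + b *\<^sub>R yss) \<le> ereal (a * r + b * s)"
  unfolding conj_le_iff
proof (intro allI impI)
  fix u us t assume "h (u, us) \<le> ereal t"
  then have "xs u + xss us - t \<le> r" "ys u + yss us - t \<le> s"
    using assms(1,2) by (auto simp: conj_le_iff)
  then have "a * (xs u + xss us - t) + b * (ys u + yss us - t) \<le> a * r + b * s"
    using assms(3,4) by (intro add_mono mult_left_mono)
  moreover have "a * (xs u + xss us - t) + b * (ys u + yss us - t) =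
    a * xs u + b * ys u + (a * xss us + b * yss us) - (a + b) * t"
    by (simp add: algebra_simps)
  ultimately show "(a *\<^sub>R xs + b *\<^sub>R ys) u + (a *\<^sub>R xss + b *\<^sub>R yss) us - t \<le> a * r + b * s"
    using assms(5) by (simp add: blinfun.add_left blinfun.scaleR_left)
qed

lemma blinfun_real_arg: "blinfun_apply (f :: real \<Rightarrow>\<^sub>L real) t = f 1 * t"
  using blinfun.scaleR_right[of f t 1] by simp

text \<open>The hyperplane separating \<open>((x0, xs0), r0)\<close> from the epigraph may be
  vertical. Combining a large multiple of it with the known affine minorant
  \<open>(as, ass, a0)\<close> gives a nonvertical one that still exceeds \<open>r0\<close> at the
  point.\<close>

lemma fenchel_moreau:
  assumes conv: "convex (epi h)" and clo: "closed (epi h)"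
    and minorant: "conj h (as, ass) \<le> ereal a0" and less: "\<not> h (x0, xs0) \<le> ereal r0"
  obtains ws wss s where "conj h (ws, wss) \<le> ereal s"
    "r0 < blinfun_apply ws x0 + blinfun_apply wss xs0 - s"
proof (cases "epi h = {}")
  case True
  then have "\<not> h z \<le> ereal r" for z r
    by (metis empty_iff epi_iff)
  then show ?thesis
    by (intro that[of 0 0 "- r0 - 1"]) (auto simp: conj_le_iff)
next
  case False
  define z where "z = ((x0, xs0), r0)"
  have "z \<notin> epi h" using less by (simp add: z_def)
  then obtain d where d: "d > 0" "ball z d \<inter> epi h = {}"
    using clo by (metis Diff_disjoint Compl_eq_Diff_UNIV ComplI Int_commute open_contains_ball closed_def
      disjoint_eq_subset_Compl)
  have "d \<le> 1 * norm (q - z)" if "q \<in> epi h" for q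
  proof -
    have "q \<notin> ball z d" using d(2) that by blast
    then show ?thesis by (simp add: dist_norm norm_minus_commute)
  qed
  then obtain L where L: "linear L" "L \<le> (\<lambda>x. 1 * norm x)" "\<And>q. q \<in> epi h \<Longrightarrow> L z + d \<le> L q"
    using convex_separation[OF sublinear_norm[of 1] conv] by (metis zero_le_one)
  obtain f where f: "blinfun_apply f = L"
    using L(1,2) by (metis le_fun_def linear_le_norm_blinfun)
  obtain g k where gk: "\<And>x y. f (x, y) = blinfun_apply g x + blinfun_apply k y"
    using blinfun_prodE by blast
  obtain b c where bc: "\<And>x y. g (x, y) = blinfun_apply b x + blinfun_apply c y"
    using blinfun_prodE by blast
  define s where "s = k 1"
  have L_eq: "L ((x, ys), t) = b x + c ys + s * t" for x ys t
    using gk bc by (simp add: s_def blinfun_real_arg[of k t] flip: f)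
  have sep: "b x0 + c xs0 + s * r0 + d \<le> b x + c ys + s * t" if "h (x, ys) \<le> ereal t" for x ys t
    using L(3)[of "((x, ys), t)"] that by (simp add: z_def L_eq)
  have "s \<ge> 0"
  proof (rule ccontr)
    assume neg: "\<not> s \<ge> 0"
    obtain x ys t where q: "h (x, ys) \<le> ereal t" using False by (auto simp: epi_def)
    define C where "C = b x + c ys + s * t - (b x0 + c xs0 + s * r0 + d)"
    have "h (x, ys) \<le> ereal (t + e)" if "e \<ge> 0" for e
      using q that by (meson ereal_less_eq(3) le_add_same_cancel1 order_trans)
    from sep[OF this] have "0 \<le> C + s * e" if "e \<ge> 0" for e
      using that by (simp add: C_def algebra_simps)
    from this[of 0] this[of "(C + 1) / (- s)"] neg show False
      by (simp add: field_simps)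
  qed
  \<comment> \<open>Large enough that \<open>l * d\<close> outweighs the deficit of the given
    minorant at \<open>(x0, xs0)\<close> relative to \<open>r0\<close>.\<close>
  define l where "l = (\<bar>r0 + a0 - as x0 - ass xs0\<bar> + 1) / d"
  have l: "l > 0" "l * d > r0 + a0 - as x0 - ass xs0"
    using d by (auto simp: l_def)
  \<comment> \<open>Normalises the coefficient of \<open>t\<close> to 1; as \<open>s\<close> may
    vanish, it is \<open>l * s + 1\<close> that is known to be positive.\<close>
  define m where "m = 1 / (l * s + 1)"
  have m: "m > 0" "m * (l * s + 1) = 1"
    using l \<open>s \<ge> 0\<close> by (auto simp: m_def add_nonneg_pos less_imp_neq[THEN not_sym])
  define S where "S = m * (a0 - l * (b x0 + c xs0 + s * r0 + d))"
  define ws where "ws = m *\<^sub>R (as - l *\<^sub>R b)"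
  define wss where "wss = m *\<^sub>R (ass - l *\<^sub>R c)"
  show ?thesis
  proof (rule that)
    show "conj h (ws, wss) \<le> ereal S"
      unfolding conj_le_iff
    proof (intro allI impI)
      fix x ys t assume t: "h (x, ys) \<le> ereal t"
      have "as x + ass ys - t \<le> a0" using t minorant by (simp add: conj_le_iff)
      moreover have "l * (b x0 + c xs0 + s * r0 + d) \<le> l * (b x + c ys + s * t)"
        using sep[OF t] l(1) by (intro mult_left_mono) auto
      ultimately have "as x + ass ys - l * (b x + c ys) - (l * s + 1) * t \<le>
          a0 - l * (b x0 + c xs0 + s * r0 + d)"
        by (simp add: algebra_simps)
      then have "m * (as x + ass ys - l * (b x + c ys) - (l * s + 1) * t) \<le> S"
        unfolding S_def using m(1) by (intro mult_left_mono) auto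
      moreover have "m * (as x + ass ys - l * (b x + c ys) - (l * s + 1) * t) =
          ws x + wss ys - (m * (l * s + 1)) * t"
        by (simp add: ws_def wss_def blinfun.scaleR_left blinfun.diff_left algebra_simps)
      ultimately show "ws x + wss ys - t \<le> S"
        using m(2) by simp
    qed
    have "ws x0 + wss xs0 - S = m * (as x0 + ass xs0 - a0 + l * d + l * s * r0)"
      by (simp add: ws_def wss_def S_def blinfun.scaleR_left blinfun.diff_left algebra_simps)
    also have "\<dots> > m * (r0 + l * s * r0)"
      using m(1) l(2) by (intro mult_strict_left_mono) auto
    also have "m * (r0 + l * s * r0) = (m * (l * s + 1)) * r0"
      by (simp add: algebra_simps)
    finally show "r0 < ws x0 + wss xs0 - S"
      using m(2) by simp
  qed
qed

text \<open>Division by \<open>s\<close> and the limit at 0, made explicit by an \<open>s\<close>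
  that costs at most half of the supposed gap. It extracts the derivative at one end of a segment in
  the two tangency arguments below.\<close>

lemma first_order_inequality:
  fixes A B C D :: real
  assumes "\<And>s. 0 < s \<Longrightarrow> s \<le> 1 \<Longrightarrow> s * ((1 - s) * B + s * C) \<le> s * ((1 - s) * A + D)"
  shows "B \<le> A + D"
proof (rule ccontr)
  assume "\<not> B \<le> A + D"
  then have e: "B - A - D > 0" by simp
  define E where "E = \<bar>C - B + A\<bar> + 1"
  have E: "E > 0" by (simp add: E_def)
  define s where "s = min 1 ((B - A - D) / (2 * E))"
  have s: "0 < s" "s \<le> 1" using e E by (auto simp: s_def)
  define X where "X = s * (C - B + A)"
  have "s * E \<le> (B - A - D) / (2 * E) * E"
    unfolding s_def using E by (intro mult_right_mono) auto
  then have "s * E \<le> (B - A - D) / 2" using E by simp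
  moreover have "s * (- E) \<le> s * (C - B + A)"
    using s(1) by (intro mult_left_mono) (auto simp: E_def)
  then have "- (s * E) \<le> X" by (simp add: X_def)
  moreover have "(1 - s) * B + s * C \<le> (1 - s) * A + D"
    using assms[OF s] s(1) by simp
  then have "B + X \<le> A + D"
    by (simp add: X_def algebra_simps)
  ultimately have "B - A - D \<le> (B - A - D) / 2"
    by (smt (verit))
  with e show False by simp
qed

lemma coupling_convex_combination:
  "((1 - s) *\<^sub>R xs + s *\<^sub>R ys) ((1 - s) *\<^sub>R x + s *\<^sub>R y) =
    (1 - s) * (1 - s) * blinfun_apply xs x + s * ((1 - s) * (blinfun_apply xs y + blinfun_apply ys x)
      + s * blinfun_apply ys y)" for xs ys :: "_ \<Rightarrow>\<^sub>L real"
  by (simp only: blinfun.add_left blinfun.add_right blinfun.scaleR_left blinfun.scaleR_right)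
    (simp add: algebra_simps)

text \<open>A convex function above the coupling is tangent to it wherever they meet.\<close>

lemma conj_le_coupling:
  assumes conv: "convex (epi h)"
    and ge: "\<And>x xs. ereal (blinfun_apply xs x) \<le> h (x, xs)"
    and le: "h (x, xs) \<le> ereal (xs x)"
  shows "conj h (xs, canon x) \<le> ereal (xs x)"
  unfolding conj_le_iff
proof (intro allI impI)
  fix y ys t assume t: "h (y, ys) \<le> ereal t"
  have "xs y + ys x \<le> xs x + t"
  proof (rule first_order_inequality)
    fix s :: real assume s: "0 < s" "s \<le> 1"
    have "(1 - s) *\<^sub>R ((x, xs), xs x) + s *\<^sub>R ((y, ys), t) \<in> epi h"
      using le t s by (intro convexD[OF conv]) auto
    then have "h ((1 - s) *\<^sub>R x + s *\<^sub>R y, (1 - s) *\<^sub>R xs + s *\<^sub>R ys) \<le> ereal ((1 - s) * xs x + s * t)"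
      by simp
    from order_trans[OF ge this]
    have "(1 - s) * (1 - s) * xs x + s * ((1 - s) * (xs y + ys x) + s * ys y) \<le> (1 - s) * xs x + s * t"
      unfolding coupling_convex_combination by simp
    then show "s * ((1 - s) * (xs y + ys x) + s * ys y) \<le> s * ((1 - s) * xs x + t)"
      by (simp add: algebra_simps)
  qed
  then show "xs y + canon x ys - t \<le> xs x" by simp
qed

text \<open>Tangency on the conjugate side. If \<open>h\<close> exceeded the coupling,
  Fenchel--Moreau would give an affine minorant with a larger value there, but the conjugate is
  convex, above the coupling, and touches it at \<open>(xs, canon x)\<close>.\<close>

lemma le_coupling_of_conj:
  assumes conv: "convex (epi h)" and clo: "closed (epi h)"
    and conj_ge: "\<And>xs xss. ereal (blinfun_apply xss xs) \<le> conj h (xs, xss)"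
    and le: "conj h (xs, canon x) \<le> ereal (xs x)"
  shows "h (x, xs) \<le> ereal (xs x)"
proof (rule ccontr)
  assume "\<not> h (x, xs) \<le> ereal (xs x)"
  from fenchel_moreau[OF conv clo le this] obtain ws wss r where w: "conj h (ws, wss) \<le> ereal r"
    "xs x < ws x + wss xs - r" by blast
  have "wss xs + ws x \<le> xs x + r"
  proof (rule first_order_inequality)
    fix s :: real assume s: "0 < s" "s \<le> 1"
    have "conj h ((1 - s) *\<^sub>R xs + s *\<^sub>R ws, (1 - s) *\<^sub>R canon x + s *\<^sub>R wss)
        \<le> ereal ((1 - s) * xs x + s * r)"
      using s by (intro conj_convex le w(1)) auto
    from order_trans[OF conj_ge this]
    have "(1 - s) * (1 - s) * xs x + s * ((1 - s) * (ws x + wss xs) + s * wss ws)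
        \<le> (1 - s) * xs x + s * r"
      unfolding coupling_convex_combination by simp
    then show "s * ((1 - s) * (wss xs + ws x) + s * wss ws) \<le> s * ((1 - s) * xs x + r)"
      by (simp add: algebra_simps)
  qed
  with w(2) show False by simp
qed

text \<open>The value function is the infimum of \<open>h z + g (z + w)\<close> over
  \<open>z\<close>. Continuity of \<open>g\<close> at a point of the domain of \<open>h\<close>
  bounds it above near \<open>w = 0\<close>, which gives an affine minorant with value \<beta> at 0.
  The hypothesis on the conjugate is applied to the negative of its slope, and the two signs cancel
  in the coupling.\<close>

lemma fenchel_duality:
  fixes h :: "'a::real_normed_vector \<times> ('a \<Rightarrow>\<^sub>L real) \<Rightarrow> ereal"
  assumes conv: "convex (epi h)" and proper: "epi h \<noteq> {}"
    and conj_ge: "\<And>xs xss. ereal (blinfun_apply xss xs) \<le> conj h (xs, xss)"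
    and g: "convex_on UNIV g" "continuous_on UNIV g"
    and bound: "\<And>z t. h z \<le> ereal t \<Longrightarrow> \<beta> \<le> t + g z"
  obtains us uss where
    "\<And>y ys. \<beta> + blinfun_apply us y + blinfun_apply uss ys + blinfun_apply uss us \<le> g (y, ys)"
proof -
  define \<phi> :: "(('a \<times> ('a \<Rightarrow>\<^sub>L real)) \<times> real) \<times> (('a \<times> ('a \<Rightarrow>\<^sub>L real)) \<times> real) \<Rightarrow> _"
    where "\<phi> = (\<lambda>p. (fst (snd p) - fst (fst p), snd (fst p) + snd (snd p)))"
  define Q where "Q = \<phi> ` (epi h \<times> {(y, k). g y \<le> k})"
  have "linear \<phi>"
    unfolding \<phi>_def by (intro linearI) (auto simp: algebra_simps)
  moreover have "convex {(y, k). g y \<le> k}"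
    using convex_epigraphI[OF g(1)] by (simp add: epigraph_def split_def)
  ultimately have Q: "convex Q"
    unfolding Q_def using conv by (intro convex_linear_image convex_Times)
  have QI: "(y - z, t + k) \<in> Q" if "h z \<le> ereal t" "g y \<le> k" for z t y k
    unfolding Q_def using that by (intro image_eqI[of _ _ "((z, t), (y, k))"]) (auto simp: \<phi>_def)
  have QE: "\<exists>z t y k. h z \<le> ereal t \<and> g y \<le> k \<and> w = y - z \<and> r = t + k" if "(w, r) \<in> Q" for w r
    using that by (force simp: Q_def \<phi>_def)
  obtain z1 t1 where z1: "h z1 \<le> ereal t1" using proper by (auto simp: epi_def)
  obtain d where d: "d > 0" "\<And>y. dist y z1 < d \<Longrightarrow> dist (g y) (g z1) < 1"
    using g(2) unfolding continuous_on_iff by (metis UNIV_I zero_less_one)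
  obtain L :: "('a \<times> ('a \<Rightarrow>\<^sub>L real)) \<Rightarrow>\<^sub>L real" where L: "\<And>w r. (w, r) \<in> Q \<Longrightarrow> \<beta> + L w \<le> r"
  proof (rule marginal_subgradient[OF Q subspace_UNIV _ d(1)])
    show "\<exists>r\<le>t1 + (g z1 + 1). (w, r) \<in> Q" if "norm w < d" for w
    proof -
      have "dist (g (z1 + w)) (g z1) < 1" using that by (intro d(2)) (simp add: dist_norm)
      then have "((z1 + w) - z1, t1 + (g z1 + 1)) \<in> Q"
        by (intro QI z1) (simp add: dist_real_def abs_less_iff)
      then show ?thesis by (intro exI[of _ "t1 + (g z1 + 1)"]) simp
    qed
    show "\<beta> \<le> r" if r: "(0, r) \<in> Q" for r
    proof -
      obtain z t k where "h z \<le> ereal t" "g z \<le> k" "r = t + k"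
        using QE[OF r] by auto
      with bound[of z t] show ?thesis by linarith
    qed
  qed auto
  obtain us uss where uss: "\<And>x y. L (x, y) = blinfun_apply us x + blinfun_apply uss y"
    using blinfun_prodE by blast
  show ?thesis
  proof (rule that[of us uss])
    fix y ys
    have "conj h (- us, - uss) \<le> ereal (g (y, ys) - \<beta> - us y - uss ys)"
      unfolding conj_le_iff
    proof (intro allI impI)
      fix x xs t assume "h (x, xs) \<le> ereal t"
      from L[OF QI[OF this order_refl, of "(y, ys)"]]
      show "(- us) x + (- uss) xs - t \<le> g (y, ys) - \<beta> - us y - uss ys"
        by (simp add: uss blinfun.minus_left blinfun.diff_right)
    qed
    from order_trans[OF conj_ge this]
    show "\<beta> + us y + uss ys + uss us \<le> g (y, ys)"
      by (simp add: blinfun.minus_left blinfun.minus_right)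
  qed
qed

section \<open>Near-norming vectors, Goldstine's theorem and convex penalties\<close>

lemma blinfun_norm_witness:
  fixes f :: "'e::real_normed_vector \<Rightarrow>\<^sub>L real"
  assumes "\<kappa> > 0"
  obtains u where "norm u \<le> 1" "norm f - \<kappa> < f u"
proof (rule ccontr)
  note witness = that
  assume "\<not> thesis"
  then have le: "f u \<le> norm f - \<kappa>" if "norm u \<le> 1" for u
    using witness[OF that] by (meson not_le)
  have "norm (f x) \<le> (norm f - \<kappa>) * norm x" for x
  proof (cases "x = 0")
    case False
    have "f (sgn x) \<le> norm f - \<kappa>" "f (- sgn x) \<le> norm f - \<kappa>"
      by (rule le; simp add: norm_sgn)+
    then have "\<bar>f (sgn x)\<bar> \<le> norm f - \<kappa>"
      by (simp add: blinfun.minus_right)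
    then have "\<bar>f (sgn x)\<bar> * norm x \<le> (norm f - \<kappa>) * norm x"
      by (rule mult_right_mono) simp
    moreover have "f x = norm x * f (sgn x)"
      using False by (simp add: sgn_div_norm blinfun.scaleR_right)
    ultimately show ?thesis by (simp add: abs_mult mult.commute)
  qed simp
  then have "norm f \<le> norm f - \<kappa>"
    using le[of 0] by (intro norm_blinfun_bound) auto
  with assms show False by simp
qed

text \<open>If no point of the ball imitated \<open>zss\<close> on \<open>F\<close>, separation by
  the seminorm of \<open>F\<close> would give evaluation at some combination \<open>y\<close> of
  \<open>F\<close>. A vector of the ball that almost norms \<open>- y\<close> then contradicts
  \<open>- (norm zss * norm y) \<le> zss y\<close>.\<close>

lemma goldstine:
  fixes zss :: "('a::real_normed_vector \<Rightarrow>\<^sub>L real) \<Rightarrow>\<^sub>L real"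
  assumes F: "finite F" and \<kappa>: "\<kappa> > 0"
  obtains x where "norm x \<le> norm zss" "\<And>f. f \<in> F \<Longrightarrow> \<bar>blinfun_apply f x - zss f\<bar> < \<kappa>"
proof (rule ccontr)
  note witness = that
  assume contr: "\<not> thesis"
  define p where "p v = (\<Sum>f\<in>F. \<bar>blinfun_apply v f\<bar>)" for v :: "('a \<Rightarrow>\<^sub>L real) \<Rightarrow>\<^sub>L real"
  define C where "C = canon ` cball (0::'a) (norm zss)"
  have "linear canon"
    by (rule linearI; rule blinfun_eqI) (simp_all add: blinfun.add_left blinfun.add_right
        blinfun.scaleR_left blinfun.scaleR_right)
  then have C: "convex C"
    unfolding C_def by (intro convex_linear_image convex_cball)
  have lin: "linear (\<lambda>v. blinfun_apply v f)" for f :: "'a \<Rightarrow>\<^sub>L real"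
    by (intro linearI) (simp_all add: blinfun.add_left blinfun.scaleR_left)
  have p: "sublinear p"
    unfolding p_def by (intro sublinear_sum_abs lin)
  have far: "\<exists>f\<in>F. \<kappa> \<le> \<bar>blinfun_apply f x - zss f\<bar>" if "norm x \<le> norm zss" for x
    using witness[OF that] contr by (meson not_le)
  have bound: "\<kappa> \<le> p (c - zss)" if c: "c \<in> C" for c
  proof -
    obtain x where x: "c = canon x" "norm x \<le> norm zss"
      using c by (auto simp: C_def)
    obtain f where f: "f \<in> F" "\<kappa> \<le> \<bar>f x - zss f\<bar>"
      using far[OF x(2)] by blast
    have "\<bar>f x - zss f\<bar> \<le> p (c - zss)"
      unfolding p_def using member_le_sum[OF f(1), of "\<lambda>f. \<bar>(c - zss) f\<bar>"] F x(1)
      by (simp add: blinfun.diff_left)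
    with f(2) show ?thesis by simp
  qed
  obtain L where L: "linear L" "L \<le> p" "\<And>c. c \<in> C \<Longrightarrow> L zss + \<kappa> \<le> L c"
    using convex_separation[OF p C bound] by blast
  have vanish: "L v = 0" if "\<And>f. f \<in> F \<Longrightarrow> blinfun_apply v f = 0" for v
  proof -
    have "p v = 0" "p (- v) = 0" using that by (simp_all add: p_def blinfun.minus_left)
    then show ?thesis
      using le_funD[OF L(2), of v] le_funD[OF L(2), of "- v"] linear_neg[OF L(1), of v] by simp
  qed
  have "\<exists>c. \<forall>v. L v = (\<Sum>f\<in>F. c f * blinfun_apply v f)"
    by (rule linear_combination_of_kernels[OF F lin L(1) vanish])
  then obtain c where c: "\<And>v. L v = (\<Sum>f\<in>F. c f * blinfun_apply v f)"
    by blast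
  define y where "y = (\<Sum>f\<in>F. c f *\<^sub>R f)"
  have Ly: "L v = blinfun_apply v y" for v
    by (simp add: c y_def blinfun.sum_right blinfun.scaleR_right)
  define Z where "Z = norm zss"
  \<comment> \<open>The tolerance is multiplied by \<open>Z\<close> below; division by
    \<open>Z + 1\<close> keeps the product under \<kappa>, also for \<open>Z = 0\<close>.\<close>
  obtain u where u: "norm u \<le> 1" "norm (- y) - \<kappa> / (Z + 1) < (- y) u"
    using blinfun_norm_witness[of "\<kappa> / (Z + 1)" "- y"] \<kappa> by (auto simp: Z_def add_nonneg_pos)
  have "canon (Z *\<^sub>R u) \<in> C"
    using u(1) by (auto simp: C_def Z_def mult_left_le)
  from L(3)[OF this] have "zss y + \<kappa> \<le> Z * y u"
    by (simp add: Ly blinfun.scaleR_right)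
  moreover have "- (Z * norm y) \<le> zss y"
    using norm_blinfun_real[of zss y] by (simp add: Z_def abs_le_iff)
  moreover have "Z * (norm y - \<kappa> / (Z + 1)) \<le> Z * (- y u)"
    using u(2) by (intro mult_left_mono) (auto simp: Z_def blinfun.minus_left)
  moreover have "Z * (\<kappa> / (Z + 1)) < \<kappa>"
    using \<kappa> by (simp add: Z_def divide_simps add_nonneg_pos)
  ultimately show False by (simp add: algebra_simps)
qed

lemma convex_on_linear: "linear f \<Longrightarrow> convex_on UNIV f"
  by (simp add: convex_on_def linear_add linear_scale)

lemma convex_on_compose_linear:
  assumes "convex_on UNIV g" "linear f"
  shows "convex_on UNIV (\<lambda>x. g (f x))"
  using assms by (simp add: convex_on_def linear_add linear_scale)

lemma convex_on_norm_diff: "convex_on UNIV (\<lambda>x. norm (x - a))"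
  using convex_on_dist[OF convex_UNIV, of a] by (simp add: dist_norm norm_minus_commute)

lemma convex_on_norm_diff_square: "convex_on UNIV (\<lambda>x. (norm (x - a))\<^sup>2)"
proof -
  have "(norm (u *\<^sub>R x + v *\<^sub>R y - a))\<^sup>2 \<le> u * (norm (x - a))\<^sup>2 + v * (norm (y - a))\<^sup>2"
    if uv: "0 \<le> u" "0 \<le> v" "u + v = 1" for u v x y
  proof -
    define p where "p = norm (x - a)"
    define q where "q = norm (y - a)"
    have "norm (u *\<^sub>R x + v *\<^sub>R y - a) \<le> u * p + v * q"
      using convex_on_norm_diff[of a] uv by (simp add: convex_on_def p_def q_def)
    then have "(norm (u *\<^sub>R x + v *\<^sub>R y - a))\<^sup>2 \<le> (u * p + v * q)\<^sup>2"
      by (intro power_mono) auto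
    also have "(u * p + v * q)\<^sup>2 = (u + v) * (u * p\<^sup>2 + v * q\<^sup>2) - u * v * (p - q)\<^sup>2"
      by (simp add: power2_eq_square algebra_simps)
    also have "\<dots> \<le> u * p\<^sup>2 + v * q\<^sup>2"
      using uv by simp
    finally show ?thesis by (simp add: p_def q_def)
  qed
  then show ?thesis by (simp add: convex_on_def)
qed

lemma convex_on_max_0:
  assumes "convex_on UNIV f"
  shows "convex_on UNIV (\<lambda>x. max 0 (f x))"
proof -
  have "f (u *\<^sub>R x + v *\<^sub>R y) \<le> u * max 0 (f x) + v * max 0 (f y)"
    if "0 \<le> u" "0 \<le> v" "u + v = 1" for u v x y
  proof -
    have "f (u *\<^sub>R x + v *\<^sub>R y) \<le> u * f x + v * f y"
      using assms that by (simp add: convex_on_def)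
    also have "\<dots> \<le> u * max 0 (f x) + v * max 0 (f y)"
      using that by (intro add_mono mult_left_mono) auto
    finally show ?thesis .
  qed
  then show ?thesis by (simp add: convex_on_def)
qed

lemma convex_on_sum_fun:
  assumes "finite I" "\<And>i. i \<in> I \<Longrightarrow> convex_on UNIV (f i)"
  shows "convex_on UNIV (\<lambda>x. \<Sum>i\<in>I. f i x :: real)"
  using assms by (induction rule: finite_induct) (auto simp: convex_on_const intro: convex_on_add)

lemma weighted_am_gm:
  fixes \<mu> p q :: real
  assumes "\<mu> > 0"
  shows "2 * (p * q) \<le> p\<^sup>2 / \<mu> + \<mu> * q\<^sup>2"
proof -
  have "p\<^sup>2 / \<mu> + \<mu> * q\<^sup>2 - 2 * (p * q) = (p - \<mu> * q)\<^sup>2 / \<mu>"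
    using assms by (simp add: power2_eq_square field_simps)
  moreover have "0 \<le> (p - \<mu> * q)\<^sup>2 / \<mu>"
    using assms by simp
  ultimately show ?thesis by linarith
qed

subsection \<open>Functions above the coupling with conjugate above the coupling\<close>

text \<open>No operator is mentioned; it is recovered as \<open>contact\<close>. The same results
  then serve \<open>hS\<close>, \<open>hT\<close>, the closed infimal convolution and
  \<open>contact_rep\<close>.\<close>

locale strong_rep =
  fixes h :: "'a::banach \<times> ('a \<Rightarrow>\<^sub>L real) \<Rightarrow> ereal"
  assumes conv: "convex (epi h)" and clo: "closed (epi h)"
    and ge: "\<And>x xs. ereal (blinfun_apply xs x) \<le> h (x, xs)"
    and conj_ge: "\<And>xs xss. ereal (blinfun_apply xss xs) \<le> conj h (xs, xss)"
begin

definition contact :: "('a \<times> ('a \<Rightarrow>\<^sub>L real)) set" where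
  "contact = {(x, xs). h (x, xs) \<le> ereal (xs x)}"

lemma contact_iff: "(x, xs) \<in> contact \<longleftrightarrow> h (x, xs) \<le> ereal (xs x)"
  by (simp add: contact_def)

lemma coupling_le: "h (x, xs) \<le> ereal t \<Longrightarrow> xs x \<le> t"
  using ge[of xs x] by (metis ereal_less_eq(3) order_trans)

lemma proper: "epi h \<noteq> {}"
proof
  assume "epi h = {}"
  then have "\<not> h z \<le> ereal r" for z r by (metis empty_iff epi_iff)
  then have "conj h (0, 0) \<le> ereal (- 1)" by (simp add: conj_le_iff)
  with conj_ge[of 0 0] show False by (metis blinfun.zero_left ereal_less_eq(3) order_trans
        neg_0_le_iff_le not_one_le_zero)
qed

text \<open>Membership in the extended parallel sum is decided on the right-hand side: the conjugate
  of the infimal convolution splits exactly, whereas the infimum defining the convolution need not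
  be attained.\<close>

lemma contact_iff_conj: "(x, xs) \<in> contact \<longleftrightarrow> conj h (xs, canon x) \<le> ereal (xs x)"
  using conj_le_coupling[OF conv ge] le_coupling_of_conj[OF conv clo conj_ge]
  by (auto simp: contact_iff)

section \<open>Approximate minimisers and the Brondsted--Rockafellar property\<close>

lemma midpoint_bound:
  fixes zs :: "'a \<Rightarrow>\<^sub>L real"
  assumes "h (x, xs) \<le> ereal t" "h (x1, xs1) \<le> ereal t1"
  shows "- ((norm (x - x0) + norm (x1 - x0)) * (norm (xs - zs) + norm (xs1 - zs)))
    \<le> 2 * (t - zs x - xs x0 + zs x0) + 2 * (t1 - zs x1 - xs1 x0 + zs x0)"
proof -
  define v where "v = (x - x0) + (x1 - x0)"
  define w where "w = (xs - zs) + (xs1 - zs)"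
  \<comment> \<open>The coupling inequality at the midpoint brings in the cross terms, and
    recentring collects everything into \<open>w v\<close>. A fixed second point thus confines an
    approximate minimiser.\<close>
  have "(1/2) *\<^sub>R ((x, xs), t) + (1/2) *\<^sub>R ((x1, xs1), t1) \<in> epi h"
    using assms by (intro convexD[OF conv]) auto
  then have "h ((1/2) *\<^sub>R x + (1/2) *\<^sub>R x1, (1/2) *\<^sub>R xs + (1/2) *\<^sub>R xs1) \<le> ereal ((1/2) * t + (1/2) * t1)"
    by simp
  from coupling_le[OF this] have "xs x + xs x1 + xs1 x + xs1 x1 \<le> 2 * t + 2 * t1"
    by (simp add: blinfun.add_left blinfun.add_right blinfun.scaleR_left blinfun.scaleR_right field_simps)
  moreover have "w v = xs x + xs x1 + xs1 x + xs1 x1 - 2 * (xs x0 + xs1 x0) - 2 * (zs x + zs x1) + 4 * zs x0"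
    by (simp add: v_def w_def blinfun.add_left blinfun.add_right blinfun.diff_left blinfun.diff_right)
  moreover have "- (norm w * norm v) \<le> w v"
    using norm_blinfun_real[of w v] by (simp add: abs_le_iff)
  moreover have "norm w * norm v \<le> (norm (xs - zs) + norm (xs1 - zs)) * (norm (x - x0) + norm (x1 - x0))"
    unfolding v_def w_def by (intro mult_mono norm_triangle_ineq add_nonneg_nonneg) auto
  ultimately show ?thesis by (simp add: algebra_simps)
qed

text \<open>Here \<open>t - zs x - xs x0 + zs x0\<close> is the value at \<open>(x, xs)\<close> of \<open>h\<close> recentred at \<open>(x0, zs)\<close>.\<close>

lemma quadratic_approximation:
  fixes zs :: "'a \<Rightarrow>\<^sub>L real"
  assumes \<mu>: "\<mu> > 0" and \<delta>: "\<delta> > 0"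
  obtains x xs t where "h (x, xs) \<le> ereal t"
    "t - zs x - blinfun_apply xs x0 + zs x0 + (norm (x - x0))\<^sup>2 / (2 * \<mu>) + \<mu> * (norm (xs - zs))\<^sup>2 / 2 < \<delta>"
proof (rule ccontr)
  note witness = that
  assume contr: "\<not> thesis"
  define g where "g p = (1 / (2 * \<mu>)) * (norm (fst p - x0))\<^sup>2 + (\<mu> / 2) * (norm (snd p - zs))\<^sup>2
    + ((- zs) (fst p) + (- canon x0) (snd p) + zs x0)" for p :: "'a \<times> ('a \<Rightarrow>\<^sub>L real)"
  have "linear (\<lambda>p::'a \<times> ('a \<Rightarrow>\<^sub>L real). blinfun_apply (- zs) (fst p))"
    "linear (\<lambda>p::'a \<times> ('a \<Rightarrow>\<^sub>L real). blinfun_apply (- canon x0) (snd p))"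
    by (intro bounded_linear.linear bounded_linear_compose[OF blinfun.bounded_linear_right]
        bounded_linear_fst bounded_linear_snd bounded_linear_ident)+
  note convex_lin = this[THEN convex_on_linear]
  have "convex_on UNIV g"
    unfolding g_def using \<mu>
    by (intro convex_on_add convex_on_cmul convex_on_compose_linear[OF convex_on_norm_diff_square linear_fst]
        convex_on_compose_linear[OF convex_on_norm_diff_square linear_snd] convex_lin)
      (auto simp: convex_on_const)
  moreover have "continuous_on UNIV g"
    unfolding g_def by (intro continuous_intros bounded_linear.continuous_on[OF blinfun.bounded_linear_right])
  moreover have "\<delta> \<le> t + g z" if z: "h z \<le> ereal t" for z t
  proof (cases z)
    case (Pair x xs)
    then have "\<delta> \<le> t - zs x - xs x0 + zs x0 + (norm (x - x0))\<^sup>2 / (2 * \<mu>) + \<mu> * (norm (xs - zs))\<^sup>2 / 2"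
      using witness[of x xs t] z contr by (meson not_le)
    then show ?thesis
      by (simp add: Pair g_def blinfun.minus_left)
  qed
  ultimately obtain us uss where uss:
    "\<And>y ys. \<delta> + blinfun_apply us y + blinfun_apply uss ys + blinfun_apply uss us \<le> g (y, ys)"
    using fenchel_duality[OF conv proper conj_ge] by metis
  \<comment> \<open>Testing at \<open>zs - a = - us\<close> cancels \<open>uss us\<close>, so
    \<open>uss\<close> disappears. Moving \<open>x0\<close> by at most \<open>\<mu> * norm a\<close>
    in an almost norming direction of \<open>a\<close> keeps each quadratic term within
    \<open>\<mu> * (norm a)\<^sup>2 / 2\<close>, while \<open>a v\<close> nearly reaches their
    sum.\<close>
  define a where "a = us + zs"
  obtain u where u: "norm u \<le> 1" "norm a - \<delta> / (\<mu> * (norm a + 1)) < a u"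
    using blinfun_norm_witness[of "\<delta> / (\<mu> * (norm a + 1))" a] \<mu> \<delta> by (auto simp: add_nonneg_pos)
  define v where "v = (\<mu> * norm a) *\<^sub>R u"
  have e: "zs - a = - us" by (simp add: a_def)
  have eqs: "uss (zs - a) = - uss us" "canon x0 (zs - a) = - us x0" "a v = us v + zs v"
    unfolding e by (simp_all add: a_def blinfun.minus_left blinfun.minus_right blinfun.add_left)
  have "\<delta> + us (x0 + v) + uss (zs - a) + uss us \<le> g (x0 + v, zs - a)"
    by (rule uss)
  also have "g (x0 + v, zs - a) = (norm v)\<^sup>2 / (2 * \<mu>) + \<mu> * (norm a)\<^sup>2 / 2
      + (- zs (x0 + v) - canon x0 (zs - a) + zs x0)"
    unfolding g_def blinfun.minus_left by simp
  finally have "\<delta> + a v \<le> (norm v)\<^sup>2 / (2 * \<mu>) + \<mu> * (norm a)\<^sup>2 / 2"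
    unfolding eqs blinfun.add_right by simp
  moreover have "norm v \<le> \<mu> * norm a"
    unfolding v_def using u(1) \<mu> by (simp add: mult_left_le)
  then have "(norm v)\<^sup>2 \<le> (\<mu> * norm a)\<^sup>2" by (intro power_mono) auto
  then have "(norm v)\<^sup>2 / (2 * \<mu>) \<le> (\<mu> * norm a)\<^sup>2 / (2 * \<mu>)"
    using \<mu> by (intro divide_right_mono) auto
  moreover have "(\<mu> * norm a)\<^sup>2 / (2 * \<mu>) = \<mu> * (norm a)\<^sup>2 / 2"
    using \<mu> by (simp add: power2_eq_square)
  moreover have "\<mu> * norm a * (norm a - \<delta> / (\<mu> * (norm a + 1))) \<le> a v"
    unfolding v_def blinfun.scaleR_right real_scaleR_def using u(2) \<mu> by (intro mult_left_mono) auto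
  moreover have "\<mu> * norm a * (norm a - \<delta> / (\<mu> * (norm a + 1))) =
      \<mu> * (norm a)\<^sup>2 - \<delta> * (norm a / (norm a + 1))"
  proof -
    have "\<mu> * norm a * (\<delta> / (\<mu> * (norm a + 1))) = (\<mu> * (\<delta> * norm a)) / (\<mu> * (norm a + 1))"
      by simp
    also have "\<dots> = \<delta> * (norm a / (norm a + 1))"
      using \<mu> by (subst mult_divide_mult_cancel_left) auto
    finally show ?thesis by (simp add: power2_eq_square right_diff_distrib)
  qed
  moreover have "\<delta> * (norm a / (norm a + 1)) < \<delta>"
    using \<delta> by (simp add: divide_simps add_nonneg_pos)
  ultimately show False by linarith
qed

text \<open>The quadratic terms dominate the product of the two deviations, which bounds the gap by
  \<delta>. For the norms the same terms are played against the midpoint inequality with a reference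
  point.\<close>

lemma quadratic_approximation_bounds:
  fixes zs :: "'a \<Rightarrow>\<^sub>L real"
  assumes \<mu>: "\<mu> > 0" and h: "h (x, xs) \<le> ereal t"
    and small: "t - zs x - xs x0 + zs x0 + (norm (x - x0))\<^sup>2 / (2 * \<mu>) + \<mu> * (norm (xs - zs))\<^sup>2 / 2 < \<delta>"
  shows "t < xs x + \<delta>"
    and "h (x1, xs1) \<le> ereal t1 \<Longrightarrow> (norm (x - x0))\<^sup>2 / \<mu> + \<mu> * (norm (xs - zs))\<^sup>2
      \<le> 8 * (t1 - zs x1 - xs1 x0 + zs x0 + \<delta>) + 6 * ((norm (x1 - x0))\<^sup>2 / \<mu> + \<mu> * (norm (xs1 - zs))\<^sup>2)"
proof -
  have half: "(norm (x - x0))\<^sup>2 / (2 * \<mu>) = ((norm (x - x0))\<^sup>2 / \<mu>) / 2" by simp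
  have "- (norm (xs - zs) * norm (x - x0)) \<le> (xs - zs) (x - x0)"
    using norm_blinfun_real[of "xs - zs" "x - x0"] by (simp add: abs_le_iff)
  moreover have "(xs - zs) (x - x0) = xs x - zs x - xs x0 + zs x0"
    by (simp add: blinfun.diff_left blinfun.diff_right)
  moreover have "2 * (norm (x - x0) * norm (xs - zs)) \<le> (norm (x - x0))\<^sup>2 / \<mu> + \<mu> * (norm (xs - zs))\<^sup>2"
    by (rule weighted_am_gm[OF \<mu>])
  ultimately show "t < xs x + \<delta>"
    using small unfolding half by (simp add: mult.commute)
  assume h1: "h (x1, xs1) \<le> ereal t1"
  define a b a1 b1 where ab: "a = norm (x - x0)" "b = norm (xs - zs)"
    "a1 = norm (x1 - x0)" "b1 = norm (xs1 - zs)"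
  \<comment> \<open>With the weights 3/2 and 3 the unknown deviations enter with weight 3/4 against
    1 from the hypothesis; the remaining quarter produces the factors 8 and 6. Weights 2 and 2 would
    leave nothing.\<close>
  have sq: "(p + q)\<^sup>2 \<le> (3/2) * p\<^sup>2 + 3 * q\<^sup>2" for p q :: real
  proof -
    have "(3/2) * p\<^sup>2 + 3 * q\<^sup>2 - (p + q)\<^sup>2 = (p - 2 * q)\<^sup>2 / 2"
      by (simp add: power2_eq_square field_simps)
    then show ?thesis using zero_le_power2[of "p - 2 * q"] by linarith
  qed
  have "(a + a1)\<^sup>2 / \<mu> \<le> ((3/2) * a\<^sup>2 + 3 * a1\<^sup>2) / \<mu>"
    using \<mu> by (intro divide_right_mono sq) auto
  moreover have "\<mu> * (b + b1)\<^sup>2 \<le> \<mu> * ((3/2) * b\<^sup>2 + 3 * b1\<^sup>2)"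
    using \<mu> by (intro mult_left_mono sq) auto
  moreover have "2 * ((a + a1) * (b + b1)) \<le> (a + a1)\<^sup>2 / \<mu> + \<mu> * (b + b1)\<^sup>2"
    by (rule weighted_am_gm[OF \<mu>])
  moreover have "- ((a + a1) * (b + b1)) \<le>
      2 * (t - zs x - xs x0 + zs x0) + 2 * (t1 - zs x1 - xs1 x0 + zs x0)"
    unfolding ab by (rule midpoint_bound[OF h h1])
  ultimately show "a\<^sup>2 / \<mu> + \<mu> * b\<^sup>2 \<le> 8 * (t1 - zs x1 - xs1 x0 + zs x0 + \<delta>) + 6 * (a1\<^sup>2 / \<mu> + \<mu> * b1\<^sup>2)"
    using small unfolding half ab[symmetric] by (simp add: add_divide_distrib algebra_simps)
qed

text \<open>The point is both centre and reference, so the reference distances vanish and the bound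
  becomes \<open>8 * (s\<^sup>2 + s\<^sup>2 / 4) = 10 * s\<^sup>2\<close>, below
  \<open>(4 * s)\<^sup>2\<close>. The gap drops by the factor 4 while the move stays of order
  \<open>s\<close>.\<close>

lemma halve_gap:
  assumes s: "s > 0" and h: "h (x0, xs0) \<le> ereal (xs0 x0 + s\<^sup>2)"
  obtains x xs where "h (x, xs) \<le> ereal (blinfun_apply xs x + (s/2)\<^sup>2)" "norm (x - x0) \<le> 4 * s" "norm (xs - xs0) \<le> 4 * s"
proof -
  obtain x xs t where x: "h (x, xs) \<le> ereal t"
    "t - xs0 x - blinfun_apply xs x0 + xs0 x0 + (norm (x - x0))\<^sup>2 / (2 * 1) + 1 * (norm (xs - xs0))\<^sup>2 / 2 < (s/2)\<^sup>2"
    using quadratic_approximation[of 1 "(s/2)\<^sup>2"] s by (metis zero_less_one zero_less_power half_gt_zero)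
  note b = quadratic_approximation_bounds[OF _ x]
  have "(norm (x - x0))\<^sup>2 + (norm (xs - xs0))\<^sup>2 \<le> 10 * s\<^sup>2"
    using b(2)[OF _ h] by (simp add: power2_eq_square)
  moreover have sq: "(4 * s)\<^sup>2 = 16 * s\<^sup>2" by (simp add: power_mult_distrib)
  ultimately have "(norm (x - x0))\<^sup>2 \<le> (4 * s)\<^sup>2" "(norm (xs - xs0))\<^sup>2 \<le> (4 * s)\<^sup>2"
    using zero_le_power2[of "norm (x - x0)"] zero_le_power2[of "norm (xs - xs0)"] zero_le_power2[of s]
    unfolding sq by linarith+
  then have "norm (x - x0) \<le> 4 * s" "norm (xs - xs0) \<le> 4 * s"
    using s by (auto intro: power2_le_imp_le)
  moreover have "h (x, xs) \<le> ereal (xs x + (s/2)\<^sup>2)"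
    using x(1) b(1) by (simp add: order_trans[OF x(1)])
  ultimately show ?thesis using that by blast
qed

text \<open>Each step moves either component by at most \<open>4 * s / 2 ^ n\<close>, together
  \<open>8 * s / 2 ^ n\<close>, and the geometric series gives \<open>16 * s\<close>. Completeness
  supplies the limit, closedness of the epigraph gives it gap 0.\<close>

theorem brondsted_rockafellar:
  assumes s: "s > 0" and h: "h (x, xs) \<le> ereal (xs x + s\<^sup>2)"
  obtains y ys where "(y, ys) \<in> contact" "norm (y - x) \<le> 16 * s" "norm (ys - xs) \<le> 16 * s"
proof -
  define P where "P n z \<longleftrightarrow> h z \<le> ereal (snd z (fst z) + (s / 2 ^ n)\<^sup>2)" for n and z :: "'a \<times> ('a \<Rightarrow>\<^sub>L real)"
  have "\<exists>f. \<forall>n. (P n (f n) \<and> (n = 0 \<longrightarrow> f n = (x, xs))) \<and> norm (f (Suc n) - f n) \<le> 8 * s * (1/2) ^ n"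
  proof (rule dependent_nat_choice)
    show "\<exists>z. P 0 z \<and> (0 = (0::nat) \<longrightarrow> z = (x, xs))"
      using h by (simp add: P_def)
    fix z n assume "P n z \<and> (n = 0 \<longrightarrow> z = (x, xs))"
    then have "h (fst z, snd z) \<le> ereal (snd z (fst z) + (s / 2 ^ n)\<^sup>2)" by (simp add: P_def)
    from halve_gap[OF _ this] obtain y ys where y: "h (y, ys) \<le> ereal (blinfun_apply ys y + (s / 2 ^ n / 2)\<^sup>2)"
      "norm (y - fst z) \<le> 4 * (s / 2 ^ n)" "norm (ys - snd z) \<le> 4 * (s / 2 ^ n)"
      using s by auto
    have "norm ((y, ys) - z) \<le> norm (y - fst z) + norm (ys - snd z)"
      using norm_Pair_le[of "y - fst z" "ys - snd z"] by (cases z) simp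
    also have "\<dots> \<le> 8 * s * (1/2) ^ n"
      using y(2,3) by (simp add: power_divide)
    finally show "\<exists>z'. (P (Suc n) z' \<and> (Suc n = 0 \<longrightarrow> z' = (x, xs))) \<and> norm (z' - z) \<le> 8 * s * (1/2) ^ n"
      using y(1) by (intro exI[of _ "(y, ys)"]) (simp add: P_def field_simps)
  qed
  then obtain f where f: "\<And>n. P n (f n)" "f 0 = (x, xs)"
    "\<And>n. norm (f (Suc n) - f n) \<le> 8 * s * (1/2) ^ n" by auto
  have sums: "(\<lambda>n. 8 * s * (1/2) ^ n) sums (16 * s)"
    using sums_mult[OF geometric_sums[of "1/2::real"], of "8 * s"] by simp
  have summ: "summable (\<lambda>n. f (Suc n) - f n)"
    by (rule summable_comparison_test'[OF sums_summable[OF sums] f(3)])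
  define l where "l = f 0 + (\<Sum>n. f (Suc n) - f n)"
  have "(\<lambda>n. f 0 + (\<Sum>k<n. f (Suc k) - f k)) \<longlonglongrightarrow> l"
    unfolding l_def by (intro tendsto_intros summable_LIMSEQ summ)
  then have lim: "f \<longlonglongrightarrow> l" by (simp add: sum_lessThan_telescope)
  have "norm (\<Sum>n. f (Suc n) - f n) \<le> (\<Sum>n. 8 * s * (1/2) ^ n)"
    by (intro norm_suminf_le sums_summable[OF sums] f(3))
  then have norm: "norm (l - (x, xs)) \<le> 16 * s"
    using sums by (simp add: l_def f(2) sums_iff)
  have "(\<lambda>n. (f n, snd (f n) (fst (f n)) + (s / 2 ^ n)\<^sup>2)) \<longlonglongrightarrow> (l, snd l (fst l) + 0\<^sup>2)"
  proof (intro tendsto_intros lim blinfun.tendsto)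
    have "(\<lambda>n. s * (1/2) ^ n) \<longlonglongrightarrow> s * 0"
      by (intro tendsto_intros LIMSEQ_power_zero) auto
    then show "(\<lambda>n. s / 2 ^ n) \<longlonglongrightarrow> 0" by (simp add: power_divide)
  qed
  then have "(l, snd l (fst l) + 0\<^sup>2) \<in> epi h"
    by (rule closed_sequentially[OF clo, rotated]) (use f(1) in \<open>simp add: P_def\<close>)
  then have "(fst l, snd l) \<in> contact" by (cases l) (simp add: contact_def)
  moreover have "norm (fst l - x) \<le> 16 * s" "norm (snd l - xs) \<le> 16 * s"
    using norm norm_fst_le[of "fst l - x" "snd l - xs"] norm_snd_le[of "snd l - xs" "fst l - x"]
    by (cases l; simp)+
  ultimately show ?thesis using that by blast
qed

end

section \<open>Epigraphs, closures and halfspaces\<close>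

lemma epi_INF:
  fixes Q :: "('z::topological_space \<times> real) set"
  assumes Q: "closed Q" and up: "\<And>z r e. (z, r) \<in> Q \<Longrightarrow> 0 \<le> e \<Longrightarrow> (z, r + e) \<in> Q"
  shows "epi (\<lambda>z. INF r\<in>{r. (z, r) \<in> Q}. ereal r) = Q"
proof (intro set_eqI iffI; clarify)
  fix z r assume "(z, r) \<in> epi (\<lambda>z. INF r\<in>{r. (z, r) \<in> Q}. ereal r)"
  then have le: "(INF r\<in>{r. (z, r) \<in> Q}. ereal r) \<le> ereal r" by simp
  \<comment> \<open>The infimum is not known to be attained, so \<open>r\<close> is approached from
    above and closedness takes the limit.\<close>
  have "(z, r + inverse (real (Suc n))) \<in> Q" for n
  proof -
    have "(INF r\<in>{r. (z, r) \<in> Q}. ereal r) < ereal (r + inverse (real (Suc n)))"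
      by (rule le_less_trans[OF le]) simp
    then obtain r' where "(z, r') \<in> Q" "r' < r + inverse (real (Suc n))"
      by (auto simp: INF_less_iff)
    then show ?thesis
      using up[of z r' "r + inverse (real (Suc n)) - r'"] by simp
  qed
  moreover have "(\<lambda>n. (z, r + inverse (real (Suc n)))) \<longlonglongrightarrow> (z, r)"
    by (intro tendsto_intros LIMSEQ_inverse_real_of_nat_add)
  ultimately show "(z, r) \<in> Q"
    using closed_sequentially[OF Q, of "\<lambda>n. (z, r + inverse (real (Suc n)))"] by blast
next
  fix z r assume "(z, r) \<in> Q"
  then show "(z, r) \<in> epi (\<lambda>z. INF r\<in>{r. (z, r) \<in> Q}. ereal r)"
    by (auto intro: INF_lower)
qed

lemma upward_closure:
  fixes Q :: "('z::real_normed_vector \<times> real) set"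
  assumes "\<And>z r e. (z, r) \<in> Q \<Longrightarrow> 0 \<le> e \<Longrightarrow> (z, r + e) \<in> Q" "(z, r) \<in> closure Q" "0 \<le> e"
  shows "(z, r + e) \<in> closure Q"
proof -
  have "(0, e) + (z, r) \<in> closure ((+) (0, e) ` Q)"
    using assms(2) by (subst closure_translation) blast
  moreover have "(+) (0, e) ` Q \<subseteq> Q"
    using assms(1,3) by (auto simp: add.commute)
  ultimately show ?thesis
    using closure_mono[of "(+) (0, e) ` Q" Q] by (auto simp: add.commute)
qed

lemma upward_convex_hull:
  fixes Q :: "('z::real_normed_vector \<times> real) set"
  assumes "\<And>z r e. (z, r) \<in> Q \<Longrightarrow> 0 \<le> e \<Longrightarrow> (z, r + e) \<in> Q" "(z, r) \<in> convex hull Q" "0 \<le> e"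
  shows "(z, r + e) \<in> convex hull Q"
proof -
  have "(0, e) + (z, r) \<in> convex hull ((+) (0, e) ` Q)"
    using assms(2) by (subst convex_hull_translation) blast
  moreover have "(+) (0, e) ` Q \<subseteq> Q"
    using assms(1,3) by (auto simp: add.commute)
  ultimately show ?thesis
    using hull_mono[of "(+) (0, e) ` Q" Q convex] by (auto simp: add.commute)
qed

lemma affine_halfspace:
  fixes as :: "'a::real_normed_vector \<Rightarrow>\<^sub>L real" and ass :: "('a \<Rightarrow>\<^sub>L real) \<Rightarrow>\<^sub>L real"
  shows "convex {((x, ys), t). as x + ass ys - t \<le> r}" "closed {((x, ys), t). as x + ass ys - t \<le> r}"
proof -
  have eq: "{((x, ys), t). as x + ass ys - t \<le> r}
    = (\<lambda>p. as (fst (fst p)) + ass (snd (fst p)) - snd p) -` {..r}"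
    by auto
  have "linear (\<lambda>p. as (fst (fst p)) + ass (snd (fst p)) - snd p)"
    by (intro linearI) (simp_all add: blinfun.add_right blinfun.scaleR_right algebra_simps)
  then show "convex {((x, ys), t). as x + ass ys - t \<le> r}"
    unfolding eq by (rule convex_linear_vimage) simp
  show "closed {((x, ys), t). as x + ass ys - t \<le> r}"
    unfolding eq by (intro closed_vimage continuous_intros)
qed

text \<open>The right-hand side is inclusion in a closed convex set, so a bound on the conjugate
  passes to closures and convex hulls of the epigraph.\<close>

lemma conj_le_iff_epi:
  "conj h (xs, xss) \<le> ereal r \<longleftrightarrow>
    epi h \<subseteq> {((x, ys), t). blinfun_apply xs x + blinfun_apply xss ys - t \<le> r}"
  by (auto simp: conj_le_iff epi_def)

lemma epi_lsc_hull:
  fixes h :: "'z::real_normed_vector \<Rightarrow> ereal"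
  shows "epi (lsc_hull h) = closure (epi h)"
  unfolding lsc_hull_def[abs_def]
proof (rule epi_INF)
  show "(z, r + e) \<in> closure (epi h)" if "(z, r) \<in> closure (epi h)" "0 \<le> e" for z r e
  proof (rule upward_closure[OF _ that])
    show "(z, r + e) \<in> epi h" if "(z, r) \<in> epi h" "0 \<le> e" for z r e
      using that by (auto intro: le_ereal_trans)
  qed
qed simp

lemma conj_lsc_hull: "conj (lsc_hull h) p \<le> ereal r \<longleftrightarrow> conj h p \<le> ereal r"
proof (cases p)
  case (Pair xs xss)
  show ?thesis
    unfolding Pair conj_le_iff_epi epi_lsc_hull
    by (rule iffI; (rule order_trans[OF closure_subset] closure_minimal[OF _ affine_halfspace(2)]), assumption)
qed

section \<open>Bidual points, the Gossez closure of the contact set and type (D)\<close>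

context strong_rep
begin

text \<open>Recentring at \<open>(0, zs)\<close> puts the origin in place of the bidual point
  \<open>zss\<close>. This costs about \<open>norm zss * norm (xs - zs)\<close>, which a large
  weight \<mu> on the dual norm makes small; the primal component may drift far, but stays
  bounded.\<close>

lemma contact_infimum_nonpos:
  fixes zs :: "'a \<Rightarrow>\<^sub>L real" and zss :: "('a \<Rightarrow>\<^sub>L real) \<Rightarrow>\<^sub>L real"
  assumes le: "\<And>y ys. (y, ys) \<in> contact \<Longrightarrow> zs y + zss ys - blinfun_apply ys y \<le> r"
  shows "zss zs \<le> r"
proof (rule field_le_epsilon)
  fix e :: real assume e: "e > 0"
  define Z where "Z = norm zss"
  \<comment> \<open>The weighted mean inequality splits \<open>Z * d\<close> into
    \<open>Z\<^sup>2 / (2 * \<mu>)\<close>, now at most \<open>e / 2\<close>, and half of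
    \<open>\<mu> * d\<^sup>2\<close>, which the penalty pays for.\<close>
  define \<mu> where "\<mu> = (Z\<^sup>2 + 1) / e"
  have \<mu>: "\<mu> > 0" using e by (simp add: \<mu>_def add_nonneg_pos)
  have Z\<mu>: "Z\<^sup>2 / \<mu> \<le> e"
    using e by (simp add: \<mu>_def divide_simps add_nonneg_pos)
  obtain x1 xs1 t1 where h1: "h (x1, xs1) \<le> ereal t1" using proper by (auto simp: epi_def)
  \<comment> \<open>\<open>C\<close>, \<open>R\<close> and \<open>K\<close> are fixed before
    \<open>s\<close>; the bounds on \<open>x\<close> and \<open>xs\<close> use
    \<open>s \<le> 1\<close> alone. This avoids a circle between these norms and the distance
    \<open>16 * s\<close> to the contact set.\<close>
  define C where "C = \<bar>8 * (t1 - zs x1 + 1) + 6 * ((norm x1)\<^sup>2 / \<mu> + \<mu> * (norm (xs1 - zs))\<^sup>2)\<bar>"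
  define R where "R = 2 + \<mu> * C + C / \<mu> + norm zs"
  have R: "R \<ge> 0" using \<mu> by (simp add: R_def C_def)
  \<comment> \<open>Collects the coefficients of \<open>s\<close> in the errors of moving from
    \<open>(x, xs)\<close> to a contact point, the facts 1 to 4 below.\<close>
  define K where "K = 16 * (norm zs + Z + 2 * R + 16)"
  have K: "K \<ge> 0" using R by (simp add: K_def Z_def)
  define s where "s = min 1 (e / (2 * (1 + K)))"
  have s: "0 < s" "s \<le> 1" using e K by (auto simp: s_def)
  have "s * (1 + K) \<le> e / (2 * (1 + K)) * (1 + K)"
    using K unfolding s_def by (intro mult_right_mono) auto
  also have "\<dots> = e / 2" using K by (simp add: field_simps)
  finally have sK: "s * (1 + K) \<le> e / 2" .
  have s2: "s\<^sup>2 \<le> s" using s by (simp add: power2_eq_square mult_left_le)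
  obtain x xs t where x: "h (x, xs) \<le> ereal t"
    "t - zs x - blinfun_apply xs 0 + zs 0 + (norm (x - 0))\<^sup>2 / (2 * \<mu>) + \<mu> * (norm (xs - zs))\<^sup>2 / 2 < s\<^sup>2"
    using quadratic_approximation[OF \<mu>, of "s\<^sup>2"] s(1) by (metis zero_less_power)
  note b = quadratic_approximation_bounds[OF \<mu> x]
  define a where "a = norm x"
  define d where "d = norm (xs - zs)"
  have "a\<^sup>2 / \<mu> + \<mu> * d\<^sup>2 \<le> 8 * (t1 - zs x1 + s\<^sup>2) + 6 * ((norm x1)\<^sup>2 / \<mu> + \<mu> * (norm (xs1 - zs))\<^sup>2)"
    using b(2)[OF h1] by (simp add: a_def d_def blinfun.zero_right)
  also have "\<dots> \<le> 8 * (t1 - zs x1 + 1) + 6 * ((norm x1)\<^sup>2 / \<mu> + \<mu> * (norm (xs1 - zs))\<^sup>2)"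
    using order_trans[OF s2 s(2)] by simp
  also have "\<dots> \<le> C" unfolding C_def by (rule abs_ge_self)
  finally have ad: "a\<^sup>2 / \<mu> + \<mu> * d\<^sup>2 \<le> C" .
  have "a\<^sup>2 / \<mu> \<le> C" "\<mu> * d\<^sup>2 \<le> C"
    using ad \<mu> by (smt (verit) divide_nonneg_pos mult_nonneg_nonneg zero_le_power2)+
  then have "a\<^sup>2 \<le> \<mu> * C" "d\<^sup>2 \<le> C / \<mu>" using \<mu> by (simp_all add: field_simps)
  moreover have "p \<le> 1 + p\<^sup>2" for p :: real
  proof -
    have "2 * p \<le> 1 + p\<^sup>2" using zero_le_power2[of "p - 1"] by (simp add: power2_diff)
    then show ?thesis using zero_le_power2[of p] by linarith
  qed
  ultimately have "a \<le> 1 + \<mu> * C" "d \<le> 1 + C / \<mu>" by (meson add_left_mono order_trans)+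
  moreover have "norm xs \<le> d + norm zs" unfolding d_def by (metis diff_add_cancel norm_triangle_ineq)
  moreover have "0 \<le> \<mu> * C" "0 \<le> C / \<mu>" using \<mu> by (simp_all add: C_def)
  ultimately have xR: "norm x \<le> R" "norm xs \<le> R" unfolding R_def a_def by (smt (verit) norm_ge_zero)+
  obtain y ys where y: "(y, ys) \<in> contact" "norm (y - x) \<le> 16 * s" "norm (ys - xs) \<le> 16 * s"
  proof (rule brondsted_rockafellar[OF s(1)])
    show "h (x, xs) \<le> ereal (xs x + s\<^sup>2)"
      using order_trans[OF x(1)] b(1) by simp
  qed
  have 1: "- (norm zs * (16 * s)) \<le> zs (y - x)"
    using norm_blinfun_real[of zs "y - x"] mult_left_mono[OF y(2), of "norm zs"] by (simp add: abs_le_iff)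
  have 2: "- (Z * (16 * s)) \<le> zss (ys - xs)"
    using norm_blinfun_real[of zss "ys - xs"] mult_left_mono[OF y(3), of Z] by (simp add: abs_le_iff Z_def)
  have "norm ys \<le> R + 16"
    using y(3) s xR(2) norm_triangle_sub[of ys xs] by linarith
  then have "norm ys * norm (y - x) \<le> (R + 16) * (16 * s)"
    using y(2) R by (intro mult_mono) auto
  then have 3: "ys (y - x) \<le> (R + 16) * (16 * s)"
    using norm_blinfun_real[of ys "y - x"] by (simp add: abs_le_iff)
  have "norm (ys - xs) * norm x \<le> (16 * s) * R"
    using y(3) xR R s by (intro mult_mono) auto
  then have 4: "(ys - xs) x \<le> 16 * s * R"
    using norm_blinfun_real[of "ys - xs" x] by (simp add: abs_le_iff)
  have 5: "zs y + zss ys - ys y \<le> r" by (rule le[OF y(1)])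
  have half: "(norm (x - 0))\<^sup>2 / (2 * \<mu>) \<ge> 0" using \<mu> by simp
  have 6: "xs x - zs x + \<mu> * d\<^sup>2 / 2 \<le> s\<^sup>2"
    using x(2) coupling_le[OF x(1)] half unfolding d_def by (simp add: blinfun.zero_right)
  have 7: "- (Z * d) \<le> zss (xs - zs)"
    using norm_blinfun_real[of zss "xs - zs"] by (simp add: abs_le_iff Z_def d_def)
  have 8: "2 * (Z * d) \<le> Z\<^sup>2 / \<mu> + \<mu> * d\<^sup>2" by (rule weighted_am_gm[OF \<mu>])
  have "s * K = norm zs * (16 * s) + Z * (16 * s) + (R + 16) * (16 * s) + 16 * s * R"
    by (simp add: K_def algebra_simps)
  moreover have "s + s * K \<le> e / 2" using sK by (simp add: algebra_simps)
  ultimately show "zss zs \<le> r + e"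
    using 1 2 3 4 5 6 7 8 Z\<mu> s2
    by (simp add: blinfun.diff_left blinfun.diff_right)
qed

text \<open>Instead of a norm centred at \<open>zss\<close>, the primal penalty \<phi> vanishes on
  the points of a ball that imitate \<open>zss\<close> on \<open>F\<close>; only the dual variable
  carries a norm. Duality makes the penalised value small, and since the bound on the conjugate
  keeps the recentred value nonnegative, every penalty is small separately.\<close>

lemma contact_approximation:
  fixes zs :: "'a \<Rightarrow>\<^sub>L real" and zss :: "('a \<Rightarrow>\<^sub>L real) \<Rightarrow>\<^sub>L real"
  assumes le: "conj h (zs, zss) \<le> ereal (zss zs)" and F: "finite F" and e: "e > 0" "e \<le> 1"
  obtains y ys where "(y, ys) \<in> contact" "norm y \<le> norm zss + 3" "norm (ys - zs) < e"
    "\<And>f. f \<in> F \<Longrightarrow> \<bar>blinfun_apply f y - zss f\<bar> < e"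
proof -
  define R where "R = norm zss + 1"
  have R: "R \<ge> 1" by (simp add: R_def)
  define \<phi> where "\<phi> y = max 0 (norm (y - 0) - R) + (\<Sum>f\<in>F. max 0 (\<bar>blinfun_apply f y - zss f\<bar> - e / 4))" for y
  define N where "N = 1 + (\<Sum>f\<in>F. norm f)"
  have N: "N \<ge> 1" "\<And>f. f \<in> F \<Longrightarrow> norm f \<le> N"
    using member_le_sum[of _ F norm] F by (force simp: N_def sum_nonneg)+
  define \<tau> where "\<tau> = e / (8 * N)"
  have \<tau>: "0 < \<tau>" "\<tau> \<le> 1 / 8" "\<tau> * N = e / 8"
    using e N by (auto simp: \<tau>_def field_simps)
  \<comment> \<open>The room left by \<phi>, \<open>e / 4\<close> on \<open>F\<close> and 1 in norm,
    is shared between Goldstine's point and the shift by \<open>\<tau> *\<^sub>R u\<close>, each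
    using at most \<open>e / 8\<close> on \<open>F\<close>. The shift gains nearly
    \<open>\<tau> * norm a\<close>, the cost of the dual penalty.\<close>
  have dual: "\<exists>y. \<phi> y = 0 \<and> zss a + \<tau> * norm a - \<kappa> < blinfun_apply a y" if \<kappa>: "\<kappa> > 0" for a \<kappa>
  proof -
    obtain u where u: "norm u \<le> 1" "norm a - \<kappa> / 2 < blinfun_apply a u"
      using blinfun_norm_witness[of "\<kappa> / 2" a] \<kappa> by auto
    obtain x where x: "norm x \<le> norm zss" "\<And>f. f \<in> insert a F \<Longrightarrow> \<bar>blinfun_apply f x - zss f\<bar> < min (e / 8) (\<kappa> / 2)"
      using goldstine[of "insert a F" "min (e / 8) (\<kappa> / 2)" zss] F e(1) \<kappa> by auto
    define y where "y = x + \<tau> *\<^sub>R u"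
    have "norm (\<tau> *\<^sub>R u) \<le> 1"
      using u(1) \<tau> mult_mono[of \<tau> 1 "norm u" 1] by simp
    then have "norm y \<le> R"
      using x(1) norm_triangle_ineq[of x "\<tau> *\<^sub>R u"] by (simp add: y_def R_def)
    moreover have "\<bar>blinfun_apply f y - zss f\<bar> \<le> e / 4" if f: "f \<in> F" for f
    proof -
      have "\<bar>blinfun_apply f (\<tau> *\<^sub>R u)\<bar> \<le> norm f * norm (\<tau> *\<^sub>R u)" by (rule norm_blinfun_real)
      also have "\<dots> \<le> N * (\<tau> * 1)"
        using u(1) \<tau>(1) N(2)[OF f] N(1) by (intro mult_mono) auto
      finally have "\<bar>blinfun_apply f (\<tau> *\<^sub>R u)\<bar> \<le> e / 8" using \<tau>(3) by (simp add: mult.commute)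
      moreover have "\<bar>blinfun_apply f x - zss f\<bar> < e / 8" using x(2)[of f] f by simp
      moreover have "blinfun_apply f y = f x + f (\<tau> *\<^sub>R u)" by (simp add: y_def blinfun.add_right)
      ultimately show ?thesis by linarith
    qed
    then have "(\<Sum>f\<in>F. max 0 (\<bar>blinfun_apply f y - zss f\<bar> - e / 4)) = 0"
      by (intro sum.neutral) auto
    ultimately have "\<phi> y = 0" by (simp add: \<phi>_def)
    moreover have "\<bar>blinfun_apply a x - zss a\<bar> < \<kappa> / 2" using x(2)[of a] by simp
    then have "zss a - \<kappa> / 2 < a x" by linarith
    moreover have "\<tau> * (norm a - \<kappa> / 2) \<le> \<tau> * a u" using u(2) \<tau>(1) by (intro mult_left_mono) auto
    moreover have "\<tau> * (\<kappa> / 2) \<le> 1 * (\<kappa> / 2)" using \<tau> \<kappa> by (intro mult_right_mono) auto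
    ultimately show ?thesis
      by (intro exI[of _ y]) (simp add: y_def blinfun.add_right blinfun.scaleR_right algebra_simps)
  qed
  have \<phi>_nonneg: "\<phi> y \<ge> 0" for y
    unfolding \<phi>_def by (intro add_nonneg_nonneg sum_nonneg) auto
  have approx: "\<exists>x xs t. h (x, xs) \<le> ereal t \<and>
      t - zs x - zss xs + zss zs + \<tau> * norm (xs - zs) + \<phi> x < \<delta>" if \<delta>: "\<delta> > 0" for \<delta>
  proof (rule ccontr)
    assume contr: "\<not> ?thesis"
    define g where "g p = \<tau> * norm (snd p - zs) + \<phi> (fst p) + ((- zs) (fst p) + (- zss) (snd p) + zss zs)"
      for p :: "'a \<times> ('a \<Rightarrow>\<^sub>L real)"
    have "linear (\<lambda>p::'a \<times> ('a \<Rightarrow>\<^sub>L real). blinfun_apply (- zs) (fst p))"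
      "linear (\<lambda>p::'a \<times> ('a \<Rightarrow>\<^sub>L real). blinfun_apply (- zss) (snd p))"
      by (intro bounded_linear.linear bounded_linear_compose[OF blinfun.bounded_linear_right]
          bounded_linear_fst bounded_linear_snd bounded_linear_ident)+
    note convex_lin = this[THEN convex_on_linear]
    have abs: "convex_on UNIV (\<lambda>y. \<bar>blinfun_apply f y - zss f\<bar> - e / 4)" for f
    proof -
      have "convex_on UNIV (\<lambda>y. norm (blinfun_apply f y - zss f))"
        by (intro convex_on_compose_linear[OF convex_on_norm_diff] bounded_linear.linear
            blinfun.bounded_linear_right)
      then have "convex_on UNIV (\<lambda>y. norm (blinfun_apply f y - zss f) + (- (e / 4)))"
        by (intro convex_on_add) (auto simp: convex_on_const)
      then show ?thesis by simp
    qed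
    have "convex_on UNIV (\<lambda>y::'a. norm (y - 0) + (- R))"
      by (intro convex_on_add convex_on_norm_diff) (auto simp: convex_on_const)
    then have "convex_on UNIV (\<lambda>y::'a. norm (y - 0) - R)" by simp
    then have \<phi>: "convex_on UNIV \<phi>"
      unfolding \<phi>_def by (intro convex_on_add convex_on_max_0 convex_on_sum_fun F abs)
    have "convex_on UNIV g"
      unfolding g_def using \<tau>(1)
      by (intro convex_on_add convex_on_cmul convex_on_compose_linear[OF \<phi> linear_fst]
          convex_on_compose_linear[OF convex_on_norm_diff linear_snd] convex_lin)
        (auto simp: convex_on_const)
    moreover have "continuous_on UNIV g"
      unfolding g_def \<phi>_def
      by (intro continuous_intros bounded_linear.continuous_on[OF blinfun.bounded_linear_right])
    moreover have "\<delta> \<le> t + g z" if z: "h z \<le> ereal t" for z t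
    proof (cases z)
      case (Pair x xs)
      then have "\<delta> \<le> t - zs x - zss xs + zss zs + \<tau> * norm (xs - zs) + \<phi> x"
        using z contr by (meson not_le)
      then show ?thesis
        by (simp add: Pair g_def blinfun.minus_left)
    qed
    ultimately obtain us uss where uss:
      "\<And>y ys. \<delta> + blinfun_apply us y + blinfun_apply uss ys + blinfun_apply uss us \<le> g (y, ys)"
      using fenchel_duality[OF conv proper conj_ge] by metis
    define a where "a = us + zs"
    obtain y where y: "\<phi> y = 0" "zss a + \<tau> * norm a - \<delta> < a y" using dual[OF \<delta>] by blast
    have e: "zs - a = - us" by (simp add: a_def)
    have eqs: "uss (zs - a) = - uss us" "zss (zs - a) = - zss us" "a y = us y + zs y"
      "zss a = zss us + zss zs"
      unfolding e by (simp_all add: a_def blinfun.minus_right blinfun.add_left blinfun.add_right)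
    have "\<delta> + us y + uss (zs - a) + uss us \<le> g (y, zs - a)"
      by (rule uss)
    also have "g (y, zs - a) = \<tau> * norm a + (- zs y - zss (zs - a) + zss zs)"
      unfolding g_def blinfun.minus_left by (simp add: y(1))
    finally have "\<delta> + a y \<le> \<tau> * norm a + zss a"
      unfolding eqs by simp
    with y(2) show False by simp
  qed
  \<comment> \<open>\<open>\<delta> * K\<close> bounds the gap \<open>t - xs x\<close>: one \<delta>
    from the recentred value, and \<open>2 * R + 1\<close> times \<open>\<delta> / \<tau>\<close>
    from exchanging \<open>zs\<close> for \<open>xs\<close>.\<close>
  define K where "K = 1 + (2 * R + 1) / \<tau>"
  have K: "K \<ge> 1" using \<tau>(1) R by (simp add: K_def)
  define s where "s = min (1 / 16) (e / (64 * N))"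
  have s: "0 < s" "16 * s \<le> 1" using e N(1) by (auto simp: s_def)
  have sN: "16 * s * N \<le> e / 4"
  proof -
    have "16 * s * N \<le> 16 * (e / (64 * N)) * N"
      unfolding s_def using N(1) by (intro mult_right_mono) auto
    then show ?thesis using N(1) by simp
  qed
  then have s_e: "16 * s \<le> e / 4" using mult_left_mono[OF N(1), of "16 * s"] s(1) by linarith
  define \<delta> where "\<delta> = min (s\<^sup>2 / K) (\<tau> * e / 4)"
  have \<delta>: "0 < \<delta>" using s(1) K \<tau>(1) e by (simp add: \<delta>_def)
  have \<delta>K: "\<delta> * K \<le> s\<^sup>2"
  proof -
    have "\<delta> * K \<le> s\<^sup>2 / K * K" unfolding \<delta>_def using K by (intro mult_right_mono) auto
    then show ?thesis using K by simp
  qed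
  have \<delta>\<tau>: "\<delta> / \<tau> \<le> e / 4"
    using \<tau>(1) by (simp add: \<delta>_def field_simps)
  have \<delta>e: "\<delta> \<le> e / 4"
  proof -
    have "\<delta> \<le> \<tau> * (e / 4)"
      using min.cobounded2[of "s\<^sup>2 / K" "\<tau> * e / 4"] by (simp only: \<delta>_def times_divide_eq_right)
    also have "\<dots> \<le> 1 * (e / 4)" using \<tau>(2) e(1) by (intro mult_right_mono) auto
    finally show ?thesis by simp
  qed
  obtain x xs t where x: "h (x, xs) \<le> ereal t"
    "t - zs x - zss xs + zss zs + \<tau> * norm (xs - zs) + \<phi> x < \<delta>"
    using approx[OF \<delta>] by blast
  have nonneg: "0 \<le> t - zs x - zss xs + zss zs"
    using le x(1) by (simp add: conj_le_iff) (smt (verit))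
  have "0 \<le> \<tau> * norm (xs - zs)" using \<tau>(1) by simp
  then have small: "\<tau> * norm (xs - zs) < \<delta>" "\<phi> x < \<delta>" "t - zs x - zss xs + zss zs < \<delta>"
    using x(2) nonneg \<phi>_nonneg[of x] by linarith+
  have xs: "norm (xs - zs) \<le> \<delta> / \<tau>" using small(1) \<tau>(1) by (simp add: field_simps)
  have \<phi>_parts: "max 0 (norm x - R) \<le> \<phi> x" "f \<in> F \<Longrightarrow> \<bar>blinfun_apply f x - zss f\<bar> - e / 4 \<le> \<phi> x" for f
  proof -
    have 1: "0 \<le> (\<Sum>f\<in>F. max 0 (\<bar>blinfun_apply f x - zss f\<bar> - e / 4))"
      by (intro sum_nonneg) auto
    then show "max 0 (norm x - R) \<le> \<phi> x" by (simp add: \<phi>_def)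
    show "\<bar>blinfun_apply f x - zss f\<bar> - e / 4 \<le> \<phi> x" if f: "f \<in> F"
    proof -
      have "max 0 (\<bar>blinfun_apply f x - zss f\<bar> - e / 4) \<le> (\<Sum>f\<in>F. max 0 (\<bar>blinfun_apply f x - zss f\<bar> - e / 4))"
        using f F by (intro member_le_sum) auto
      then show ?thesis unfolding \<phi>_def by linarith
    qed
  qed
  have xR: "norm x \<le> R + 1" using \<phi>_parts(1) small(2) \<delta>e e by linarith
  have "- ((xs - zs) x) \<le> (R + 1) * (\<delta> / \<tau>)"
  proof -
    have "- ((xs - zs) x) \<le> norm (xs - zs) * norm x"
      using norm_blinfun_real[of "xs - zs" x] by (simp add: abs_le_iff)
    also have "\<dots> \<le> (\<delta> / \<tau>) * (R + 1)" using xs xR R \<delta> \<tau>(1) by (intro mult_mono) auto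
    finally show ?thesis by (simp add: mult.commute)
  qed
  moreover have "zss (xs - zs) \<le> R * (\<delta> / \<tau>)"
  proof -
    have "zss (xs - zs) \<le> norm zss * norm (xs - zs)"
      using norm_blinfun_real[of zss "xs - zs"] by (simp add: abs_le_iff)
    also have "\<dots> \<le> R * (\<delta> / \<tau>)" using xs by (intro mult_mono) (auto simp: R_def)
    finally show ?thesis .
  qed
  moreover have "\<delta> * K = \<delta> + (R + 1) * (\<delta> / \<tau>) + R * (\<delta> / \<tau>)"
    using \<tau>(1) by (simp add: K_def field_simps)
  ultimately have "t \<le> xs x + s\<^sup>2"
    using small(3) \<delta>K by (simp add: blinfun.diff_left blinfun.diff_right)
  then have "h (x, xs) \<le> ereal (xs x + s\<^sup>2)"
    using order_trans[OF x(1)] by simp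
  then obtain y ys where y: "(y, ys) \<in> contact" "norm (y - x) \<le> 16 * s" "norm (ys - xs) \<le> 16 * s"
    using brondsted_rockafellar[OF s(1)] by blast
  show ?thesis
  proof (rule that[OF y(1)])
    show "norm y \<le> norm zss + 3"
      using y(2) s(2) xR norm_triangle_sub[of y x] by (simp add: R_def)
    have "norm (ys - zs) \<le> norm (ys - xs) + norm (xs - zs)"
      by (metis diff_add_cancel norm_triangle_ineq add_diff_eq)
    also have "\<dots> < e" using y(3) s_e xs \<delta>\<tau> e(1) by linarith
    finally show "norm (ys - zs) < e" .
    fix f assume f: "f \<in> F"
    have "\<bar>blinfun_apply f (y - x)\<bar> \<le> norm f * norm (y - x)" by (rule norm_blinfun_real)
    also have "\<dots> \<le> N * (16 * s)" using y(2) N(1) N(2)[OF f] by (intro mult_mono) auto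
    finally have "\<bar>blinfun_apply f (y - x)\<bar> \<le> e / 4" using sN by (simp add: algebra_simps)
    then show "\<bar>blinfun_apply f y - zss f\<bar> < e"
      using \<phi>_parts(2)[OF f] small(2) \<delta>e e(1) unfolding blinfun.diff_right by linarith
  qed
qed

definition contact_epi :: "(('a \<times> ('a \<Rightarrow>\<^sub>L real)) \<times> real) set" where
  "contact_epi = closure (convex hull {((y, ys), r). (y, ys) \<in> contact \<and> ys y \<le> r})"

text \<open>The largest representative function of the contact set.\<close>

definition contact_rep :: "'a \<times> ('a \<Rightarrow>\<^sub>L real) \<Rightarrow> ereal" where
  "contact_rep z = (INF r\<in>{r. (z, r) \<in> contact_epi}. ereal r)"

lemma epi_contact_rep: "epi contact_rep = contact_epi"
  unfolding contact_rep_def[abs_def]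
proof (rule epi_INF)
  show "(z, r + e) \<in> contact_epi" if "(z, r) \<in> contact_epi" "0 \<le> e" for z r e
    using that unfolding contact_epi_def
    by (auto intro!: upward_closure upward_convex_hull)
qed (simp add: contact_epi_def)

lemma contact_epi_subset: "contact_epi \<subseteq> epi h"
  unfolding contact_epi_def
  by (intro closure_minimal hull_minimal conv clo) (auto simp: contact_iff intro: le_ereal_trans)

text \<open>Up to the order of its arguments the conjugate is the Fitzpatrick function of the
  contact set, extended to the bidual: a closed halfspace contains the generating points exactly if
  it contains their closed convex hull.\<close>

lemma conj_contact_rep_le_iff:
  "conj contact_rep (zs, zss) \<le> ereal r \<longleftrightarrow>
    (\<forall>(y, ys)\<in>contact. blinfun_apply zs y + blinfun_apply zss ys - ys y \<le> r)" (is "?l \<longleftrightarrow> ?r")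
proof
  assume ?l
  then have sub: "contact_epi \<subseteq> {((x, ys), t). zs x + zss ys - t \<le> r}"
    unfolding conj_le_iff_epi epi_contact_rep .
  have "((y, ys), ys y) \<in> contact_epi" if "(y, ys) \<in> contact" for y ys
    unfolding contact_epi_def using that by (intro subsetD[OF closure_subset] hull_inc) simp
  with sub show ?r by blast
next
  assume r: ?r
  have "contact_epi \<subseteq> {((x, ys), t). zs x + zss ys - t \<le> r}"
    unfolding contact_epi_def
  proof (intro closure_minimal hull_minimal affine_halfspace)
    show "{((y, ys), r). (y, ys) \<in> contact \<and> ys y \<le> r} \<subseteq> {((x, ys), t). zs x + zss ys - t \<le> r}"
      using r by fastforce
  qed
  then show ?l
    unfolding conj_le_iff_epi epi_contact_rep .
qed

text \<open>Lying above \<open>h\<close>, the function inherits the coupling inequality. The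
  inequality for its conjugate is the substantial point and amounts to
  \<open>contact_infimum_nonpos\<close>.\<close>

lemma strong_rep_contact_rep: "strong_rep contact_rep"
proof
  show "convex (epi contact_rep)" "closed (epi contact_rep)"
    unfolding epi_contact_rep by (simp_all add: contact_epi_def convex_closure)
  show "ereal (blinfun_apply xs x) \<le> contact_rep (x, xs)" for x xs
    unfolding contact_rep_def using contact_epi_subset coupling_le
    by (intro INF_greatest) auto
  show "ereal (blinfun_apply xss xs) \<le> conj contact_rep (xs, xss)" for xs xss
  proof (rule ereal_le_real)
    fix r assume "conj contact_rep (xs, xss) \<le> ereal r"
    then have "xss xs \<le> r"
      by (intro contact_infimum_nonpos) (auto simp: conj_contact_rep_le_iff)
    then show "ereal (xss xs) \<le> ereal r" by simp
  qed
qed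

lemma contact_contact_rep: "strong_rep.contact contact_rep \<subseteq> contact"
proof
  fix p assume p: "p \<in> strong_rep.contact contact_rep"
  obtain x xs where [simp]: "p = (x, xs)" by (cases p)
  have "((x, xs), xs x) \<in> epi contact_rep"
    using p strong_rep.contact_iff[OF strong_rep_contact_rep] by simp
  then have "((x, xs), xs x) \<in> epi h"
    unfolding epi_contact_rep using contact_epi_subset by blast
  then show "p \<in> contact" by (simp add: contact_iff)
qed

text \<open>Multiplying out the monotone relation of \<open>(zss, zs)\<close> to the contact set
  gives the Fitzpatrick inequality.\<close>

lemma gossez_contactD:
  assumes "(zss, zs) \<in> gossez contact"
  shows "conj contact_rep (zs, zss) \<le> ereal (zss zs)"
  using assms unfolding conj_contact_rep_le_iff gossez_def
  by (fastforce simp: blinfun.diff_left blinfun.diff_right)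

lemma monotone_contact: "monotone_op contact"
  unfolding monotone_op_def
proof clarify
  fix x xs y ys assume x: "(x, xs) \<in> contact" and y: "(y, ys) \<in> contact"
  have "xs y + canon x ys - ys y \<le> xs x"
    using x y by (simp only: contact_iff_conj[of x xs] conj_le_iff contact_iff[of y ys])
  then show "0 \<le> (xs - ys) (x - y)"
    by (simp add: blinfun.diff_left blinfun.diff_right)
qed

text \<open>A point monotonically related to the contact set makes the conjugate of
  \<open>contact_rep\<close> touch the coupling at a canonical image; tangency returns it to the
  contact set of \<open>contact_rep\<close>, which lies in that of \<open>h\<close>.\<close>

lemma max_monotone_contact: "max_monotone contact"
  unfolding max_monotone_def
proof (intro conjI allI impI monotone_contact)
  fix G assume G: "monotone_op G \<and> contact \<subseteq> G"
  have "(x, xs) \<in> contact" if x: "(x, xs) \<in> G" for x xs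
  proof -
    have "0 \<le> (canon x - canon y) (xs - ys)" if "(y, ys) \<in> contact" for y ys
    proof -
      have "0 \<le> (xs - ys) (x - y)"
        using G x that unfolding monotone_op_def by blast
      then show ?thesis by (simp flip: canon_diff)
    qed
    then have "(canon x, xs) \<in> gossez contact"
      by (auto simp: gossez_def)
    from gossez_contactD[OF this] show ?thesis
      using strong_rep.contact_iff_conj[OF strong_rep_contact_rep, of x xs] contact_contact_rep
      by auto
  qed
  with G show "G = contact" by auto
qed

lemma type_D_contact: "type_D contact"
  unfolding type_D_def
proof clarify
  fix zss zs assume z: "(zss, zs) \<in> gossez contact"
  \<comment> \<open>The radii do not depend on the neighbourhood, so one bounded set serves all of
    them; \<open>min e 1\<close> below keeps the dual component in its ball.\<close>
  define B where "B = contact \<inter> (cball 0 (norm zss + 3) \<times> cball zs 1)"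
  have "(zss, zs) \<in> prod_topology wstar euclidean closure_of (\<lambda>(x, xs). (canon x, xs)) ` B"
    unfolding closure_of_wstar_norm_iff
  proof (intro allI impI)
    fix F :: "('a \<Rightarrow>\<^sub>L real) set" and e :: real assume F: "finite F" and e: "0 < e"
    obtain y ys where y: "(y, ys) \<in> strong_rep.contact contact_rep" "norm y \<le> norm zss + 3" "norm (ys - zs) < min e 1"
      "\<And>f. f \<in> F \<Longrightarrow> \<bar>blinfun_apply f y - zss f\<bar> < min e 1"
    proof (rule strong_rep.contact_approximation[OF strong_rep_contact_rep gossez_contactD[OF z] F])
      show "0 < min e 1" "min e 1 \<le> 1" using e by auto
    qed (rule that)
    have "(y, ys) \<in> B"
      using y(1,2,3) contact_contact_rep by (auto simp: B_def dist_norm norm_minus_commute)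
    moreover have "dist ys zs < e" using y(3) by (simp add: dist_norm)
    moreover have "\<forall>f\<in>F. \<bar>canon y f - zss f\<bar> < e" using y(4) by simp
    ultimately show "\<exists>(v', g')\<in>(\<lambda>(x, xs). (canon x, xs)) ` B.
        (\<forall>x\<in>F. \<bar>blinfun_apply v' x - zss x\<bar> < e) \<and> dist g' zs < e"
      by (intro bexI[of _ "(canon y, ys)"]) auto
  qed
  moreover have "bounded B"
    unfolding B_def by (intro bounded_Int) (auto intro!: bounded_Times)
  moreover have "B \<subseteq> contact" by (simp add: B_def)
  ultimately show "\<exists>B\<subseteq>contact. bounded B \<and>
      (zss, zs) \<in> prod_topology wstar euclidean closure_of (\<lambda>(x, xs). (canon x, xs)) ` B"
    by blast
qed

theorem max_monotone_D_contact: "max_monotone_D contact"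
  by (simp add: max_monotone_D_def max_monotone_contact type_D_contact)

theorem strong_representative_contact: "strong_representative contact h"
  unfolding strong_representative_def representative_def
proof (intro conjI conv clo allI ge conj_ge)
  show "\<forall>(x, xs)\<in>contact. h (x, xs) = ereal (xs x)"
    using ge by (auto simp: contact_iff intro: antisym)
qed

end

lemma strong_representative_strong_rep: "strong_representative G h \<Longrightarrow> strong_rep h"
  by (simp add: strong_representative_def representative_def strong_rep_def)

subsection \<open>The conjugate of the infimal convolution\<close>

text \<open>A Robinson--Ursescu theorem: by Baire category the closure of \<open>\<Lambda> ` (Q \<inter> cball 0 N)\<close> contains a
  neighbourhood of \<open>0\<close> in \<open>Y\<close>, and a geometric series in \<open>Q\<close> removes the closure.\<close>

theorem closed_convex_open_mapping:
  fixes Q :: "'e::banach set" and \<Lambda> :: "'e \<Rightarrow> 'f::banach"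
  assumes \<Lambda>: "bounded_linear \<Lambda>" and Q: "closed Q" "convex Q" and Y: "subspace Y" "closed Y"
    and QY: "\<Lambda> ` Q \<subseteq> Y" and absorb: "\<And>y. y \<in> Y \<Longrightarrow> \<exists>t>0. t *\<^sub>R y \<in> \<Lambda> ` Q"
  obtains \<delta> N where "\<delta> > 0" "\<And>w. w \<in> Y \<Longrightarrow> norm w < \<delta> \<Longrightarrow> \<exists>q\<in>Q. norm q \<le> N \<and> \<Lambda> q = w"
proof -
  note lin = bounded_linear.linear[OF \<Lambda>]
  define A where "A r = closure (\<Lambda> ` (Q \<inter> cball 0 r))" for r
  have A_mono: "A r \<subseteq> A s" if "r \<le> s" for r s
    unfolding A_def using that by (intro closure_mono image_mono) auto
  have A_convex: "convex (A r)" for r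
    unfolding A_def by (intro convex_closure convex_linear_image lin convex_Int Q convex_cball)
  \<comment> \<open>Dilated closed images of the bounded parts of \<open>Q\<close>; absorption makes
    them cover \<open>Y\<close>, so Baire's theorem applies to their traces on
    \<open>Y\<close>.\<close>
  define B where "B n = (\<lambda>x. real (Suc n) *\<^sub>R x) ` A (real n)" for n
  obtain q0 where q0: "q0 \<in> Q" "\<Lambda> q0 = 0"
    using absorb[OF subspace_0[OF Y(1)]] by auto
  have cover: "\<exists>n. y \<in> B n" if y: "y \<in> Y" for y
  proof -
    obtain t q where t: "t > 0" "q \<in> Q" "t *\<^sub>R y = \<Lambda> q" using absorb[OF y] by force
    obtain n :: nat where n: "max (max (norm q) (norm q0)) (1 / t) \<le> real n"
      using real_arch_simple by blast
    define s where "s = 1 / real (Suc n)"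
    have "1 \<le> t * real n" using n t(1) by (simp add: field_simps)
    then have "s \<le> t" using t(1) by (simp add: s_def field_simps)
    moreover have "0 \<le> s" by (simp add: s_def)
    ultimately have st: "0 \<le> s / t" "0 \<le> 1 - s / t" "s / t + (1 - s / t) = 1"
      using t(1) by (simp_all add: divide_le_eq_1_pos)
    define q' where "q' = (s / t) *\<^sub>R q + (1 - s / t) *\<^sub>R q0"
    have "q' \<in> Q \<inter> cball 0 (real n)"
      unfolding q'_def by (rule convexD[OF convex_Int[OF Q(2) convex_cball]]) (use t q0 n st in auto)
    moreover have "\<Lambda> q' = s *\<^sub>R y"
      using t(1) by (simp add: q'_def linear_add[OF lin] linear_scale[OF lin] q0(2) flip: t(3))
    ultimately have "s *\<^sub>R y \<in> A (real n)"
      unfolding A_def by (metis closure_subset image_eqI subsetD)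
    then have "y \<in> B n"
      unfolding B_def by (intro image_eqI[of _ _ "s *\<^sub>R y"]) (simp_all add: s_def)
    then show ?thesis ..
  qed
  have "\<exists>n. top_of_set Y interior_of (Y \<inter> B n) \<noteq> {}"
  proof (rule ccontr)
    assume contr: "\<not> ?thesis"
    have "top_of_set Y interior_of (\<Union> (range (\<lambda>n. Y \<inter> B n))) = {}"
    proof (intro Baire_category_alt disjI1)
      show "completely_metrizable_space (top_of_set Y)"
        using Y(2) completely_metrizable_space_closedin[OF completely_metrizable_space_euclidean, of Y]
        by simp
      show "closedin (top_of_set Y) U \<and> top_of_set Y interior_of U = {}" if "U \<in> range (\<lambda>n. Y \<inter> B n)" for U
        using that contr by (auto simp: B_def A_def intro!: closedin_closed_Int closed_scaling)
    qed simp
    moreover have "\<Union> (range (\<lambda>n. Y \<inter> B n)) = Y"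
      using cover by blast
    ultimately have "Y = {}"
      using interior_of_topspace[of "top_of_set Y"] by simp
    then show False using subspace_0[OF Y(1)] by simp
  qed
  then obtain n y0 where n: "y0 \<in> top_of_set Y interior_of (Y \<inter> B n)" by blast
  then obtain U where U: "openin (top_of_set Y) U" "y0 \<in> U" "U \<subseteq> Y \<inter> B n"
    by (auto simp: interior_of_def)
  then obtain r where r: "r > 0" "ball y0 r \<inter> Y \<subseteq> U"
    by (meson openin_contains_ball)
  have y0: "y0 \<in> Y" using U by blast
  define k where "k = real (Suc n)"
  have k: "k > 0" by (simp add: k_def)
  have ballA: "y \<in> A (real n)" if "y \<in> Y" "norm (k *\<^sub>R y - y0) < r" for y
  proof -
    have "k *\<^sub>R y \<in> ball y0 r \<inter> Y"
      using that Y(1) by (simp add: dist_norm norm_minus_commute subspace_scale)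
    then have "k *\<^sub>R y \<in> B n" using r(2) U(3) by blast
    then show ?thesis using k by (auto simp: B_def k_def)
  qed
  \<comment> \<open>The ball found so far is centred at a multiple of \<open>y0\<close>. A multiple
    of the opposite point lies in some \<open>A (real m)\<close> as well, and convexity moves the
    centre to 0.\<close>
  have "- (1 / k) *\<^sub>R y0 \<in> Y" using y0 Y(1) by (intro subspace_scale)
  then obtain m where m: "- (1 / k) *\<^sub>R y0 \<in> B m" using cover by blast
  define \<sigma> where "\<sigma> = 1 / real (Suc m)"
  have \<sigma>: "\<sigma> > 0" by (simp add: \<sigma>_def)
  have neg: "- (\<sigma> / k) *\<^sub>R y0 \<in> A (real m)"
  proof -
    obtain a where a: "a \<in> A (real m)" "- (1 / k) *\<^sub>R y0 = real (Suc m) *\<^sub>R a"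
      using m by (auto simp: B_def)
    have "\<sigma> *\<^sub>R (- (1 / k) *\<^sub>R y0) = a"
      unfolding a(2) by (simp add: \<sigma>_def)
    then show ?thesis using a(1) by simp
  qed
  define N where "N = max (real n) (real m)"
  have N: "0 \<le> N" by (simp add: N_def)
  define \<delta> where "\<delta> = \<sigma> / (1 + \<sigma>) * (r / k)"
  have \<delta>: "\<delta> > 0" using \<sigma> r k by (simp add: \<delta>_def)
  have dense: "w \<in> A N" if w: "w \<in> Y" "norm w < \<delta>" for w
  proof -
    define z where "z = (1 / k) *\<^sub>R y0 + ((1 + \<sigma>) / \<sigma>) *\<^sub>R w"
    have zY: "z \<in> Y" unfolding z_def using w y0 Y(1) by (intro subspace_add subspace_scale)
    have "k *\<^sub>R z - y0 = (k * ((1 + \<sigma>) / \<sigma>)) *\<^sub>R w"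
      using k by (simp add: z_def scaleR_add_right)
    then have "norm (k *\<^sub>R z - y0) = k * ((1 + \<sigma>) / \<sigma>) * norm w"
      using k \<sigma> by simp
    also have "\<dots> < k * ((1 + \<sigma>) / \<sigma>) * \<delta>"
      using w(2) k \<sigma> by (intro mult_strict_left_mono mult_pos_pos divide_pos_pos) auto
    also have "\<dots> = r" using k \<sigma> by (simp add: \<delta>_def)
    finally have "norm (k *\<^sub>R z - y0) < r" .
    with zY have "z \<in> A N" using ballA A_mono[of "real n" N] by (auto simp: N_def)
    moreover have "- (\<sigma> / k) *\<^sub>R y0 \<in> A N" using neg A_mono[of "real m" N] by (auto simp: N_def)
    ultimately have "(\<sigma> / (1 + \<sigma>)) *\<^sub>R z + (1 / (1 + \<sigma>)) *\<^sub>R (- (\<sigma> / k) *\<^sub>R y0) \<in> A N"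
      using \<sigma> by (intro convexD[OF A_convex]) (auto simp: add_divide_distrib[symmetric])
    moreover have "(\<sigma> / (1 + \<sigma>)) *\<^sub>R z + (1 / (1 + \<sigma>)) *\<^sub>R (- (\<sigma> / k) *\<^sub>R y0) = w"
      using \<sigma> by (simp add: z_def scaleR_add_right)
    ultimately show ?thesis by simp
  qed
  have "\<forall>w\<in>{w \<in> Y. norm w < \<delta>}. \<exists>q. q \<in> Q \<and> norm q \<le> N \<and> norm (w - \<Lambda> q) < \<delta> / 2"
  proof clarify
    fix w assume "w \<in> Y" "norm w < \<delta>"
    then obtain x where "x \<in> \<Lambda> ` (Q \<inter> cball 0 N)" "dist x w < \<delta> / 2"
      using dense \<delta> unfolding A_def closure_approachable by (meson half_gt_zero)
    then show "\<exists>q. q \<in> Q \<and> norm q \<le> N \<and> norm (w - \<Lambda> q) < \<delta> / 2"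
      by (auto simp: dist_norm norm_minus_commute)
  qed
  from bchoice[OF this] obtain g where
    g: "\<And>w. w \<in> Y \<Longrightarrow> norm w < \<delta> \<Longrightarrow> g w \<in> Q \<and> norm (g w) \<le> N \<and> norm (w - \<Lambda> (g w)) < \<delta> / 2"
    by auto
  have "\<exists>q\<in>Q. norm q \<le> N \<and> \<Lambda> q = w" if w: "w \<in> Y" "norm w < \<delta> / 2" for w
  proof -
    \<comment> \<open>The start \<open>2 *\<^sub>R w\<close> and the doubling of each remainder
      match the weights \<open>(1/2) ^ Suc i\<close>, which sum to 1: the limit is a convex series
      in \<open>Q\<close>. The start is also why norms are taken below
      \<open>\<delta> / 2\<close>.\<close>
    define W where "W = rec_nat (2 *\<^sub>R w) (\<lambda>_ v. 2 *\<^sub>R (v - \<Lambda> (g v)))"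
    have W0: "W 0 = 2 *\<^sub>R w" and WS: "\<And>i. W (Suc i) = 2 *\<^sub>R (W i - \<Lambda> (g (W i)))"
      by (simp_all add: W_def)
    have W: "W i \<in> Y \<and> norm (W i) < \<delta>" for i
    proof (induction i)
      case 0
      then show ?case using w Y(1) by (simp add: W0 subspace_scale)
    next
      case (Suc i)
      then have "g (W i) \<in> Q" "norm (W i - \<Lambda> (g (W i))) < \<delta> / 2" using g by auto
      moreover have "W (Suc i) \<in> Y"
        unfolding WS using Suc QY \<open>g (W i) \<in> Q\<close> Y(1) by (intro subspace_scale subspace_diff) auto
      ultimately show ?case by (simp add: WS)
    qed
    define q where "q i = g (W i)" for i
    have q: "q i \<in> Q" "norm (q i) \<le> N" for i
      using g W by (auto simp: q_def)
    define P where "P k = (\<Sum>i<k. (1/2) ^ Suc i *\<^sub>R q i)" for k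
    \<comment> \<open>The weights of a partial sum fall short of 1 by \<open>(1/2) ^ k\<close>;
      putting this mass on any point of \<open>Q\<close> completes a convex combination.\<close>
    have PQ: "P k + (1/2) ^ k *\<^sub>R x \<in> Q" if "x \<in> Q" for k x
      using that
    proof (induction k arbitrary: x)
      case (Suc k)
      have "(1/2) *\<^sub>R q k + (1/2) *\<^sub>R x \<in> Q"
        using q Suc.prems by (intro convexD[OF Q(2)]) auto
      from Suc.IH[OF this] show ?case
        by (simp add: P_def scaleR_add_right mult.commute add.assoc)
    qed (simp add: P_def)
    have \<Lambda>P: "\<Lambda> (P k) = w - (1/2) ^ Suc k *\<^sub>R W k" for k
    proof (induction k)
      case 0
      then show ?case by (simp add: P_def W0 linear_0[OF lin])
    next
      case (Suc k)
      have "P (Suc k) = P k + (1/2) ^ Suc k *\<^sub>R q k" by (simp add: P_def)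
      then have "\<Lambda> (P (Suc k)) = w - (1/2) ^ Suc k *\<^sub>R W k + (1/2) ^ Suc k *\<^sub>R \<Lambda> (q k)"
        by (simp only: linear_add[OF lin] linear_scale[OF lin] Suc)
      also have "\<dots> = w - (1/2) ^ Suc (Suc k) *\<^sub>R W (Suc k)"
        by (simp add: WS q_def scaleR_diff_right)
      finally show ?case .
    qed
    have pow: "(\<lambda>i. (1/2::real) ^ i) \<longlonglongrightarrow> 0" by (rule LIMSEQ_power_zero) simp
    have sums: "(\<lambda>i. (1/2) ^ Suc i * N) sums N"
      using sums_mult2[OF power_half_series, of N] by simp
    have le: "norm ((1/2) ^ Suc i *\<^sub>R q i) \<le> (1/2) ^ Suc i * N" for i
      using q(2)[of i] by (simp add: mult_left_mono)
    have summ: "summable (\<lambda>i. (1/2) ^ Suc i *\<^sub>R q i)"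
      by (rule summable_comparison_test'[OF sums_summable[OF sums] le])
    define x where "x = (\<Sum>i. (1/2) ^ Suc i *\<^sub>R q i)"
    have lim: "P \<longlonglongrightarrow> x"
      unfolding P_def x_def by (rule summable_LIMSEQ[OF summ])
    have "(\<lambda>k. P k + (1/2) ^ k *\<^sub>R q0) \<longlonglongrightarrow> x + 0 *\<^sub>R q0"
      by (intro tendsto_intros lim pow)
    then have "x \<in> Q"
      using closed_sequentially[OF Q(1), of "\<lambda>k. P k + (1/2) ^ k *\<^sub>R q0"] PQ[OF q0(1)] by simp
    moreover have "norm x \<le> N"
      using norm_suminf_le[OF le sums_summable[OF sums]] sums by (simp add: x_def sums_iff)
    moreover have "\<Lambda> x = w"
    proof (rule LIMSEQ_unique)
      show "(\<lambda>k. \<Lambda> (P k)) \<longlonglongrightarrow> \<Lambda> x" by (rule bounded_linear.tendsto[OF \<Lambda> lim])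
      have "(\<lambda>k. (1/2) ^ Suc k * \<delta>) \<longlonglongrightarrow> 0 * \<delta>"
        by (intro tendsto_intros LIMSEQ_Suc[OF pow])
      moreover have "norm ((1/2) ^ Suc k *\<^sub>R W k) \<le> (1/2) ^ Suc k * \<delta>" for k
      proof -
        have c: "0 \<le> (1/2::real) ^ Suc k" by (rule zero_le_power) simp
        show ?thesis
          unfolding norm_scaleR abs_of_nonneg[OF c]
          using W[of k] by (intro mult_left_mono c less_imp_le) blast
      qed
      ultimately have "(\<lambda>k. (1/2) ^ Suc k *\<^sub>R W k) \<longlonglongrightarrow> 0"
        unfolding mult_zero_left by (rule Lim_null_comparison[OF always_eventually, OF allI, rotated])
      then have "(\<lambda>k. w - (1/2) ^ Suc k *\<^sub>R W k) \<longlonglongrightarrow> w - 0"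
        by (intro tendsto_intros)
      then show "(\<lambda>k. \<Lambda> (P k)) \<longlonglongrightarrow> w" by (simp add: \<Lambda>P)
    qed
    ultimately show ?thesis by blast
  qed
  then show ?thesis using that[of "\<delta> / 2" N] \<delta> by auto
qed

text \<open>Nonemptiness of \<open>B\<close> makes the supremum of \<open>A\<close> finite, and this
  real number divides the joint bound between the two summands.\<close>

lemma real_sup_split:
  fixes A B :: "real set"
  assumes "A \<noteq> {}" "B \<noteq> {}" "\<And>a b. a \<in> A \<Longrightarrow> b \<in> B \<Longrightarrow> a + b \<le> r"
  obtains c where "\<And>a. a \<in> A \<Longrightarrow> a \<le> c" "\<And>b. b \<in> B \<Longrightarrow> b \<le> r - c"
proof (rule that[of "Sup A"])
  obtain b where b: "b \<in> B" using assms(2) by blast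
  have "bdd_above A"
    using assms(3)[OF _ b] by (intro bdd_aboveI[of _ "r - b"]) (simp add: le_diff_eq)
  then show "a \<le> Sup A" if "a \<in> A" for a
    using that by (rule cSup_upper[rotated])
  show "b \<le> r - Sup A" if "b \<in> B" for b
  proof -
    have "Sup A \<le> r - b"
      using assms(1,3) that by (intro cSup_least) (auto simp: le_diff_eq)
    then show ?thesis by simp
  qed
qed

lemma infconv1_le:
  assumes "hS (u, ys) \<le> ereal s" "hT (v, ys) \<le> ereal t"
  shows "infconv1 hS hT (u + v, ys) \<le> ereal (s + t)"
proof -
  have "infconv1 hS hT (u + v, ys) \<le> hS (u, ys) + hT (v, ys)"
    unfolding infconv1_def by (auto intro!: INF_lower2[of "(u, v)"])
  also have "\<dots> \<le> ereal s + ereal t" by (intro add_mono assms)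
  finally show ?thesis by simp
qed

lemma pr_dual_dom_iff: "ys \<in> pr_dual_dom h \<longleftrightarrow> (\<exists>x t. h (x, ys) \<le> ereal t)"
proof -
  have "e < \<infinity> \<longleftrightarrow> (\<exists>t. e \<le> ereal t)" for e by (cases e) auto
  then show ?thesis by (auto simp: pr_dual_dom_def)
qed

text \<open>The dual variables of \<open>hS\<close> and \<open>hT\<close> are decoupled and their
  difference is the perturbation. Small differences lift to epigraph points of bounded norm, where
  the objective is bounded; the resulting functional \<open>L\<close> splits \<open>xss\<close> into
  \<open>xss + L\<close> and \<open>- L\<close>.\<close>

lemma conj_infconv1_interior:
  fixes hS hT :: "'a::banach \<times> ('a \<Rightarrow>\<^sub>L real) \<Rightarrow> ereal"
  assumes S: "strong_rep hS" and T: "strong_rep hT"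
    and ne: "pr_dual_dom hS \<inter> pr_dual_dom hT \<noteq> {}"
    and ic: "0 \<in> ic {a - b | a b. a \<in> pr_dual_dom hS \<and> b \<in> pr_dual_dom hT}"
    and le: "conj (infconv1 hS hT) (xs, xss) \<le> ereal r"
  obtains uss vss a b where "uss + vss = xss" "conj hS (xs, uss) \<le> ereal a"
    "conj hT (xs, vss) \<le> ereal b" "a + b = r"
proof -
  interpret S: strong_rep hS by fact
  interpret T: strong_rep hT by fact
  define D where "D = {a - b | a b. a \<in> pr_dual_dom hS \<and> b \<in> pr_dual_dom hT}"
  define Y where "Y = affine hull D"
  have D0: "0 \<in> D" using ne unfolding D_def by force
  then have Y_span: "Y = span D"
    unfolding Y_def by (intro affine_hull_span_0 hull_inc)
  have "closed Y"
    using ic unfolding D_def[symmetric] ic_def Y_def by (auto split: if_splits)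
  then have Y: "subspace Y" "closed Y"
    by (simp_all add: Y_span)
  define E where "E = epi hS \<times> epi hT"
  define \<Lambda> :: "(('a \<times> ('a \<Rightarrow>\<^sub>L real)) \<times> real) \<times> (('a \<times> ('a \<Rightarrow>\<^sub>L real)) \<times> real) \<Rightarrow> _"
    where "\<Lambda> p = snd (fst (fst p)) - snd (fst (snd p))" for p
  have \<Lambda>: "bounded_linear \<Lambda>"
    unfolding \<Lambda>_def[abs_def]
    by (intro bounded_linear_sub bounded_linear_compose[OF bounded_linear_snd]
        bounded_linear_compose[OF bounded_linear_fst] bounded_linear_fst bounded_linear_snd)
  have \<Lambda>E: "\<Lambda> ` E = D"
    unfolding \<Lambda>_def E_def D_def pr_dual_dom_iff by (force simp: image_def epi_def)
  have absorb: "\<exists>t>0. t *\<^sub>R y \<in> \<Lambda> ` E" if "y \<in> Y" for y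
  proof -
    \<comment> \<open>\<open>icr\<close> speaks of the affine hull of differences of
      \<open>D\<close>; since \<open>0 \<in> D\<close>, this hull contains \<open>Y\<close>.\<close>
    have "D \<subseteq> {a - b | a b. a \<in> D \<and> b \<in> D}"
      using D0 by force
    then have "y \<in> affine hull {a - b | a b. a \<in> D \<and> b \<in> D}"
      using that hull_mono unfolding Y_def by blast
    then obtain d where "d > 0" "\<forall>t\<in>{0..d}. 0 + t *\<^sub>R y \<in> D"
      using ic unfolding D_def[symmetric] ic_def icr_def by (auto split: if_splits)
    then show ?thesis unfolding \<Lambda>E by (intro exI[of _ d]) auto
  qed
  obtain d N where d: "d > 0" "\<And>w. w \<in> Y \<Longrightarrow> norm w < d \<Longrightarrow> \<exists>q\<in>E. norm q \<le> N \<and> \<Lambda> q = w"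
  proof (rule closed_convex_open_mapping[OF \<Lambda> _ _ Y _ absorb])
    show "closed E" "convex E"
      unfolding E_def by (intro closed_Times convex_Times S.clo T.clo S.conv T.conv)+
    show "\<Lambda> ` E \<subseteq> Y" unfolding \<Lambda>E Y_def by (rule hull_subset)
  qed (assumption, rule that)
  \<comment> \<open>\<open>xss\<close> is charged to the dual variable of \<open>hS\<close> alone.
    At perturbation 0 both dual variables agree, and \<open>L\<close> redistributes the
    charge.\<close>
  define val :: "(('a \<times> ('a \<Rightarrow>\<^sub>L real)) \<times> real) \<times> (('a \<times> ('a \<Rightarrow>\<^sub>L real)) \<times> real) \<Rightarrow> _"
    where "val p = snd (fst p) + snd (snd p) - xs (fst (fst (fst p))) - xs (fst (fst (snd p)))
      - xss (snd (fst (fst p)))" for p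
  define Q where "Q = (\<lambda>p. (\<Lambda> p, val p)) ` E"
  have "linear (\<lambda>p. (\<Lambda> p, val p))"
    unfolding \<Lambda>_def val_def
    by (intro linearI) (simp_all add: blinfun.add_right blinfun.scaleR_right algebra_simps)
  then have Q: "convex Q"
    unfolding Q_def E_def by (intro convex_linear_image convex_Times S.conv T.conv)
  have split: "xs u + xss ys - s + (xs v - t) \<le> r" if "hS (u, ys) \<le> ereal s" "hT (v, ys) \<le> ereal t"
    for u v ys s t
    using le infconv1_le[of hS u ys s hT v t, OF that] unfolding conj_le_iff
    by (fastforce simp: blinfun.add_right)
  obtain L where L: "\<And>w k. (w, k) \<in> Q \<Longrightarrow> - r + blinfun_apply L w \<le> k"
  proof (rule marginal_subgradient[OF Q Y(1) _ d(1)])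
    show "w \<in> Y" if "(w, k) \<in> Q" for w k
      using that \<Lambda>E hull_subset[of D affine] unfolding Q_def Y_def by auto
    show "\<exists>k\<le>2 * N + 2 * (norm xs * N) + norm xss * N. (w, k) \<in> Q" if "w \<in> Y" "norm w < d" for w
    proof -
      obtain q where q: "q \<in> E" "norm q \<le> N" "\<Lambda> q = w" using d(2) \<open>w \<in> Y\<close> \<open>norm w < d\<close> by blast
      obtain u us s v vs t where q_eq: "q = (((u, us), s), ((v, vs), t))" by (metis surj_pair)
      have n: "norm ((u, us), s) \<le> N" "norm ((v, vs), t) \<le> N"
        using q(2) norm_fst_le[of "((u, us), s)" "((v, vs), t)"] norm_snd_le[of "((v, vs), t)" "((u, us), s)"]
        unfolding q_eq by linarith+
      have st: "\<bar>s\<bar> \<le> N" "\<bar>t\<bar> \<le> N" "norm (u, us) \<le> N" "norm (v, vs) \<le> N"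
        using n norm_snd_le[of s "(u, us)"] norm_snd_le[of t "(v, vs)"]
          norm_fst_le[of "(u, us)" s] norm_fst_le[of "(v, vs)" t] by simp_all
      have uv: "norm u \<le> N" "norm us \<le> N" "norm v \<le> N"
        using st norm_fst_le[of u us] norm_snd_le[of us u] norm_fst_le[of v vs] by linarith+
      have bnd: "- f x \<le> norm f * N" if "norm x \<le> N" for f :: "'b::real_normed_vector \<Rightarrow>\<^sub>L real" and x
        using norm_blinfun_real[of f x] mult_left_mono[OF that norm_ge_zero[of f]] by linarith
      have "val q \<le> 2 * N + 2 * (norm xs * N) + norm xss * N"
        using st(1,2) bnd[OF uv(1), of xs] bnd[OF uv(3), of xs] bnd[OF uv(2), of xss]
        unfolding val_def q_eq by simp
      then show ?thesis using q unfolding Q_def by auto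
    qed
    show "- r \<le> k" if k: "(0, k) \<in> Q" for k
    proof -
      obtain u us s v vs t where *: "hS (u, us) \<le> ereal s" "hT (v, vs) \<le> ereal t"
        "us - vs = 0" "k = s + t - xs u - xs v - xss us"
        using k by (auto simp: Q_def E_def \<Lambda>_def val_def epi_def)
      then show ?thesis using split[of u us s v t] by simp
    qed
  qed blast
  define A where "A = {xs u + (xss + L) us - s | u us s. hS (u, us) \<le> ereal s}"
  define B where "B = {xs v + (- L) vs - t | v vs t. hT (v, vs) \<le> ereal t}"
  have AB: "a + b \<le> r" if "a \<in> A" "b \<in> B" for a b
  proof -
    obtain u us s where a: "hS (u, us) \<le> ereal s" "a = xs u + (xss + L) us - s"
      using \<open>a \<in> A\<close> by (auto simp: A_def)
    obtain v vs t where b: "hT (v, vs) \<le> ereal t" "b = xs v + (- L) vs - t"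
      using \<open>b \<in> B\<close> by (auto simp: B_def)
    have "(((u, us), s), ((v, vs), t)) \<in> E" using a b by (simp add: E_def)
    then have "(us - vs, s + t - xs u - xs v - xss us) \<in> Q"
      unfolding Q_def by (intro image_eqI[of _ _ "(((u, us), s), ((v, vs), t))"]) (auto simp: \<Lambda>_def val_def)
    from L[OF this] show ?thesis
      by (simp add: a b blinfun.add_left blinfun.minus_left blinfun.diff_right)
  qed
  have "A \<noteq> {}" "B \<noteq> {}"
    using S.proper T.proper by (auto simp: A_def B_def epi_def)
  then obtain c where c: "\<And>a. a \<in> A \<Longrightarrow> a \<le> c" "\<And>b. b \<in> B \<Longrightarrow> b \<le> r - c"
    using real_sup_split[OF _ _ AB] by metis
  show ?thesis
  proof (rule that)
    show "(xss + L) + (- L) = xss" by simp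
    show "conj hS (xs, xss + L) \<le> ereal c"
      using c(1) unfolding conj_le_iff A_def by blast
    show "conj hT (xs, - L) \<le> ereal (r - c)"
      using c(2) unfolding conj_le_iff B_def by blast
  qed simp
qed

section \<open>Exactness under the weak-star closedness condition\<close>

lemma fenchel_moreau_le:
  assumes "strong_rep h"
    and bound: "\<And>ws wss s. conj h (ws, wss) \<le> ereal s \<Longrightarrow> blinfun_apply ws x + blinfun_apply wss xs - s \<le> c"
    and minorant: "conj h (as, ass) \<le> ereal a0"
  shows "h (x, xs) \<le> ereal c"
proof (rule ccontr)
  interpret strong_rep h by fact
  assume "\<not> h (x, xs) \<le> ereal c"
  from fenchel_moreau[OF conv clo minorant this] show False
    using bound by (metis not_less)
qed

definition conj_sum_epi where
  "conj_sum_epi hS hT = {(us, vs, uss + vss, r) | us vs uss vss r.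
    conj hS (us, uss) + conj hT (vs, vss) \<le> ereal r}"

text \<open>Domination by finitely many evaluations makes each partial functional an evaluation at a
  point of the predual. In the application the third factor is the bidual, so \<open>z\<close> is a
  dual vector and can be fed back into \<open>hS\<close> and \<open>hT\<close>.\<close>

lemma wstar4_functional:
  fixes L :: "('a::real_normed_vector \<Rightarrow>\<^sub>L real) \<times> ('b::real_normed_vector \<Rightarrow>\<^sub>L real) \<times>
    ('c::real_normed_vector \<Rightarrow>\<^sub>L real) \<times> real \<Rightarrow> real"
  assumes L: "linear L" and fin: "finite F" "finite G" "finite H"
    and bound: "\<And>a b c r. L (a, b, c, r) \<le>
      (\<Sum>x\<in>F. \<bar>blinfun_apply a x\<bar>) + (\<Sum>x\<in>G. \<bar>blinfun_apply b x\<bar>) + (\<Sum>x\<in>H. \<bar>blinfun_apply c x\<bar>) + \<bar>r\<bar>"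
  obtains x y z s where "\<And>a b c r. L (a, b, c, r) = blinfun_apply a x + blinfun_apply b y + blinfun_apply c z + s * r"
proof -
  have part: "\<exists>x. \<forall>a. l a = blinfun_apply a x"
    if l: "linear l" and le: "\<And>a. l a \<le> (\<Sum>x\<in>F. \<bar>blinfun_apply a x\<bar>)" and F: "finite F"
    for l :: "('d::real_normed_vector \<Rightarrow>\<^sub>L real) \<Rightarrow> real" and F
  proof -
    have "linear (\<lambda>a. blinfun_apply a x)" for x :: 'd
      by (intro linearI) (simp_all add: blinfun.add_left blinfun.scaleR_left)
    note lin = this
    have vanish: "l a = 0" if "\<And>x. x \<in> F \<Longrightarrow> blinfun_apply a x = 0" for a
      using le[of a] le[of "- a"] that by (simp add: blinfun.minus_left linear_neg[OF l])
    have "\<exists>c. \<forall>a. l a = (\<Sum>x\<in>F. c x * blinfun_apply a x)"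
      by (rule linear_combination_of_kernels[OF F lin l vanish])
    then obtain c where "\<forall>a. l a = (\<Sum>x\<in>F. c x * blinfun_apply a x)" by blast
    then have "\<forall>a. l a = blinfun_apply a (\<Sum>x\<in>F. c x *\<^sub>R x)"
      by (simp add: blinfun.sum_right blinfun.scaleR_right)
    then show ?thesis ..
  qed
  have "linear (\<lambda>a. L (a, 0, 0, 0))" "linear (\<lambda>b. L (0, b, 0, 0))" "linear (\<lambda>c. L (0, 0, c, 0))"
    by (rule linear_compose[OF _ L, unfolded o_def]; rule linearI; simp)+
  note lin = this
  obtain x where x: "\<And>a. L (a, 0, 0, 0) = blinfun_apply a x"
    using part[OF lin(1) _ fin(1)] bound[of _ 0 0 0] by (auto simp: blinfun.zero_left)
  obtain y where y: "\<And>b. L (0, b, 0, 0) = blinfun_apply b y"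
    using part[OF lin(2) _ fin(2)] bound[of 0 _ 0 0] by (auto simp: blinfun.zero_left)
  obtain z where z: "\<And>c. L (0, 0, c, 0) = blinfun_apply c z"
    using part[OF lin(3) _ fin(3)] bound[of 0 0 _ 0] by (auto simp: blinfun.zero_left)
  show ?thesis
  proof (rule that)
    fix a b c r
    have "L (a, b, c, r) = L (a, 0, 0, 0) + L (0, b, 0, 0) + L (0, 0, c, 0) + L (r *\<^sub>R (0, 0, 0, 1))"
      by (simp flip: linear_add[OF L])
    then show "L (a, b, c, r) = blinfun_apply a x + blinfun_apply b y + blinfun_apply c z + L (0, 0, 0, 1) * r"
      unfolding x y z linear_scale[OF L] by simp
  qed
qed

lemma sum_abs_far:
  fixes f g :: "'b::real_normed_vector \<Rightarrow>\<^sub>L real"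
  assumes "finite F" "x \<in> F" "\<not> \<bar>blinfun_apply f x - blinfun_apply g x\<bar> < e"
  shows "e \<le> (\<Sum>x\<in>F. \<bar>blinfun_apply (f - g) x\<bar>)"
  using member_le_sum[of x F "\<lambda>x. \<bar>blinfun_apply (f - g) x\<bar>"] assms
  by (simp add: blinfun.diff_left)

text \<open>The assumption \<open>dual\<close> bounds the conjugate of the map sending
  \<open>(u, v, zs)\<close> to \<open>hS (u, zs) + hT (v, zs)\<close>. A functional separating the
  point from the set becomes, once normalised, a primal point \<open>(X, Y, Z)\<close> where
  Fenchel--Moreau bounds both functions, in contradiction to \<open>dual\<close>.\<close>

lemma conj_sum_epi_closure:
  fixes hS hT :: "'a::banach \<times> ('a \<Rightarrow>\<^sub>L real) \<Rightarrow> ereal"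
  assumes S: "strong_rep hS" and T: "strong_rep hT"
    and conjS: "conj hS (as, ass) \<le> ereal a0" and conjT: "conj hT (bs, bss) \<le> ereal b0"
    and ne: "pr_dual_dom hS \<inter> pr_dual_dom hT \<noteq> {}"
    and dual: "\<And>u v zs s t. hS (u, zs) \<le> ereal s \<Longrightarrow> hT (v, zs) \<le> ereal t \<Longrightarrow>
      blinfun_apply xs u + blinfun_apply ys v + blinfun_apply xss zs - s - t \<le> r"
  shows "(xs, ys, xss, r) \<in>
    prod_topology wstar (prod_topology wstar (prod_topology wstar euclideanreal))
      closure_of (conj_sum_epi hS hT)"
proof (rule closure_of_wstar4_I, rule ccontr)
  interpret S: strong_rep hS by fact
  interpret T: strong_rep hT by fact
  fix F G H and e :: real
  assume fin: "finite F" "finite G" "finite H" and e: "0 < e"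
    and far: "\<not> (\<exists>(a', b', c', r')\<in>conj_sum_epi hS hT.
      (\<forall>x\<in>F. \<bar>blinfun_apply a' x - blinfun_apply xs x\<bar> < e) \<and>
      (\<forall>x\<in>G. \<bar>blinfun_apply b' x - blinfun_apply ys x\<bar> < e) \<and>
      (\<forall>x\<in>H. \<bar>blinfun_apply c' x - blinfun_apply xss x\<bar> < e) \<and> \<bar>r' - r\<bar> < e)"
  \<comment> \<open>Separate real bounds for the two conjugates make convexity a computation with
    reals; the slack \<open>k\<close> makes the set upward closed, which forces
    \<open>s \<ge> 0\<close>.\<close>
  define C where "C = {(us, vs, uss + vss, s + t + k) | us vs uss vss s t (k::real).
    conj hS (us, uss) \<le> ereal s \<and> conj hT (vs, vss) \<le> ereal t \<and> 0 \<le> k}"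
  have C_sub: "C \<subseteq> conj_sum_epi hS hT"
  proof
    fix q assume "q \<in> C"
    then obtain us vs uss vss s t k where q: "q = (us, vs, uss + vss, s + t + k)"
      "conj hS (us, uss) \<le> ereal s" "conj hT (vs, vss) \<le> ereal t" "0 \<le> k"
      by (auto simp: C_def)
    have "conj hS (us, uss) + conj hT (vs, vss) \<le> ereal s + ereal t"
      by (intro add_mono q)
    also have "\<dots> \<le> ereal (s + t + k)" using q(4) by simp
    finally show "q \<in> conj_sum_epi hS hT" unfolding q(1) conj_sum_epi_def by blast
  qed
  have C: "convex C"
  proof (rule convexI)
    fix p q and u v :: real assume p: "p \<in> C" and q: "q \<in> C" and uv: "0 \<le> u" "0 \<le> v" "u + v = 1"
    obtain us vs uss vss s t k where p: "p = (us, vs, uss + vss, s + t + k)"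
      "conj hS (us, uss) \<le> ereal s" "conj hT (vs, vss) \<le> ereal t" "0 \<le> k"
      using p by (auto simp: C_def)
    obtain us' vs' uss' vss' s' t' k' where q: "q = (us', vs', uss' + vss', s' + t' + k')"
      "conj hS (us', uss') \<le> ereal s'" "conj hT (vs', vss') \<le> ereal t'" "0 \<le> k'"
      using q by (auto simp: C_def)
    have "u *\<^sub>R p + v *\<^sub>R q = (u *\<^sub>R us + v *\<^sub>R us', u *\<^sub>R vs + v *\<^sub>R vs',
      (u *\<^sub>R uss + v *\<^sub>R uss') + (u *\<^sub>R vss + v *\<^sub>R vss'),
      (u * s + v * s') + (u * t + v * t') + (u * k + v * k'))"
      by (simp add: p q scaleR_add_right algebra_simps)
    moreover have "conj hS (u *\<^sub>R us + v *\<^sub>R us', u *\<^sub>R uss + v *\<^sub>R uss') \<le> ereal (u * s + v * s')"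
      "conj hT (u *\<^sub>R vs + v *\<^sub>R vs', u *\<^sub>R vss + v *\<^sub>R vss') \<le> ereal (u * t + v * t')"
      by (intro conj_convex p q uv)+
    moreover have "0 \<le> u * k + v * k'" using p(4) q(4) uv by simp
    ultimately show "u *\<^sub>R p + v *\<^sub>R q \<in> C" unfolding C_def by blast
  qed
  define p :: "('a \<Rightarrow>\<^sub>L real) \<times> ('a \<Rightarrow>\<^sub>L real) \<times> (('a \<Rightarrow>\<^sub>L real) \<Rightarrow>\<^sub>L real) \<times> real \<Rightarrow> real"
    where "p q = (\<Sum>x\<in>F. \<bar>fst q x\<bar>) + (\<Sum>x\<in>G. \<bar>fst (snd q) x\<bar>) + (\<Sum>x\<in>H. \<bar>fst (snd (snd q)) x\<bar>)
      + \<bar>snd (snd (snd q))\<bar>" for q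
  have p: "sublinear p"
    unfolding sublinear_def
  proof (intro conjI allI impI)
    fix q q'
    have *: "(\<Sum>x\<in>F. \<bar>(f + g) x\<bar>) \<le> (\<Sum>x\<in>F. \<bar>f x\<bar>) + (\<Sum>x\<in>F. \<bar>g x\<bar>)"
      for F and f g :: "'b::real_normed_vector \<Rightarrow>\<^sub>L real"
      unfolding sum.distrib[symmetric] by (intro sum_mono) (simp add: blinfun.add_left)
    show "p (q + q') \<le> p q + p q'"
      unfolding p_def fst_add snd_add
      using *[of "fst q" "fst q'" F] *[of "fst (snd q)" "fst (snd q')" G]
        *[of "fst (snd (snd q))" "fst (snd (snd q'))" H]
        abs_triangle_ineq[of "snd (snd (snd q))" "snd (snd (snd q'))"]
      by linarith
  next
    fix t :: real and q assume "t > 0"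
    then show "p (t *\<^sub>R q) \<le> t * p q"
      by (simp add: p_def blinfun.scaleR_left abs_mult sum_distrib_left distrib_left)
  qed
  define z0 where "z0 = (xs, ys, xss, r)"
  have sep: "e \<le> p (q - z0)" if "q \<in> C" for q
  proof -
    obtain a b c k where q: "q = (a, b, c, k)" by (metis surj_pair)
    have nn: "0 \<le> (\<Sum>x\<in>F. \<bar>f x\<bar>)" for F and f :: "'b::real_normed_vector \<Rightarrow>\<^sub>L real"
      by (intro sum_nonneg) auto
    note nns = nn[of "a - xs" F] nn[of "b - ys" G] nn[of "c - xss" H] abs_ge_zero[of "k - r"]
    have p_eq: "p (q - z0) = (\<Sum>x\<in>F. \<bar>(a - xs) x\<bar>) + (\<Sum>x\<in>G. \<bar>(b - ys) x\<bar>)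
        + (\<Sum>x\<in>H. \<bar>(c - xss) x\<bar>) + \<bar>k - r\<bar>"
      by (simp add: p_def q z0_def)
    have "(\<exists>x\<in>F. \<not> \<bar>blinfun_apply a x - blinfun_apply xs x\<bar> < e) \<or>
      (\<exists>x\<in>G. \<not> \<bar>blinfun_apply b x - blinfun_apply ys x\<bar> < e) \<or>
      (\<exists>x\<in>H. \<not> \<bar>blinfun_apply c x - blinfun_apply xss x\<bar> < e) \<or> \<not> \<bar>k - r\<bar> < e"
      using far C_sub that unfolding q by blast
    then have "e \<le> (\<Sum>x\<in>F. \<bar>(a - xs) x\<bar>) \<or> e \<le> (\<Sum>x\<in>G. \<bar>(b - ys) x\<bar>) \<or>
        e \<le> (\<Sum>x\<in>H. \<bar>(c - xss) x\<bar>) \<or> e \<le> \<bar>k - r\<bar>"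
      using sum_abs_far[OF fin(1), of _ a xs e] sum_abs_far[OF fin(2), of _ b ys e]
        sum_abs_far[OF fin(3), of _ c xss e] by (meson not_less)
    then show ?thesis
      unfolding p_eq using nns by linarith
  qed
  obtain L where L: "linear L" "L \<le> p" "\<And>q. q \<in> C \<Longrightarrow> L z0 + e \<le> L q"
    using convex_separation[OF p C sep] by blast
  obtain x y z s where L_eq: "\<And>a b c k. L (a, b, c, k) =
      blinfun_apply a x + blinfun_apply b y + blinfun_apply c z + s * k"
  proof (rule wstar4_functional[OF L(1) fin])
    show "L (a, b, c, k) \<le> (\<Sum>x\<in>F. \<bar>a x\<bar>) + (\<Sum>x\<in>G. \<bar>b x\<bar>) + (\<Sum>x\<in>H. \<bar>c x\<bar>) + \<bar>k\<bar>" for a b c k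
      using le_funD[OF L(2), of "(a, b, c, k)"] by (simp add: p_def)
  qed (rule that)
  have LC: "L z0 + e \<le> us x + vs y + (uss + vss) z + s * (c + d + k)"
    if "conj hS (us, uss) \<le> ereal c" "conj hT (vs, vss) \<le> ereal d" "0 \<le> k" for us vs uss vss c d k
    using L(3)[of "(us, vs, uss + vss, c + d + k)"] that unfolding L_eq C_def by blast
  have s: "s \<ge> 0"
  proof (rule ccontr)
    assume neg: "\<not> s \<ge> 0"
    define D where "D = as x + bs y + (ass + bss) z + s * (a0 + b0) - (L z0 + e)"
    have "0 \<le> D + s * k" if "0 \<le> k" for k
      using LC[OF conjS conjT that] by (simp add: D_def algebra_simps)
    from this[of 0] this[of "(D + 1) / (- s)"] neg show False
      by (simp add: field_simps)
  qed
  text \<open>A point of the domain of \<open>(u, v, zs) \<mapsto> hS (u, zs) + hT (v, zs)\<close> supplies a functional with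
    positive last coordinate that is bounded below on \<open>C\<close>; adding it to \<open>L\<close> makes the
    separating functional nonvertical.\<close>
  obtain u0 v0 zs0 s0 t0 where 0: "hS (u0, zs0) \<le> ereal s0" "hT (v0, zs0) \<le> ereal t0"
    using ne by (auto simp: pr_dual_dom_iff)
  define P where "P = s0 + t0 - xs u0 - ys v0 - xss zs0 + r"
  have P: "P \<ge> 0" using dual[OF 0] by (simp add: P_def)
  \<comment> \<open>\<open>P\<close> is the slack of \<open>dual\<close> at the domain point;
    \<open>l\<close> is chosen to make the final inequality \<open>l * e \<le> P\<close>
    impossible.\<close>
  define l where "l = (P + 1) / e"
  have l: "l > 0" "l * e = P + 1" using P e by (simp_all add: l_def)
  define m where "m = l * s + 1"
  have m: "m > 0" using l s by (simp add: m_def add_nonneg_pos)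
  define X where "X = (1 / m) *\<^sub>R (u0 - l *\<^sub>R x)"
  define Y where "Y = (1 / m) *\<^sub>R (v0 - l *\<^sub>R y)"
  define Z where "Z = (1 / m) *\<^sub>R (zs0 - l *\<^sub>R z)"
  define \<beta> where "\<beta> = (1 / m) * (s0 + t0 - l * (L z0 + e))"
  have key: "(us X + uss Z - c) + (vs Y + vss Z - d) \<le> \<beta>"
    if "conj hS (us, uss) \<le> ereal c" "conj hT (vs, vss) \<le> ereal d" for us vs uss vss c d
  proof -
    have "l * (L z0 + e) \<le> l * (us x + vs y + (uss + vss) z + s * (c + d))"
      using LC[OF that, of 0] l(1) by (intro mult_left_mono) auto
    moreover have "us u0 + uss zs0 - s0 \<le> c" "vs v0 + vss zs0 - t0 \<le> d"
      using that 0 by (simp_all add: conj_le_iff)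
    ultimately have "us u0 + uss zs0 + vs v0 + vss zs0 - l * (us x + vs y + (uss + vss) z)
        - m * (c + d) \<le> s0 + t0 - l * (L z0 + e)"
      by (simp add: m_def algebra_simps)
    then have "(1 / m) * (us u0 + uss zs0 + vs v0 + vss zs0 - l * (us x + vs y + (uss + vss) z)
        - m * (c + d)) \<le> \<beta>"
      unfolding \<beta>_def using m by (intro mult_left_mono) auto
    moreover have "(1 / m) * (us u0 + uss zs0 + vs v0 + vss zs0 - l * (us x + vs y + (uss + vss) z)
        - m * (c + d)) = (us X + uss Z - c) + (vs Y + vss Z - d)"
      using m by (simp add: X_def Y_def Z_def blinfun.scaleR_right blinfun.diff_right blinfun.add_left
          field_simps)
    ultimately show ?thesis by simp
  qed
  \<comment> \<open>The two families are bounded jointly by \<beta>. Splitting \<beta> turns this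
    into one bound on each biconjugate, both at the same dual point \<open>Z\<close>.\<close>
  define A where "A = {blinfun_apply us X + blinfun_apply uss Z - c | us uss c. conj hS (us, uss) \<le> ereal c}"
  define B where "B = {blinfun_apply vs Y + blinfun_apply vss Z - d | vs vss d. conj hT (vs, vss) \<le> ereal d}"
  have "A \<noteq> {}" "B \<noteq> {}" using conjS conjT by (auto simp: A_def B_def)
  moreover have "a + b \<le> \<beta>" if "a \<in> A" "b \<in> B" for a b
    using that key unfolding A_def B_def by blast
  ultimately obtain k where k: "\<And>a. a \<in> A \<Longrightarrow> a \<le> k" "\<And>b. b \<in> B \<Longrightarrow> b \<le> \<beta> - k"
    using real_sup_split by metis
  have "hS (X, Z) \<le> ereal k"
    by (rule fenchel_moreau_le[OF S _ conjS]) (use k(1) in \<open>auto simp: A_def\<close>)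
  moreover have "hT (Y, Z) \<le> ereal (\<beta> - k)"
    by (rule fenchel_moreau_le[OF T _ conjT]) (use k(2) in \<open>auto simp: B_def\<close>)
  ultimately have "xs X + ys Y + xss Z - k - (\<beta> - k) \<le> r"
    by (rule dual)
  then have "m * (xs X + ys Y + xss Z) \<le> m * (r + \<beta>)"
    using m by (intro mult_left_mono) auto
  moreover have "m * (xs X + ys Y + xss Z) = xs u0 + ys v0 + xss zs0 - l * (xs x + ys y + xss z)"
    using m by (simp add: X_def Y_def Z_def blinfun.scaleR_right blinfun.diff_right field_simps)
  moreover have "m * (r + \<beta>) = m * r + s0 + t0 - l * (L z0 + e)"
    using m by (simp add: \<beta>_def field_simps)
  moreover have "L z0 = xs x + ys y + xss z + s * r" by (simp add: z0_def L_eq)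
  ultimately have "l * e \<le> P"
    by (simp add: m_def P_def algebra_simps)
  with l(2) show False by simp
qed

text \<open>For \<open>xs = ys\<close> the bound on the conjugate of the convolution is the
  \<open>dual\<close> assumption of the closure lemma, and relative closedness on the diagonal
  removes the closure.\<close>

lemma conj_infconv1_closed:
  fixes hS hT :: "'a::banach \<times> ('a \<Rightarrow>\<^sub>L real) \<Rightarrow> ereal"
  assumes S: "strong_rep hS" and T: "strong_rep hT"
    and conjS: "conj hS (as, ass) \<le> ereal a0" and conjT: "conj hT (bs, bss) \<le> ereal b0"
    and ne: "pr_dual_dom hS \<inter> pr_dual_dom hT \<noteq> {}"
    and closed: "closed_regarding
      (prod_topology wstar (prod_topology wstar (prod_topology wstar euclideanreal)))
      (conj_sum_epi hS hT) {(xs, ys, zss, r). xs = ys}"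
    and le: "conj (infconv1 hS hT) (xs, xss) \<le> ereal r"
  obtains uss vss where "uss + vss = xss" "conj hS (xs, uss) + conj hT (xs, vss) \<le> ereal r"
proof -
  have "(xs, xs, xss, r) \<in>
    prod_topology wstar (prod_topology wstar (prod_topology wstar euclideanreal))
      closure_of (conj_sum_epi hS hT)"
  proof (rule conj_sum_epi_closure[OF S T conjS conjT ne])
    fix u v zs s t assume "hS (u, zs) \<le> ereal s" "hT (v, zs) \<le> ereal t"
    from infconv1_le[of hS u zs s hT v t, OF this] show "xs u + xs v + xss zs - s - t \<le> r"
      using le unfolding conj_le_iff by (fastforce simp: blinfun.add_right)
  qed
  then have "(xs, xs, xss, r) \<in> conj_sum_epi hS hT"
    using closed unfolding closed_regarding_def by blast
  then show ?thesis using that by (auto simp: conj_sum_epi_def)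
qed

subsection \<open>The Gossez closure and the parallel sum\<close>

lemma conj_contact_diagonal:
  fixes G :: "('a::banach \<times> ('a \<Rightarrow>\<^sub>L real)) set"
  assumes "strong_representative G h" "(x, xs) \<in> G"
  shows "conj h (xs, canon x) \<le> ereal (xs x)"
proof -
  interpret strong_rep h using assms(1) by (rule strong_representative_strong_rep)
  have "h (x, xs) = ereal (xs x)"
    using assms by (auto simp: strong_representative_def representative_def)
  then show ?thesis
    by (intro conj_le_coupling conv ge) simp
qed

text \<open>From right to left this is Fenchel--Young at the points of \<open>G\<close>. Conversely,
  tangency bounds the conjugate by the coupling along the approximating points, and boundedness
  controls \<open>(g - xs) y\<close>, so that the coupling of a weak-star and a norm approximation
  passes to the limit.\<close>

lemma gossez_iff_conj:
  fixes G :: "('a::banach \<times> ('a \<Rightarrow>\<^sub>L real)) set"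
  assumes h: "strong_representative G h" and G: "type_D G"
  shows "(xss, xs) \<in> gossez G \<longleftrightarrow> conj h (xs, xss) \<le> ereal (xss xs)"
proof
  assume le: "conj h (xs, xss) \<le> ereal (xss xs)"
  have "0 \<le> (xss - canon y) (xs - ys)" if "(y, ys) \<in> G" for y ys
  proof -
    have "h (y, ys) \<le> ereal (ys y)"
      using h that by (auto simp: strong_representative_def representative_def)
    then have "xs y + xss ys - ys y \<le> xss xs" using le by (simp add: conj_le_iff)
    then show ?thesis by (simp add: blinfun.diff_left blinfun.diff_right)
  qed
  then show "(xss, xs) \<in> gossez G" by (auto simp: gossez_def)
next
  assume "(xss, xs) \<in> gossez G"
  then obtain B where B: "B \<subseteq> G" "bounded B"
    "(xss, xs) \<in> prod_topology wstar euclidean closure_of (\<lambda>(x, xs). (canon x, xs)) ` B"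
    using G unfolding type_D_def by blast
  obtain K where K: "K > 0" "\<And>p. p \<in> B \<Longrightarrow> norm p \<le> K"
    using B(2) by (meson bounded_pos)
  show "conj h (xs, xss) \<le> ereal (xss xs)"
    unfolding conj_le_iff
  proof (intro allI impI)
    fix x ys t assume t: "h (x, ys) \<le> ereal t"
    show "xs x + xss ys - t \<le> xss xs"
    proof (rule field_le_epsilon)
      fix e :: real assume e: "e > 0"
      \<comment> \<open>Four errors add up to \<open>e\<close>: \<open>d * norm x\<close> and
        \<open>d * K\<close> from \<open>g - xs\<close>, and one \<open>d\<close> for each test
        functional \<open>xs\<close> and \<open>ys\<close>.\<close>
      define d where "d = e / (norm x + K + 2)"
      have den: "norm x + K + 2 > 0" using K(1) by (simp add: add_nonneg_pos)
      have d: "d > 0" "d * (norm x + K + 2) = e" using e den by (simp_all add: d_def)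
      have "\<exists>(v, g)\<in>(\<lambda>(x, xs). (canon x, xs)) ` B.
          (\<forall>f\<in>{xs, ys}. \<bar>blinfun_apply v f - xss f\<bar> < d) \<and> dist g xs < d"
        using B(3)[unfolded closure_of_wstar_norm_iff, rule_format, of "{xs, ys}" d] d(1) by simp
      then obtain y g where y: "(y, g) \<in> B" and
        vg: "\<bar>xs y - xss xs\<bar> < d" "\<bar>ys y - xss ys\<bar> < d" "dist g xs < d"
        by auto
      have "conj h (g, canon y) \<le> ereal (g y)"
        using conj_contact_diagonal[OF h] y B(1) by blast
      then have "g x + ys y - t \<le> g y" using t by (simp add: conj_le_iff)
      moreover have "norm y \<le> K"
        using K(2)[OF y] norm_fst_le[of y g] by linarith
      then have "(g - xs) y \<le> d * K"
        using norm_blinfun_real[of "g - xs" y] vg(3) mult_mono[of "norm (g - xs)" d "norm y" K] d(1)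
        by (simp add: dist_norm)
      moreover have "- ((g - xs) x) \<le> d * norm x"
        using norm_blinfun_real[of "g - xs" x] vg(3) mult_right_mono[of "norm (g - xs)" d "norm x"]
        by (simp add: dist_norm)
      moreover note vg(1,2)
      moreover have "d * norm x + d * K + 2 * d = e"
        using d(2) by (simp add: algebra_simps)
      ultimately show "xs x + xss ys - t \<le> xss xs + e"
        by (simp add: blinfun.diff_left)
    qed
  qed
qed

lemma max_monotone_nonempty: "max_monotone G \<Longrightarrow> G \<noteq> {}"
proof
  assume G: "max_monotone G" "G = {}"
  have "monotone_op {(0, 0)}" by (simp add: monotone_op_def)
  then show False using G unfolding max_monotone_def by blast
qed

lemma max_monotone_gossez_canon:
  assumes G: "max_monotone G" and x: "(canon x, xs) \<in> gossez G"
  shows "(x, xs) \<in> G"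
proof -
  have *: "0 \<le> (xs - ys) (x - y)" if "(y, ys) \<in> G" for y ys
    using x that by (auto simp: gossez_def simp flip: canon_diff)
  moreover have "(ys - xs) (y - x) = (xs - ys) (x - y)" for y ys
    by (simp add: blinfun.diff_left blinfun.diff_right)
  ultimately have "monotone_op (insert (x, xs) G)"
    using G unfolding monotone_op_def max_monotone_def by auto
  then show ?thesis using G unfolding max_monotone_def by blast
qed

lemma gossez_canon_mem: "monotone_op G \<Longrightarrow> (x, xs) \<in> G \<Longrightarrow> (canon x, xs) \<in> gossez G"
  unfolding gossez_def monotone_op_def by (fastforce simp flip: canon_diff)

text \<open>The bidual summands add up to a point of \<open>X\<close>, so if one lies in
  \<open>X\<close> the other does too; maximality brings Gossez pairs over \<open>X\<close> back
  into the operators.\<close>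

lemma par_sum_bar_eq_par_sum:
  assumes S: "max_monotone S" and T: "max_monotone T"
    and dom: "Domain (gossez S) \<subseteq> range canon \<or> Domain (gossez T) \<subseteq> range canon"
  shows "par_sum_bar S T = par_sum S T"
proof (intro set_eqI iffI; clarify)
  fix x xs assume "(x, xs) \<in> par_sum_bar S T"
  then obtain uss vss where uv: "uss + vss = canon x" "(uss, xs) \<in> gossez S" "(vss, xs) \<in> gossez T"
    by (auto simp: par_sum_bar_def)
  have "\<exists>u v. uss = canon u \<and> vss = canon v \<and> u + v = x"
  proof (cases "uss \<in> range canon")
    case True
    then obtain u where "uss = canon u" by blast
    moreover from this uv(1) have "vss = canon (x - u)" by (simp add: canon_diff algebra_simps)
    ultimately show ?thesis by (intro exI[of _ u] exI[of _ "x - u"]) simp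
  next
    case False
    then obtain v where "vss = canon v" using dom uv(2,3) by blast
    moreover from this uv(1) have "uss = canon (x - v)" by (simp add: canon_diff algebra_simps)
    ultimately show ?thesis by (intro exI[of _ "x - v"] exI[of _ v]) simp
  qed
  then obtain u v where "uss = canon u" "vss = canon v" "u + v = x" by blast
  moreover from this have "(u, xs) \<in> S" "(v, xs) \<in> T"
    using uv max_monotone_gossez_canon[OF S] max_monotone_gossez_canon[OF T] by blast+
  ultimately show "(x, xs) \<in> par_sum S T"
    unfolding par_sum_def by blast
next
  fix x xs assume "(x, xs) \<in> par_sum S T"
  then obtain u w where "u + w = x" "(u, xs) \<in> S" "(w, xs) \<in> T" by (auto simp: par_sum_def)
  then have "canon u + canon w = canon x" "(canon u, xs) \<in> gossez S" "(canon w, xs) \<in> gossez T"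
    using S T by (auto simp: canon_add max_monotone_def intro: gossez_canon_mem)
  then show "(x, xs) \<in> par_sum_bar S T"
    unfolding par_sum_bar_def by blast
qed

text \<open>The epigraph of \<open>infconv1\<close> only up to closure, as the infimum need not be attained.\<close>

definition infconv1_epi where
  "infconv1_epi hS hT = {((u + w, xs), s + t) | u w xs s t.
    hS (u, xs) \<le> ereal s \<and> hT (w, xs) \<le> ereal t}"

lemma convex_infconv1_epi:
  assumes S: "convex (epi hS)" and T: "convex (epi hT)"
  shows "convex (infconv1_epi hS hT)"
proof (rule convexI)
  fix p q and a b :: real
  assume p: "p \<in> infconv1_epi hS hT" and q: "q \<in> infconv1_epi hS hT"
    and ab: "0 \<le> a" "0 \<le> b" "a + b = 1"
  obtain u w xs s t where p: "p = ((u + w, xs), s + t)" "hS (u, xs) \<le> ereal s" "hT (w, xs) \<le> ereal t"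
    using p by (auto simp: infconv1_epi_def)
  obtain u' w' xs' s' t' where q: "q = ((u' + w', xs'), s' + t')"
    "hS (u', xs') \<le> ereal s'" "hT (w', xs') \<le> ereal t'"
    using q by (auto simp: infconv1_epi_def)
  have "a *\<^sub>R ((u, xs), s) + b *\<^sub>R ((u', xs'), s') \<in> epi hS"
    "a *\<^sub>R ((w, xs), t) + b *\<^sub>R ((w', xs'), t') \<in> epi hT"
    using p q ab by (auto intro!: convexD[OF S] convexD[OF T] simp del: scaleR_Pair add_Pair)
  then have "hS (a *\<^sub>R u + b *\<^sub>R u', a *\<^sub>R xs + b *\<^sub>R xs') \<le> ereal (a * s + b * s')"
    "hT (a *\<^sub>R w + b *\<^sub>R w', a *\<^sub>R xs + b *\<^sub>R xs') \<le> ereal (a * t + b * t')"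
    by simp_all
  moreover have "a *\<^sub>R p + b *\<^sub>R q = (((a *\<^sub>R u + b *\<^sub>R u') + (a *\<^sub>R w + b *\<^sub>R w'), a *\<^sub>R xs + b *\<^sub>R xs'),
      (a * s + b * s') + (a * t + b * t'))"
    by (simp add: p q algebra_simps)
  ultimately show "a *\<^sub>R p + b *\<^sub>R q \<in> infconv1_epi hS hT"
    unfolding infconv1_epi_def by blast
qed

lemma epi_lsc_infconv1:
  fixes hS hT :: "'a::real_normed_vector \<times> ('a \<Rightarrow>\<^sub>L real) \<Rightarrow> ereal"
  assumes S: "\<And>z. hS z \<noteq> - \<infinity>" and T: "\<And>z. hT z \<noteq> - \<infinity>"
  shows "epi (lsc_hull (infconv1 hS hT)) = closure (infconv1_epi hS hT)"
proof -
  have "epi (infconv1 hS hT) \<subseteq> closure (infconv1_epi hS hT)"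
  proof clarify
    fix x xs r assume "((x, xs), r) \<in> epi (infconv1 hS hT)"
    then have le: "infconv1 hS hT (x, xs) \<le> ereal r" by simp
    have "((x, xs), r + inverse (real (Suc n))) \<in> infconv1_epi hS hT" for n
    proof -
      have "infconv1 hS hT (x, xs) < ereal (r + inverse (real (Suc n)))"
        by (rule le_less_trans[OF le]) simp
      then obtain u w where uw: "u + w = x" "hS (u, xs) + hT (w, xs) < ereal (r + inverse (real (Suc n)))"
        by (auto simp: infconv1_def INF_less_iff)
      \<comment> \<open>Neither value is minus infinity, so a sum below a real number forces both to
        be finite.\<close>
      obtain s where s: "hS (u, xs) = ereal s"
        using uw(2) S[of "(u, xs)"] T[of "(w, xs)"] by (cases "hS (u, xs)"; cases "hT (w, xs)") auto
      have "hT (w, xs) \<le> ereal (r + inverse (real (Suc n)) - s)"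
        using uw(2) T[of "(w, xs)"] by (cases "hT (w, xs)") (auto simp: s)
      then show ?thesis
        unfolding infconv1_epi_def using uw(1) s
        by (intro CollectI exI[of _ u] exI[of _ w] exI[of _ xs] exI[of _ s]
            exI[of _ "r + inverse (real (Suc n)) - s"]) simp
    qed
    moreover have "(\<lambda>n. ((x, xs), r + inverse (real (Suc n)))) \<longlonglongrightarrow> ((x, xs), r)"
      by (intro tendsto_intros LIMSEQ_inverse_real_of_nat_add)
    ultimately show "((x, xs), r) \<in> closure (infconv1_epi hS hT)"
      unfolding closure_sequential
      by (intro exI[of _ "\<lambda>n. ((x, xs), r + inverse (real (Suc n)))"]) auto
  qed
  moreover have "infconv1_epi hS hT \<subseteq> epi (infconv1 hS hT)"
    by (auto simp: infconv1_epi_def simp del: plus_ereal.simps intro!: infconv1_le)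
  ultimately show ?thesis
    unfolding epi_lsc_hull by (intro antisym closure_minimal closure_mono) auto
qed

text \<open>Two lower bounds whose sum is sharp are both sharp. This turns touching of the coupling
  by the sum of the conjugates into touching by each.\<close>

lemma ereal_add_contact:
  assumes "ereal p \<le> a" "ereal q \<le> b" "a + b \<le> ereal (p + q)"
  shows "a \<le> ereal p" "b \<le> ereal q"
  using assms by (cases a; cases b; auto)+

theorem theorem4p1:
  fixes S T :: "('a::banach \<times> ('a \<Rightarrow>\<^sub>L real)) set"
    and hS hT :: "'a \<times> ('a \<Rightarrow>\<^sub>L real) \<Rightarrow> ereal"
  assumes nontriv: "\<exists>x::'a. x \<noteq> 0"
    and S: "max_monotone_D S" and T: "max_monotone_D T"
    and hS: "strong_representative S hS" and hT: "strong_representative T hT"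
    and ne: "pr_dual_dom hS \<inter> pr_dual_dom hT \<noteq> {}"
    and cq: "0 \<in> ic {a - b | a b. a \<in> pr_dual_dom hS \<and> b \<in> pr_dual_dom hT}
           \<or> closed_regarding
               (prod_topology wstar (prod_topology wstar (prod_topology wstar euclideanreal)))
               {(us, vs, uss + vss, r) | us vs uss vss r.
                   conj hS (us, uss) + conj hT (vs, vss) \<le> ereal r}
               {(xs, ys, zss, r). xs = ys}"
  shows "strong_representative (par_sum_bar S T) (lsc_hull (infconv1 hS hT))
         \<and> max_monotone_D (par_sum_bar S T)
         \<and> ((Domain (gossez S) \<subseteq> range canon \<or> Domain (gossez T) \<subseteq> range canon) \<longrightarrow>
              strong_representative (par_sum S T) (lsc_hull (infconv1 hS hT))
              \<and> max_monotone_D (par_sum S T))"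
proof -
  interpret S: strong_rep hS using hS by (rule strong_representative_strong_rep)
  interpret T: strong_rep hT using hT by (rule strong_representative_strong_rep)
  define h where "h = lsc_hull (infconv1 hS hT)"
  have epi_h: "epi h = closure (infconv1_epi hS hT)"
    unfolding h_def using S.ge T.ge by (intro epi_lsc_infconv1) (metis surj_pair MInfty_neq_ereal(1) ereal_infty_less_eq(2))+
  have mS: "max_monotone S" "type_D S" and mT: "max_monotone T" "type_D T"
    using S T by (simp_all add: max_monotone_D_def)
  obtain x1 xs1 x2 xs2 where "(x1, xs1) \<in> S" "(x2, xs2) \<in> T"
    using max_monotone_nonempty[OF mS(1)] max_monotone_nonempty[OF mT(1)] by auto
  \<comment> \<open>A point of either operator supplies an affine minorant of its representative
    function, from which the weak-star argument starts.\<close>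
  note fin = conj_contact_diagonal[OF hS this(1)] conj_contact_diagonal[OF hT this(2)]
  have decompose: "\<exists>uss vss. uss + vss = xss \<and> conj hS (xs, uss) + conj hT (xs, vss) \<le> ereal r"
    if le: "conj h (xs, xss) \<le> ereal r" for xs xss r
  proof -
    have le': "conj (infconv1 hS hT) (xs, xss) \<le> ereal r"
      using le by (simp add: h_def conj_lsc_hull)
    from cq show ?thesis
    proof
      assume ic: "0 \<in> ic {a - b | a b. a \<in> pr_dual_dom hS \<and> b \<in> pr_dual_dom hT}"
      obtain uss vss a b where uv: "uss + vss = xss" "conj hS (xs, uss) \<le> ereal a"
        "conj hT (xs, vss) \<le> ereal b" "a + b = r"
        using conj_infconv1_interior[OF S.strong_rep_axioms T.strong_rep_axioms ne ic le'] .
      have "conj hS (xs, uss) + conj hT (xs, vss) \<le> ereal a + ereal b"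
        by (intro add_mono uv)
      also have "\<dots> = ereal r" using uv(4) by simp
      finally show ?thesis using uv(1) by blast
    next
      assume "closed_regarding
        (prod_topology wstar (prod_topology wstar (prod_topology wstar euclideanreal)))
        {(us, vs, uss + vss, r) | us vs uss vss r. conj hS (us, uss) + conj hT (vs, vss) \<le> ereal r}
        {(xs, ys, zss, r). xs = ys}"
      note closed = this[folded conj_sum_epi_def]
      obtain uss vss where "uss + vss = xss" "conj hS (xs, uss) + conj hT (xs, vss) \<le> ereal r"
        using conj_infconv1_closed[OF S.strong_rep_axioms T.strong_rep_axioms fin ne closed le'] .
      then show ?thesis by blast
    qed
  qed
  \<comment> \<open>The easy half of the convolution formula; \<open>decompose\<close> is the half
    that rests on (a) or (b).\<close>
  have conj_le: "conj h (xs, uss + vss) \<le> ereal (a + b)"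
    if "conj hS (xs, uss) \<le> ereal a" "conj hT (xs, vss) \<le> ereal b" for xs uss vss a b
    unfolding conj_le_iff_epi epi_h
  proof (intro closure_minimal affine_halfspace(2) subsetI)
    fix p assume "p \<in> infconv1_epi hS hT"
    then obtain u w ys s t where p: "p = ((u + w, ys), s + t)" "hS (u, ys) \<le> ereal s" "hT (w, ys) \<le> ereal t"
      by (auto simp: infconv1_epi_def)
    then have "xs u + uss ys - s \<le> a" "xs w + vss ys - t \<le> b"
      using that by (simp_all add: conj_le_iff)
    then show "p \<in> {((x, ys), t). xs x + (uss + vss) ys - t \<le> a + b}"
      by (simp add: p(1) blinfun.add_left blinfun.add_right)
  qed
  interpret strong_rep h
  proof
    show "convex (epi h)"
      unfolding epi_h by (intro convex_closure convex_infconv1_epi S.conv T.conv)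
    show "closed (epi h)"
      by (simp add: epi_h)
    show "ereal (blinfun_apply xs x) \<le> h (x, xs)" for x xs
    proof (rule ereal_le_real)
      have "closure (infconv1_epi hS hT) \<subseteq> {p. blinfun_apply (snd (fst p)) (fst (fst p)) \<le> snd p}"
      proof (rule closure_minimal)
        show "infconv1_epi hS hT \<subseteq> {p. blinfun_apply (snd (fst p)) (fst (fst p)) \<le> snd p}"
          using S.coupling_le T.coupling_le by (fastforce simp: infconv1_epi_def blinfun.add_right)
        show "closed {p::('a \<times> ('a \<Rightarrow>\<^sub>L real)) \<times> real. blinfun_apply (snd (fst p)) (fst (fst p)) \<le> snd p}"
          by (intro closed_Collect_le continuous_intros blinfun.continuous_on)
      qed
      then show "ereal (xs x) \<le> ereal r" if "h (x, xs) \<le> ereal r" for r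
        using that unfolding epi_iff[symmetric] epi_h by auto
    qed
    show "ereal (blinfun_apply xss xs) \<le> conj h (xs, xss)" for xs xss
    proof (rule ereal_le_real)
      fix r assume "conj h (xs, xss) \<le> ereal r"
      then obtain uss vss where uv: "uss + vss = xss" "conj hS (xs, uss) + conj hT (xs, vss) \<le> ereal r"
        using decompose by blast
      have "ereal (uss xs) + ereal (vss xs) \<le> conj hS (xs, uss) + conj hT (xs, vss)"
        by (intro add_mono S.conj_ge T.conj_ge)
      also note uv(2)
      finally show "ereal (xss xs) \<le> ereal r" by (simp flip: uv(1) add: blinfun.add_left)
    qed
  qed
  \<comment> \<open>Since \<open>uss + vss = canon x\<close>, the coupling \<open>xs x\<close>
    splits as \<open>uss xs + vss xs\<close>. Hence the conjugate of \<open>h\<close> touches the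
    coupling at \<open>canon x\<close> exactly if those of \<open>hS\<close> and \<open>hT\<close>
    do for some splitting, and type (D) reads the latter as membership in the Gossez
    closures.\<close>
  have contact: "contact = par_sum_bar S T"
  proof (intro set_eqI iffI; clarify)
    fix x xs assume "(x, xs) \<in> contact"
    then have "conj h (xs, canon x) \<le> ereal (xs x)" by (simp add: contact_iff_conj)
    then obtain uss vss where uv: "uss + vss = canon x" "conj hS (xs, uss) + conj hT (xs, vss) \<le> ereal (xs x)"
      using decompose by blast
    have "xs x = uss xs + vss xs" by (metis uv(1) blinfun.add_left canon_apply)
    with uv(2) have "conj hS (xs, uss) + conj hT (xs, vss) \<le> ereal (uss xs + vss xs)" by simp
    from ereal_add_contact[OF S.conj_ge T.conj_ge this] show "(x, xs) \<in> par_sum_bar S T"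
      using uv(1) gossez_iff_conj[OF hS mS(2)] gossez_iff_conj[OF hT mT(2)]
      unfolding par_sum_bar_def by blast
  next
    fix x xs assume "(x, xs) \<in> par_sum_bar S T"
    then obtain uss vss where uv: "uss + vss = canon x" "(uss, xs) \<in> gossez S" "(vss, xs) \<in> gossez T"
      by (auto simp: par_sum_bar_def)
    have "conj h (xs, uss + vss) \<le> ereal (uss xs + vss xs)"
      using uv by (intro conj_le) (simp_all add: gossez_iff_conj[OF hS mS(2)] gossez_iff_conj[OF hT mT(2)])
    moreover have "xs x = uss xs + vss xs" by (metis uv(1) blinfun.add_left canon_apply)
    ultimately show "(x, xs) \<in> contact" by (simp add: contact_iff_conj uv(1))
  qed
  note main = strong_representative_contact[unfolded contact, unfolded h_def] max_monotone_D_contact[unfolded contact]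
  show ?thesis
    by (intro conjI impI; (rule main)?) (simp_all add: main flip: par_sum_bar_eq_par_sum[OF mS(1) mT(1)])
qed

end
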